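(* Let $s\in\mathbb{C}\cup\{\infty\}$ and, for $t\in\mathbb{C}$, let $\mathcal{W}^{(s)}_t$ be the Lie algebra of vector fields with basis $\{V_n\mid n\in\mathbb{Z}\}$ defined in the context. Let $\widetilde c:\mathbb{C}\to\mathbb{C}$ be any non-vanishing algebraic function, let $R_t$ be any family of quadratic differentials varying algebraically with respect to $t$ (as described in the context), and let $\gamma_{R_t}$ be the residue $2$-cocycle on $\mathcal{W}^{(s)}_t$ defined in the context. Then the algebras $\widehat{\mathcal{W}^{(s)}_t}=\mathbb{C}\oplus\mathcal{W}^{(s)}_t$, with $\widehat{x}=(0,x)$, $c=(1,0)$ and bracket $$[\widehat{x},\widehat{y}]=\widehat{[x,y]}+\widetilde c(t)\,\gamma_{R_t}(x,y)\,c,\qquad [\widehat{x},c]=0,$$ form a family of centrally extended algebras which is a global deformation, over the affine line with coordinate $t$, of the Virasoro algebra: the Lie algebra over $t=0$ is (isomorphic to) the Virasoro algebra, the Lie algebras over the points $t\neq0$ are (for fixed $s$) mutually isomorphic, and the deformation is nontrivial (not equivalent to a trivial deformation). In particular the Virasoro algebra is not globally rigid. (For example, one may take $\widetilde c\equiv1$ and $R_t\equiv0$.)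
   Context: The Virasoro algebra is the complex Lie algebra with basis $\{l_n\mid n\in\mathbb{Z}\}\cup\{c\}$ and bracket $[l_n,l_m]=(m-n)l_{n+m}+\frac1{12}(m^3-m)\delta_{n,-m}c$, $[l_n,c]=0$. For $s\in\mathbb{C}$ put $(e_1,e_2,e_3)=(t,st,-(1+s)t)$; for $s=\infty$ put $(e_1,e_2,e_3)=(0,t,-t)$. Let $E_t$ be the (possibly singular) plane cubic $Y^2=f(X)$, $f(X)=4(X-e_1)(X-e_2)(X-e_3)$, with its nonsingular point $\infty=(0:1:0)$. $\mathcal{W}^{(s)}_t$ is the Lie algebra, under the bracket of vector fields $[a\frac{d}{dX},b\frac{d}{dX}]=(a\frac{db}{dX}-b\frac{da}{dX})\frac{d}{dX}$ (with $\frac{dY}{dX}=\frac{f'(X)}{2Y}$), with basis $$V_{2k+1}=(X-e_1)^kY\tfrac{d}{dX},\qquad V_{2k}=\tfrac12 f(X)(X-e_1)^{k-2}\tfrac{d}{dX},\qquad k\in\mathbb{Z}.$$ The structure constants in this basis are polynomials in $t$. The points where poles are allowed are $\infty$ and the point $(X,Y)=(e_1,0)$. Let $D=Y\frac{d}{dX}$ (that is, $D=d/dz$ for the flat coordinate $z$ with $dz=dX/Y$). The family $R_t$ consists of meromorphic quadratic differentials on $E_t$, written $R_t\,(dX/Y)^2$ with $R_t$ a rational function on $E_t$, which have poles only at $\infty$ and $(e_1,0)$ and which vary algebraically with $t$. For vector fields $x=E\,D$, $y=F\,D$ in $\mathcal{W}^{(s)}_t$, with $E,F$ rational functions on $E_t$,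 set $$\gamma_{R_t}(x,y)=-\frac1{12}\,\mathrm{Res}_{\infty}\Big(\Big(\tfrac12\big(D^3(E)\,F-E\,D^3(F)\big)-R_t\cdot\big(D(E)\,F-E\,D(F)\big)\Big)\frac{dX}{Y}\Big).$$ Let $A$ be a commutative $\mathbb{K}$-algebra with unit and augmentation $\epsilon:A\to\mathbb{K}$. A global deformation of a Lie algebra $\mathcal{L}$ over $\mathbb{K}$ with base $A$ is a Lie $A$-algebra structure on $A\otimes_{\mathbb{K}}\mathcal{L}$ such that $\epsilon\otimes\mathrm{id}:A\otimes\mathcal{L}\to\mathcal{L}$ is a Lie algebra homomorphism. Over the affine line, $A=\mathbb{C}[t]$ with base point given by $t\mapsto0$, and the Lie algebra over $t=\alpha$ is obtained by reducing structure constants modulo $(t-\alpha)$. The trivial deformation has $[1\otimes x,1\otimes y]=1\otimes[x,y]$. Two deformations with the same base are equivalent if there is a Lie $A$-algebra isomorphism between them compatible with $\epsilon\otimes\mathrm{id}$. $\mathcal{L}$ is globally rigid if every global deformation of it is equivalent to a trivial one. *)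

theory Defs
  imports
    Complex_Main
    "HOL-Library.Poly_Mapping"
    "HOL-Library.Product_Plus"
    "HOL-Computational_Algebra.Polynomial"
    "HOL-Computational_Algebra.Formal_Laurent_Series"
begin

section \<open>Lie algebras over commutative rings\<close>

record ('a, 'v) lie_struct =
  lscale :: "'a \<Rightarrow> 'v \<Rightarrow> 'v"
  lcarrier :: "'v set"
  lbracket :: "'v \<Rightarrow> 'v \<Rightarrow> 'v"

definition lie_algebra :: "('a::comm_ring_1, 'v::ab_group_add) lie_struct \<Rightarrow> bool" where
  "lie_algebra L \<longleftrightarrow>
     module (lscale L) \<and>
     module.subspace (lscale L) (lcarrier L) \<and>
     (\<forall>x\<in>lcarrier L. \<forall>y\<in>lcarrier L. lbracket L x y \<in> lcarrier L) \<and>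
     (\<forall>x\<in>lcarrier L. \<forall>y\<in>lcarrier L. \<forall>z\<in>lcarrier L.
        lbracket L (x + y) z = lbracket L x z + lbracket L y z \<and>
        lbracket L x (y + z) = lbracket L x y + lbracket L x z) \<and>
     (\<forall>a. \<forall>x\<in>lcarrier L. \<forall>y\<in>lcarrier L.
        lbracket L (lscale L a x) y = lscale L a (lbracket L x y) \<and>
        lbracket L x (lscale L a y) = lscale L a (lbracket L x y)) \<and>
     (\<forall>x\<in>lcarrier L. lbracket L x x = 0) \<and>
     (\<forall>x\<in>lcarrier L. \<forall>y\<in>lcarrier L. \<forall>z\<in>lcarrier L.
        lbracket L x (lbracket L y z) + lbracket L y (lbracket L z x)
          + lbracket L z (lbracket L x y) = 0)"

definition lie_iso ::
  "('a, 'v::ab_group_add) lie_struct \<Rightarrow> ('a, 'w::ab_group_add) lie_struct \<Rightarrow> ('v \<Rightarrow> 'w) \<Rightarrow> bool" where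
  "lie_iso L M \<phi> \<longleftrightarrow>
     bij_betw \<phi> (lcarrier L) (lcarrier M) \<and>
     (\<forall>x\<in>lcarrier L. \<forall>y\<in>lcarrier L. \<phi> (x + y) = \<phi> x + \<phi> y) \<and>
     (\<forall>a. \<forall>x\<in>lcarrier L. \<phi> (lscale L a x) = lscale M a (\<phi> x)) \<and>
     (\<forall>x\<in>lcarrier L. \<forall>y\<in>lcarrier L. \<phi> (lbracket L x y) = lbracket M (\<phi> x) (\<phi> y))"

definition lie_isomorphic ::
  "('a, 'v::ab_group_add) lie_struct \<Rightarrow> ('a, 'w::ab_group_add) lie_struct \<Rightarrow> bool" where
  "lie_isomorphic L M \<longleftrightarrow> (\<exists>\<phi>. lie_iso L M \<phi>)"

text \<open>A vector space over a field \<open>'k\<close> with a basis indexed by \<open>'b\<close> is represented by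
  \<open>'b \<Rightarrow>\<^sub>0 'k\<close>; its base change to a \<open>'k\<close>-algebra \<open>'a\<close>, the tensor product of \<open>'a\<close> with
  \<open>'b \<Rightarrow>\<^sub>0 'k\<close> over \<open>'k\<close>, is then the free module \<open>'b \<Rightarrow>\<^sub>0 'a\<close>.  For a ring homomorphism \<open>h\<close>
  the map \<open>h \<otimes> id\<close> is the coefficientwise map \<open>Poly_Mapping.map h\<close>.\<close>

definition pm_scale :: "'a::comm_ring_1 \<Rightarrow> ('b \<Rightarrow>\<^sub>0 'a) \<Rightarrow> ('b \<Rightarrow>\<^sub>0 'a)" where
  "pm_scale a x = Poly_Mapping.map (\<lambda>c. a * c) x"

definition free_lie ::
  "(('b \<Rightarrow>\<^sub>0 'a) \<Rightarrow> ('b \<Rightarrow>\<^sub>0 'a) \<Rightarrow> ('b \<Rightarrow>\<^sub>0 'a)) \<Rightarrow> ('a::comm_ring_1, 'b \<Rightarrow>\<^sub>0 'a) lie_struct" where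
  "free_lie br = \<lparr>lscale = pm_scale, lcarrier = UNIV, lbracket = br\<rparr>"

definition lin_ext ::
  "('a \<Rightarrow> 'v \<Rightarrow> 'v) \<Rightarrow> ('b \<Rightarrow> 'v) \<Rightarrow> ('b \<Rightarrow>\<^sub>0 'a::comm_ring_1) \<Rightarrow> 'v::ab_group_add" where
  "lin_ext scale v x = (\<Sum>i\<in>Poly_Mapping.keys x. scale (Poly_Mapping.lookup x i) (v i))"

definition bilin_ext ::
  "('b \<Rightarrow> 'b \<Rightarrow> ('b \<Rightarrow>\<^sub>0 'a)) \<Rightarrow> ('b \<Rightarrow>\<^sub>0 'a) \<Rightarrow> ('b \<Rightarrow>\<^sub>0 'a) \<Rightarrow> ('b \<Rightarrow>\<^sub>0 'a::comm_ring_1)" where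
  "bilin_ext str x y = lin_ext pm_scale (\<lambda>i. lin_ext pm_scale (str i) y) x"


section \<open>Global deformations\<close>

definition unital_ring_hom :: "('a::comm_ring_1 \<Rightarrow> 'b::comm_ring_1) \<Rightarrow> bool" where
  "unital_ring_hom h \<longleftrightarrow>
     h 1 = 1 \<and> (\<forall>x y. h (x + y) = h x + h y) \<and> (\<forall>x y. h (x * y) = h x * h y)"

definition augmented_algebra :: "('k::field \<Rightarrow> 'a::comm_ring_1) \<Rightarrow> ('a \<Rightarrow> 'k) \<Rightarrow> bool" where
  "augmented_algebra \<iota> \<epsilon> \<longleftrightarrow> unital_ring_hom \<iota> \<and> unital_ring_hom \<epsilon> \<and> (\<forall>c. \<epsilon> (\<iota> c) = c)"

definition global_deformation ::
  "('k::field \<Rightarrow> 'a::comm_ring_1) \<Rightarrow> ('a \<Rightarrow> 'k) \<Rightarrow>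
   (('b \<Rightarrow>\<^sub>0 'k) \<Rightarrow> ('b \<Rightarrow>\<^sub>0 'k) \<Rightarrow> ('b \<Rightarrow>\<^sub>0 'k)) \<Rightarrow>
   (('b \<Rightarrow>\<^sub>0 'a) \<Rightarrow> ('b \<Rightarrow>\<^sub>0 'a) \<Rightarrow> ('b \<Rightarrow>\<^sub>0 'a)) \<Rightarrow> bool" where
  "global_deformation \<iota> \<epsilon> L br \<longleftrightarrow>
     augmented_algebra \<iota> \<epsilon> \<and> lie_algebra (free_lie L) \<and> lie_algebra (free_lie br) \<and>
     (\<forall>x y. Poly_Mapping.map \<epsilon> (br x y) = L (Poly_Mapping.map \<epsilon> x) (Poly_Mapping.map \<epsilon> y))"

definition trivial_deformation ::
  "('k::field \<Rightarrow> 'a::comm_ring_1) \<Rightarrow>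
   (('b \<Rightarrow>\<^sub>0 'k) \<Rightarrow> ('b \<Rightarrow>\<^sub>0 'k) \<Rightarrow> ('b \<Rightarrow>\<^sub>0 'k)) \<Rightarrow>
   (('b \<Rightarrow>\<^sub>0 'a) \<Rightarrow> ('b \<Rightarrow>\<^sub>0 'a) \<Rightarrow> ('b \<Rightarrow>\<^sub>0 'a))" where
  "trivial_deformation \<iota> L =
     bilin_ext (\<lambda>i j. Poly_Mapping.map \<iota> (L (Poly_Mapping.single i 1) (Poly_Mapping.single j 1)))"

definition equivalent_deformations ::
  "('a::comm_ring_1 \<Rightarrow> 'k::field) \<Rightarrow>
   (('b \<Rightarrow>\<^sub>0 'a) \<Rightarrow> ('b \<Rightarrow>\<^sub>0 'a) \<Rightarrow> ('b \<Rightarrow>\<^sub>0 'a)) \<Rightarrow>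
   (('b \<Rightarrow>\<^sub>0 'a) \<Rightarrow> ('b \<Rightarrow>\<^sub>0 'a) \<Rightarrow> ('b \<Rightarrow>\<^sub>0 'a)) \<Rightarrow> bool" where
  "equivalent_deformations \<epsilon> br br' \<longleftrightarrow>
     (\<exists>\<phi>. lie_iso (free_lie br) (free_lie br') \<phi> \<and>
          (\<forall>x. Poly_Mapping.map \<epsilon> (\<phi> x) = Poly_Mapping.map \<epsilon> x))"

text \<open>A formula of HOL cannot quantify over types, so the ring underlying the base algebra is a
  type parameter: global rigidity of \<open>L\<close> means \<open>globally_rigid TYPE('a) L\<close> for every \<open>'a\<close>, and
  it fails as soon as \<open>globally_rigid TYPE('a) L\<close> fails for one \<open>'a\<close>.\<close>

definition globally_rigid ::
  "'a::comm_ring_1 itself \<Rightarrow>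
   (('b \<Rightarrow>\<^sub>0 'k::field) \<Rightarrow> ('b \<Rightarrow>\<^sub>0 'k) \<Rightarrow> ('b \<Rightarrow>\<^sub>0 'k)) \<Rightarrow> bool" where
  "globally_rigid _ L \<longleftrightarrow>
     (\<forall>(\<iota> :: 'k \<Rightarrow> 'a) \<epsilon> br. global_deformation \<iota> \<epsilon> L br \<longrightarrow>
        equivalent_deformations \<epsilon> br (trivial_deformation \<iota> L))"

text \<open>Specialisation of the structure constants at the point \<open>t = \<alpha>\<close> of the affine line.\<close>

definition fibre ::
  "(('b \<Rightarrow>\<^sub>0 complex poly) \<Rightarrow> ('b \<Rightarrow>\<^sub>0 complex poly) \<Rightarrow> ('b \<Rightarrow>\<^sub>0 complex poly)) \<Rightarrow> complex \<Rightarrow>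
   (('b \<Rightarrow>\<^sub>0 complex) \<Rightarrow> ('b \<Rightarrow>\<^sub>0 complex) \<Rightarrow> ('b \<Rightarrow>\<^sub>0 complex))" where
  "fibre br \<alpha> x y =
     Poly_Mapping.map (\<lambda>p. poly p \<alpha>)
       (br (Poly_Mapping.map (\<lambda>c. [:c:]) x) (Poly_Mapping.map (\<lambda>c. [:c:]) y))"


section \<open>The Virasoro algebra\<close>

datatype vir_basis = Ell int | Cen

fun vir_str :: "vir_basis \<Rightarrow> vir_basis \<Rightarrow> (vir_basis \<Rightarrow>\<^sub>0 complex)" where
  "vir_str (Ell n) (Ell m) =
     Poly_Mapping.single (Ell (n + m)) (of_int (m - n)) +
     (if n = - m then Poly_Mapping.single Cen (of_int (m ^ 3 - m) / 12) else 0)"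
| "vir_str Cen _ = 0"
| "vir_str _ Cen = 0"

definition virasoro ::
  "(vir_basis \<Rightarrow>\<^sub>0 complex) \<Rightarrow> (vir_basis \<Rightarrow>\<^sub>0 complex) \<Rightarrow> (vir_basis \<Rightarrow>\<^sub>0 complex)" where
  "virasoro = bilin_ext vir_str"


section \<open>The cubic curves\<close>

datatype proj_line = Finite complex | Infinity

fun e1 :: "proj_line \<Rightarrow> complex \<Rightarrow> complex" where
  "e1 (Finite s) t = t" | "e1 Infinity t = 0"

fun e2 :: "proj_line \<Rightarrow> complex \<Rightarrow> complex" where
  "e2 (Finite s) t = s * t" | "e2 Infinity t = t"

fun e3 :: "proj_line \<Rightarrow> complex \<Rightarrow> complex" where
  "e3 (Finite s) t = - ((1 + s) * t)" | "e3 Infinity t = - t"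

text \<open>The plane cubic \<open>Y\<^sup>2 = f(X)\<close> is irreducible and nonsingular at its point at infinity, so
  a rational function on it is determined by its Laurent expansion there.  We identify the
  function field with its image in \<open>complex fls\<close>, with respect to the local parameter \<open>\<tau>\<close>
  (written \<open>fls_X\<close>) for which \<open>X = \<tau>\<^sup>-\<^sup>2\<close> and
  \<open>Y = 2 \<tau>\<^sup>-\<^sup>3 sqrt ((1 - e1 \<tau>\<^sup>2) (1 - e2 \<tau>\<^sup>2) (1 - e3 \<tau>\<^sup>2))\<close>.\<close>

definition cX :: "complex fls" where
  "cX = fls_X powi (-2)"

definition cY :: "proj_line \<Rightarrow> complex \<Rightarrow> complex fls" where
  "cY s t = 2 * fls_X powi (-3) *
     fps_to_fls (fps_radical (\<lambda>_. csqrt) 2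
       ((1 - fps_const (e1 s t) * fps_X ^ 2) *
        (1 - fps_const (e2 s t) * fps_X ^ 2) *
        (1 - fps_const (e3 s t) * fps_X ^ 2)))"

definition cf :: "proj_line \<Rightarrow> complex \<Rightarrow> complex fls" where
  "cf s t = 4 * (cX - fls_const (e1 s t)) * (cX - fls_const (e2 s t)) * (cX - fls_const (e3 s t))"

lemma cY_square: "cY s t ^ 2 = cf s t"
proof -
  let ?g = "(1 - fps_const (e1 s t) * fps_X ^ 2) *
        (1 - fps_const (e2 s t) * fps_X ^ 2) *
        (1 - fps_const (e3 s t) * fps_X ^ 2) :: complex fps"
  let ?T = "fls_X :: complex fls"
  have g0: "?g $ 0 = 1" by simp
  have "(csqrt (?g $ 0)) ^ Suc 1 = ?g $ 0 \<longleftrightarrow>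
        (fps_radical (\<lambda>_. csqrt) (Suc 1) ?g) ^ (Suc 1) = ?g"
    by (rule power_radical) (simp_all add: g0)
  then have rad: "(fps_radical (\<lambda>_. csqrt) 2 ?g) ^ 2 = ?g"
    by (simp add: g0 numeral_2_eq_2)
  have T: "?T \<noteq> 0" by simp
  have scaling: "4 * (x powi (-3)) ^ 2 * ((1 - a * x ^ 2) * (1 - b * x ^ 2) * (1 - c * x ^ 2)) =
      4 * (x powi (-2) - a) * (x powi (-2) - b) * (x powi (-2) - c)"
    if "x \<noteq> 0" for x a b c :: "complex fls"
    using that by (simp add: power_int_minus divide_simps power_numeral_reduce)
  have "cY s t ^ 2 = 4 * (?T powi (-3)) ^ 2 * fps_to_fls ?g"
    unfolding cY_def power_mult_distrib fps_to_fls_power [symmetric] rad by simp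
  also have "fps_to_fls ?g = (1 - fls_const (e1 s t) * ?T ^ 2) *
      (1 - fls_const (e2 s t) * ?T ^ 2) * (1 - fls_const (e3 s t) * ?T ^ 2)"
    by (simp add: fls_times_fps_to_fls fps_to_fls_power)
  also have "4 * (?T powi (-3)) ^ 2 * \<dots> = cf s t"
    unfolding cf_def cX_def by (rule scaling [OF T])
  finally show ?thesis .
qed

text \<open>The derivation \<open>d/dX\<close> of the function field (hence \<open>dY/dX = f'(X) / (2 Y)\<close>), the
  derivation \<open>D = Y d/dX\<close>, and the residue at infinity of the differential \<open>g dX/Y\<close>.\<close>

definition ddX :: "complex fls \<Rightarrow> complex fls" where
  "ddX g = fls_deriv g / fls_deriv cX"

definition cD :: "proj_line \<Rightarrow> complex \<Rightarrow> complex fls \<Rightarrow> complex fls" where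
  "cD s t g = cY s t * ddX g"

definition res_inf :: "proj_line \<Rightarrow> complex \<Rightarrow> complex fls \<Rightarrow> complex" where
  "res_inf s t g = fls_residue (g / cY s t * fls_deriv cX)"


section \<open>The vector field algebras and their central extensions\<close>

text \<open>The vector field \<open>a d/dX\<close> is represented by the function \<open>a\<close>; thus \<open>a d/dX = (a / Y) D\<close>.\<close>

definition fls_scale :: "complex \<Rightarrow> complex fls \<Rightarrow> complex fls" where
  "fls_scale a g = fls_const a * g"

definition vf_bracket :: "complex fls \<Rightarrow> complex fls \<Rightarrow> complex fls" where
  "vf_bracket a b = a * ddX b - b * ddX a"

definition V :: "proj_line \<Rightarrow> complex \<Rightarrow> int \<Rightarrow> complex fls" where
  "V s t n =
     (if odd n then (cX - fls_const (e1 s t)) powi ((n - 1) div 2) * cY s t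
      else 1 / 2 * cf s t * (cX - fls_const (e1 s t)) powi (n div 2 - 2))"

definition W :: "proj_line \<Rightarrow> complex \<Rightarrow> complex fls set" where
  "W s t = module.span fls_scale (range (V s t))"

definition gamma ::
  "proj_line \<Rightarrow> complex \<Rightarrow> complex fls \<Rightarrow> complex fls \<Rightarrow> complex fls \<Rightarrow> complex" where
  "gamma s t R x y =
     (let D = cD s t; E = x / cY s t; F = y / cY s t in
        - (1 / 12) * res_inf s t
            (1 / 2 * (D (D (D E)) * F - E * D (D (D F))) - R * (D E * F - E * D F)))"

definition W_hat ::
  "proj_line \<Rightarrow> (complex \<Rightarrow> complex) \<Rightarrow> (complex \<Rightarrow> complex fls) \<Rightarrow> complex \<Rightarrow>
   (complex, complex \<times> complex fls) lie_struct" where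
  "W_hat s ct R t =
     \<lparr>lscale = (\<lambda>a (z, x). (a * z, fls_scale a x)),
      lcarrier = UNIV \<times> W s t,
      lbracket = (\<lambda>(_, x) (_, y). (ct t * gamma s t (R t) x y, vf_bracket x y))\<rparr>"

fun W_hat_basis :: "proj_line \<Rightarrow> complex \<Rightarrow> vir_basis \<Rightarrow> complex \<times> complex fls" where
  "W_hat_basis s t (Ell n) = (0, V s t n)"
| "W_hat_basis s t Cen = (1, 0)"


section \<open>Algebraic dependence on the parameter\<close>

definition regular_function :: "(complex \<Rightarrow> complex) \<Rightarrow> bool" where
  "regular_function h \<longleftrightarrow> (\<exists>p. \<forall>t. h t = poly p t)"

text \<open>Value at the parameter \<open>t\<close> of a polynomial in \<open>X\<close> with coefficients in \<open>\<complex>[t]\<close>.\<close>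

definition poly_at :: "complex poly poly \<Rightarrow> complex \<Rightarrow> complex fls" where
  "poly_at P t = poly (map_poly (\<lambda>p. fls_const (poly p t)) P) cX"

text \<open>On the affine curve the function \<open>X - e1\<close> vanishes exactly at \<open>(e1, 0)\<close>.  Hence the
  functions whose only poles are at infinity and \<open>(e1, 0)\<close> are the elements of the coordinate
  ring \<open>\<complex>[X, Y] / (Y\<^sup>2 - f)\<close> localised at \<open>X - e1\<close>; for a family the constants are replaced by
  \<open>\<complex>[t]\<close>.\<close>

definition algebraic_family :: "proj_line \<Rightarrow> (complex \<Rightarrow> complex fls) \<Rightarrow> bool" where
  "algebraic_family s R \<longleftrightarrow>
     (\<exists>P Q N. \<forall>t. R t = (poly_at P t + poly_at Q t * cY s t) / (cX - fls_const (e1 s t)) ^ N)"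

lemma algebraic_family_zero: "algebraic_family s (\<lambda>_. 0)"
  unfolding algebraic_family_def
  by (rule exI [of _ 0], rule exI [of _ 0]) (simp add: poly_at_def)

end

theory Submission
  imports Defs "HOL-Computational_Algebra.Fundamental_Theorem_Algebra"
begin

text \<open>
  Put \<open>x = X - e\<^sub>1\<close>. The curve is \<open>Y\<^sup>2 = 4 x (x\<^sup>2 + p x + q)\<close>, where
  \<open>p = \<alpha> t\<close> and \<open>q = \<beta> t\<^sup>2\<close> with constants \<open>\<alpha>, \<beta>\<close> that depend on \<open>s\<close> and
  are not both zero. A computation in the function field expresses \<open>[V\<^sub>n, V\<^sub>m]\<close> by
  \<open>V\<^sub>n\<^sub>+\<^sub>m\<close>, \<open>p V\<^sub>n\<^sub>+\<^sub>m\<^sub>-\<^sub>2\<close> and \<open>q V\<^sub>n\<^sub>+\<^sub>m\<^sub>-\<^sub>4\<close> with integer coefficients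
  (\<open>V_bracket\<close>).

  The cocycle property of \<open>\<gamma>\<close> holds because the cyclic sum of the differentials
  involved is exact (\<open>third_order_cocycle\<close>, \<open>gamma_cocycle\<close>). The quadratic
  differential \<open>R\<close> only adds the coboundary \<open>\<psi>([x, y])\<close> (\<open>gamma_coboundary\<close>), and for
  \<open>R = 0\<close> the residues are explicit polynomials in \<open>p\<close> and \<open>q\<close>, homogeneous of weight
  \<open>n + m\<close> when \<open>p\<close> has weight 2 and \<open>q\<close> has weight 4 (\<open>gamma_V\<close>,
  \<open>cocycle_coeff_homogeneous\<close>). A non-vanishing polynomial function is constant, so after the
  base change \<open>V\<^sub>n \<mapsto> l\<^sub>n + \<psi>(V\<^sub>n) c\<close> and a rescaling of \<open>c\<close> the family depends
  neither on \<open>R\<close> nor on the function scaling the cocycle (\<open>family_iso_std\<close>). The resulting standard family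
  specialises to the Virasoro algebra for \<open>p = q = 0\<close>. The substitution
  \<open>V\<^sub>n \<mapsto> r\<^sup>n V\<^sub>n\<close> replaces \<open>(p, q)\<close> by \<open>(r\<^sup>2 p, r\<^sup>4 q)\<close>, and \<open>r\<^sup>2 = 1 / t\<close> identifies all
  fibres with \<open>t \<noteq> 0\<close> (\<open>hat_iso_std\<close>).

  Nontriviality rests on local finiteness. In the trivial family \<open>ad l\<^sub>0\<close> is diagonal, so
  under an equivalence the preimage \<open>h\<close> of \<open>l\<^sub>0\<close> becomes over \<open>t = 1\<close> an element for which
  the iterates of \<open>ad h\<close> on any vector have supports in one finite set. Expanding vector
  fields at a point where poles are allowed, the bracket with a field of order at most 0
  strictly lowers the order of a field that has a pole of high order there; hence
  \<open>h\<close> must vanish at infinity and at \<open>(e\<^sub>1, 0)\<close>, on each branch if this point is a node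
  (\<open>loc_finite_vanishes\<close>). At infinity this excludes every \<open>V\<^sub>n\<close> with \<open>n > 0\<close> from \<open>h\<close>,
  and at \<open>(e\<^sub>1, 0)\<close> every \<open>V\<^sub>n\<close> with \<open>n \<le> 0\<close>, as \<open>(p, q) \<noteq> (0, 0)\<close>. So \<open>h\<close> is
  central over \<open>t = 1\<close> (\<open>loc_finite_central\<close>), although \<open>[l\<^sub>0, l\<^sub>1] = l\<^sub>1\<close>: the preimage of
  \<open>l\<^sub>1\<close> would be divisible by \<open>t - 1\<close>, which is impossible.
\<close>

section \<open>Free modules, base change and bilinear extension\<close>

lemma lookup_map0:
  assumes "h 0 = 0"
  shows "Poly_Mapping.lookup (Poly_Mapping.map h x) i = h (Poly_Mapping.lookup x i)"
  using assms by (simp add: map.rep_eq when_def)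

lemma lookup_pm_scale [simp]:
  "Poly_Mapping.lookup (pm_scale a x) i = a * Poly_Mapping.lookup x i"
  unfolding pm_scale_def by (rule lookup_map0) simp

lemma module_pm_scale: "module (pm_scale :: 'a::comm_ring_1 \<Rightarrow> ('b \<Rightarrow>\<^sub>0 'a) \<Rightarrow> _)"
  by unfold_locales (rule poly_mapping_eqI, simp add: lookup_add algebra_simps)+

lemma lin_ext_superset:
  assumes "module sc" "finite S" "Poly_Mapping.keys x \<subseteq> S"
  shows "lin_ext sc v x = (\<Sum>i\<in>S. sc (Poly_Mapping.lookup x i) (v i))"
proof -
  interpret module sc by fact
  show ?thesis unfolding lin_ext_def
    by (rule sum.mono_neutral_left) (use assms in \<open>auto simp: in_keys_iff\<close>)
qed

lemma module_hom_lin_ext: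
  assumes "module sc"
  shows "module_hom pm_scale sc (lin_ext sc v)"
proof -
  interpret module sc by fact
  interpret pm: module "pm_scale :: 'a \<Rightarrow> ('c \<Rightarrow>\<^sub>0 'a) \<Rightarrow> _" by (rule module_pm_scale)
  show ?thesis
  proof unfold_locales
    fix x y :: "'c \<Rightarrow>\<^sub>0 'a" and r :: 'a
    let ?S = "Poly_Mapping.keys x \<union> Poly_Mapping.keys y"
    have "Poly_Mapping.keys (x + y) \<subseteq> ?S" by (rule Poly_Mapping.keys_add)
    then show "lin_ext sc v (x + y) = lin_ext sc v x + lin_ext sc v y"
      by (simp add: lin_ext_superset [OF assms, where S = ?S] lookup_add scale_left_distrib
          sum.distrib)
    have "Poly_Mapping.keys (pm_scale r x) \<subseteq> Poly_Mapping.keys x" by (auto simp: in_keys_iff)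
    then show "lin_ext sc v (pm_scale r x) = sc r (lin_ext sc v x)"
      by (simp add: lin_ext_superset [OF assms, where S = "Poly_Mapping.keys x"] scale_sum_right)
  qed
qed

lemmas lin_ext_add = module_hom.add [OF module_hom_lin_ext]
lemmas lin_ext_scale = module_hom.scale [OF module_hom_lin_ext]
lemmas lin_ext_zero = module_hom.zero [OF module_hom_lin_ext]
lemmas lin_ext_sum = module_hom.sum [OF module_hom_lin_ext]

lemma lin_ext_single:
  assumes "module sc"
  shows "lin_ext sc v (Poly_Mapping.single i a) = sc a (v i)"
proof -
  interpret module sc by fact
  show ?thesis unfolding lin_ext_def by (cases "a = 0") auto
qed

lemma lookup_lin_ext:
  "Poly_Mapping.lookup (lin_ext pm_scale v x) k =
     (\<Sum>i\<in>Poly_Mapping.keys x. Poly_Mapping.lookup x i * Poly_Mapping.lookup (v i) k)"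
  by (simp add: lin_ext_def lookup_sum)

lemma lin_ext_basis: "lin_ext pm_scale (\<lambda>i. Poly_Mapping.single i 1) x = x"
  by (rule poly_mapping_eqI)
     (auto simp: lookup_lin_ext lookup_single when_def in_keys_iff sum.delta' if_distrib cong: if_cong)

lemma lin_ext_lin_ext:
  assumes "module sc"
  shows "lin_ext sc v (lin_ext pm_scale w x) = lin_ext sc (\<lambda>i. lin_ext sc v (w i)) x"
  unfolding lin_ext_def [of pm_scale w] lin_ext_def [of sc "\<lambda>i. lin_ext sc v (w i)"]
  by (simp add: lin_ext_sum [OF assms] lin_ext_scale [OF assms])

lemma bilin_ext_hom_left: "module_hom pm_scale pm_scale (\<lambda>x. bilin_ext str x y)"
  unfolding bilin_ext_def by (rule module_hom_lin_ext [OF module_pm_scale])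

lemma lookup_bilin_ext:
  "Poly_Mapping.lookup (bilin_ext str x y) k =
     (\<Sum>i\<in>Poly_Mapping.keys x. \<Sum>j\<in>Poly_Mapping.keys y.
        Poly_Mapping.lookup x i * Poly_Mapping.lookup y j * Poly_Mapping.lookup (str i j) k)"
  by (simp add: bilin_ext_def lookup_lin_ext sum_distrib_left mult_ac)

lemma bilin_ext_flip: "bilin_ext str x y = bilin_ext (\<lambda>i j. str j i) y x"
  by (rule poly_mapping_eqI, simp add: lookup_bilin_ext, subst sum.swap)
     (simp add: mult_ac)

lemma bilin_ext_hom_right: "module_hom pm_scale pm_scale (\<lambda>y. bilin_ext str x y)"
  unfolding bilin_ext_flip [of str x, abs_def] by (rule bilin_ext_hom_left)

lemma bilin_ext_single:
  "bilin_ext str (Poly_Mapping.single i a) (Poly_Mapping.single j b) = pm_scale (a * b) (str i j)"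
proof -
  interpret module "pm_scale :: 'b \<Rightarrow> ('a \<Rightarrow>\<^sub>0 'b) \<Rightarrow> _" by (rule module_pm_scale)
  show ?thesis by (simp add: bilin_ext_def lin_ext_single module_pm_scale)
qed

lemma unital_ring_hom_0: "unital_ring_hom h \<Longrightarrow> h 0 = 0"
  unfolding unital_ring_hom_def by (metis add_cancel_right_right)

lemma unital_ring_hom_sum: "unital_ring_hom h \<Longrightarrow> h (sum f S) = (\<Sum>i\<in>S. h (f i))"
  by (induction S rule: infinite_finite_induct)
     (auto simp: unital_ring_hom_0, auto simp: unital_ring_hom_def)

lemma lookup_bilin_ext_superset:
  assumes "finite S" "finite T" "Poly_Mapping.keys x \<subseteq> S" "Poly_Mapping.keys y \<subseteq> T"
  shows "Poly_Mapping.lookup (bilin_ext str x y) k =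
     (\<Sum>i\<in>S. \<Sum>j\<in>T.
        Poly_Mapping.lookup x i * Poly_Mapping.lookup y j * Poly_Mapping.lookup (str i j) k)"
proof -
  have "bilin_ext str x y = (\<Sum>i\<in>S. pm_scale (Poly_Mapping.lookup x i)
      (\<Sum>j\<in>T. pm_scale (Poly_Mapping.lookup y j) (str i j)))"
    unfolding bilin_ext_def
    by (simp add: lin_ext_superset [OF module_pm_scale, where S = S]
         lin_ext_superset [OF module_pm_scale, where S = T] assms)
  then show ?thesis by (simp add: lookup_sum sum_distrib_left mult_ac)
qed

text \<open>Base change of structure constants along a ring homomorphism.\<close>

lemma map_bilin_ext:
  assumes h: "unital_ring_hom h"
  shows "Poly_Mapping.map h (bilin_ext str x y) =
     bilin_ext (\<lambda>i j. Poly_Mapping.map h (str i j)) (Poly_Mapping.map h x) (Poly_Mapping.map h y)"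
proof (rule poly_mapping_eqI)
  fix k
  note l = lookup_map0 [of h, OF unital_ring_hom_0 [OF h]]
  have *: "Poly_Mapping.keys (Poly_Mapping.map h z) \<subseteq> Poly_Mapping.keys z" for z :: "'c \<Rightarrow>\<^sub>0 'a"
    using unital_ring_hom_0 [OF h] by (auto simp: in_keys_iff l)
  have m: "h (a * b) = h a * h b" for a b using h by (simp add: unital_ring_hom_def)
  have "Poly_Mapping.lookup (bilin_ext (\<lambda>i j. Poly_Mapping.map h (str i j)) (Poly_Mapping.map h x)
      (Poly_Mapping.map h y)) k = (\<Sum>i\<in>Poly_Mapping.keys x. \<Sum>j\<in>Poly_Mapping.keys y.
      h (Poly_Mapping.lookup x i) * h (Poly_Mapping.lookup y j) * h (Poly_Mapping.lookup (str i j) k))"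
    by (subst lookup_bilin_ext_superset [OF _ _ * *]) (simp_all add: l)
  then show "Poly_Mapping.lookup (Poly_Mapping.map h (bilin_ext str x y)) k =
    Poly_Mapping.lookup (bilin_ext (\<lambda>i j. Poly_Mapping.map h (str i j)) (Poly_Mapping.map h x)
      (Poly_Mapping.map h y)) k"
    by (simp add: l lookup_bilin_ext unital_ring_hom_sum [OF h] m)
qed

lemma unital_ring_hom_poly: "unital_ring_hom (\<lambda>p. poly p a)"
  by (simp add: unital_ring_hom_def)

lemma unital_ring_hom_const: "unital_ring_hom (\<lambda>c. [:c:])"
  by (simp add: unital_ring_hom_def)

lemma pm_map_poly_const [simp]:
  "Poly_Mapping.map (\<lambda>p. poly p a) (Poly_Mapping.map (\<lambda>c. [:c:]) x) = x"
  by (rule poly_mapping_eqI) (simp add: lookup_map0)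

lemma pm_map_add:
  "unital_ring_hom h \<Longrightarrow> Poly_Mapping.map h (x + y) = Poly_Mapping.map h x + Poly_Mapping.map h y"
  by (rule poly_mapping_eqI)
     (simp add: lookup_map0 unital_ring_hom_0 lookup_add, simp add: unital_ring_hom_def)

lemma pm_map_single:
  "h 0 = 0 \<Longrightarrow> Poly_Mapping.map h (Poly_Mapping.single i a) = Poly_Mapping.single i (h a)"
  by (rule poly_mapping_eqI) (simp add: lookup_map0 lookup_single when_def)

lemma pm_map_zero: "h 0 = 0 \<Longrightarrow> Poly_Mapping.map h 0 = 0"
  by (rule poly_mapping_eqI) (simp add: lookup_map0)

text \<open>A vector with polynomial coordinates that vanishes at every point of the affine line is
  zero. So identities in a family can be checked on its fibres.\<close>

lemma poly_pm_eq_0: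
  fixes x :: "'b \<Rightarrow>\<^sub>0 complex poly"
  assumes "\<And>t. Poly_Mapping.map (\<lambda>p. poly p t) x = 0"
  shows "x = 0"
proof (rule poly_mapping_eqI)
  fix k
  have "poly (Poly_Mapping.lookup x k) t = 0" for t
    using lookup_map0 [of "\<lambda>p. poly p t" x k] assms [of t] by simp
  then show "Poly_Mapping.lookup x k = Poly_Mapping.lookup 0 k"
    using poly_all_0_iff_0 by auto
qed

lemma fibre_bilin_ext:
  "fibre (bilin_ext str) t = bilin_ext (\<lambda>i j. Poly_Mapping.map (\<lambda>p. poly p t) (str i j))"
  by (intro ext) (simp add: fibre_def map_bilin_ext unital_ring_hom_poly)

section \<open>Lie algebras given by structure constants\<close>

lemma lie_algebra_free_iff:
  fixes str :: "'b \<Rightarrow> 'b \<Rightarrow> ('b \<Rightarrow>\<^sub>0 'a::comm_ring_1)"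
  shows "lie_algebra (free_lie (bilin_ext str)) \<longleftrightarrow>
     (\<forall>x. bilin_ext str x x = 0) \<and>
     (\<forall>x y z. bilin_ext str x (bilin_ext str y z) + bilin_ext str y (bilin_ext str z x)
        + bilin_ext str z (bilin_ext str x y) = 0)"
proof -
  interpret pm: module "pm_scale :: 'a \<Rightarrow> ('b \<Rightarrow>\<^sub>0 'a) \<Rightarrow> _" by (rule module_pm_scale)
  show ?thesis
    unfolding lie_algebra_def free_lie_def lie_struct.simps
    by (simp add: module_pm_scale pm.subspace_UNIV
          module_hom.add [OF bilin_ext_hom_left] module_hom.add [OF bilin_ext_hom_right]
          module_hom.scale [OF bilin_ext_hom_left] module_hom.scale [OF bilin_ext_hom_right])
qed

text \<open>A basis of a Lie algebra with structure constants \<open>str\<close> gives an isomorphism from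
  the free module with the bracket defined by \<open>str\<close>.\<close>

lemma lie_iso_lin_ext:
  fixes L :: "('a::comm_ring_1, 'v::ab_group_add) lie_struct"
  assumes L: "lie_algebra L"
    and bij: "bij_betw (lin_ext (lscale L) b) UNIV (lcarrier L)"
    and br: "\<And>i j. lbracket L (b i) (b j) = lin_ext (lscale L) b (str i j)"
  shows "lie_iso (free_lie (bilin_ext str)) L (lin_ext (lscale L) b)"
proof -
  let ?l = "lin_ext (lscale L) b"
  have m: "module (lscale L)" and sub: "module.subspace (lscale L) (lcarrier L)"
    using L by (auto simp: lie_algebra_def)
  interpret module "lscale L" by (rule m)
  have inC: "?l x \<in> lcarrier L" for x using bij by (auto simp: bij_betw_def)
  have bC: "b i \<in> lcarrier L" for i
    using inC [of "Poly_Mapping.single i 1"] by (simp add: lin_ext_single m)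
  have sumC: "(\<Sum>i\<in>S. lscale L (c i) (b i)) \<in> lcarrier L" for c S
    by (intro subspace_sum [OF sub] subspace_scale [OF sub] bC)
  have suml: "lbracket L (\<Sum>i\<in>S. lscale L (c i) (b i)) y = (\<Sum>i\<in>S. lscale L (c i) (lbracket L (b i) y))"
    if "y \<in> lcarrier L" for c S y
  proof (induction S rule: infinite_finite_induct)
    case (insert i S)
    then show ?case using L that bC sumC subspace_scale [OF sub bC]
      by (simp add: lie_algebra_def)
  next
    case empty
    have "lbracket L (lscale L 0 0) y = lscale L 0 (lbracket L 0 y)"
      using L that subspace_0 [OF sub] unfolding lie_algebra_def by blast
    then show ?case by simp
  next
    case (infinite S)
    have "lbracket L (lscale L 0 0) y = lscale L 0 (lbracket L 0 y)"
      using L that subspace_0 [OF sub] unfolding lie_algebra_def by blast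
    with infinite show ?case by simp
  qed
  have sumr: "lbracket L y (\<Sum>i\<in>S. lscale L (c i) (b i)) = (\<Sum>i\<in>S. lscale L (c i) (lbracket L y (b i)))"
    if "y \<in> lcarrier L" for c S y
  proof (induction S rule: infinite_finite_induct)
    case (insert i S)
    then show ?case using L that bC sumC subspace_scale [OF sub bC]
      by (simp add: lie_algebra_def)
  next
    case empty
    have "lbracket L y (lscale L 0 0) = lscale L 0 (lbracket L y 0)"
      using L that subspace_0 [OF sub] unfolding lie_algebra_def by blast
    then show ?case by simp
  next
    case (infinite S)
    have "lbracket L y (lscale L 0 0) = lscale L 0 (lbracket L y 0)"
      using L that subspace_0 [OF sub] unfolding lie_algebra_def by blast
    with infinite show ?case by simp
  qed
  have "?l (bilin_ext str x y) = lbracket L (?l x) (?l y)" for x y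
  proof -
    have "?l (bilin_ext str x y) = lin_ext (lscale L) (\<lambda>i. lin_ext (lscale L) (\<lambda>j. lbracket L (b i) (b j)) y) x"
      unfolding bilin_ext_def by (simp add: lin_ext_lin_ext m br)
    also have "\<dots> = lbracket L (?l x) (?l y)"
      unfolding lin_ext_def by (simp add: suml [OF sumC] sumr [OF bC])
    finally show ?thesis .
  qed
  then show ?thesis
    unfolding lie_iso_def free_lie_def using bij
    by (simp add: lin_ext_add [OF m] lin_ext_scale [OF m])
qed

text \<open>The bracket defined by \<open>str\<close> need not be known to satisfy the Jacobi identity in
  advance: a bijection onto a Lie algebra that respects the operations suffices.\<close>

lemma lie_algebra_free_transfer:
  assumes L: "lie_algebra L" and iso: "lie_iso (free_lie (bilin_ext str)) L \<phi>"
  shows "lie_algebra (free_lie (bilin_ext str))"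
proof -
  let ?B = "bilin_ext str"
  interpret module "lscale L" using L by (simp add: lie_algebra_def)
  have add: "\<phi> (x + y) = \<phi> x + \<phi> y" and br: "\<phi> (?B x y) = lbracket L (\<phi> x) (\<phi> y)"
    and inC: "\<phi> x \<in> lcarrier L" and inj: "\<phi> x = \<phi> y \<Longrightarrow> x = y" for x y
    using iso by (auto simp: lie_iso_def free_lie_def bij_betw_def inj_on_def)
  have z: "\<phi> 0 = 0" using add [of 0 0] by simp
  show ?thesis
    unfolding lie_algebra_free_iff
  proof (intro conjI allI)
    show "?B x x = 0" for x
      by (rule inj) (use L inC in \<open>auto simp: br z lie_algebra_def\<close>)
    show "?B x (?B y z) + ?B y (?B z x) + ?B z (?B x y) = 0" for x y z
      by (rule inj) (use L inC in \<open>auto simp: br add z lie_algebra_def\<close>)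
  qed
qed

lemma lie_iso_sym:
  fixes L :: "('a::comm_ring_1, 'v::ab_group_add) lie_struct"
    and M :: "('a, 'w::ab_group_add) lie_struct"
  assumes L: "lie_algebra L" and iso: "lie_iso L M \<phi>"
  shows "lie_iso M L (the_inv_into (lcarrier L) \<phi>)"
proof -
  let ?C = "lcarrier L"
  let ?i = "the_inv_into ?C \<phi>"
  interpret module "lscale L" using L by (simp add: lie_algebra_def)
  have sub: "subspace ?C" using L by (simp add: lie_algebra_def)
  have bij: "bij_betw \<phi> ?C (lcarrier M)" using iso by (simp add: lie_iso_def)
  have inC: "?i y \<in> ?C" and inv: "\<phi> (?i y) = y" if "y \<in> lcarrier M" for y
    using that bij by (auto simp: bij_betw_def the_inv_into_into f_the_inv_into_f)
  have bk: "?i (\<phi> x) = x" if "x \<in> ?C" for x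
    using that bij by (auto simp: bij_betw_def the_inv_into_f_f)
  have brC: "lbracket L x y \<in> ?C" if "x \<in> ?C" "y \<in> ?C" for x y
    using L that by (simp add: lie_algebra_def)
  show ?thesis unfolding lie_iso_def
  proof (intro conjI ballI allI)
    show "bij_betw ?i (lcarrier M) ?C" by (rule bij_betw_the_inv_into [OF bij])
  next
    fix x y assume "x \<in> lcarrier M" "y \<in> lcarrier M"
    note h = inC [OF this(1)] inC [OF this(2)] inv [OF this(1)] inv [OF this(2)]
    have "\<phi> (?i x + ?i y) = x + y" "\<phi> (lbracket L (?i x) (?i y)) = lbracket M x y"
      using iso h by (auto simp: lie_iso_def)
    then show "?i (x + y) = ?i x + ?i y" "?i (lbracket M x y) = lbracket L (?i x) (?i y)"
      using bk [OF subspace_add [OF sub h(1,2)]] bk [OF brC [OF h(1,2)]] by simp_all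
  next
    fix a x assume "x \<in> lcarrier M"
    note h = inC [OF this] inv [OF this]
    have "\<phi> (lscale L a (?i x)) = lscale M a x" using iso h by (auto simp: lie_iso_def)
    then show "?i (lscale M a x) = lscale L a (?i x)"
      using bk [OF subspace_scale [OF sub h(1), of a]] by simp
  qed
qed

lemma lie_isomorphic_sym: "lie_algebra (L :: ('a::comm_ring_1, 'v::ab_group_add) lie_struct) \<Longrightarrow>
    lie_isomorphic L M \<Longrightarrow> lie_isomorphic M L"
  unfolding lie_isomorphic_def by (blast intro: lie_iso_sym)

lemma lie_isomorphic_trans:
  assumes "lie_isomorphic L M" "lie_isomorphic M N"
  shows "lie_isomorphic L N"
proof -
  from assms obtain f g where f: "lie_iso L M f" and g: "lie_iso M N g"
    by (auto simp: lie_isomorphic_def)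
  have fC: "f x \<in> lcarrier M" if "x \<in> lcarrier L" for x
    using f that by (auto simp: lie_iso_def bij_betw_def)
  have "lie_iso L N (g \<circ> f)"
    using f g fC unfolding lie_iso_def by (auto intro: bij_betw_trans)
  then show ?thesis by (auto simp: lie_isomorphic_def)
qed

section \<open>Vector fields in a differential field\<close>

text \<open>A derivation of a field of characteristic zero.\<close>

locale derivation =
  fixes d :: "'f::field_char_0 \<Rightarrow> 'f"
  assumes d_add: "d (a + b) = d a + d b"
    and d_mult: "d (a * b) = a * d b + d a * b"
begin

lemma d_0 [simp]: "d 0 = 0" using d_add [of 0 0] by simp
lemma d_1 [simp]: "d 1 = 0" using d_mult [of 1 1] by simp
lemma d_minus: "d (- a) = - d a" using d_add [of a "- a"] by (simp add: eq_neg_iff_add_eq_0 add.commute)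
lemma d_diff: "d (a - b) = d a - d b" using d_add [of a "- b"] by (simp add: d_minus)
lemma d_of_nat [simp]: "d (of_nat n) = 0" by (induction n) (simp_all add: d_add)
lemma d_of_int [simp]: "d (of_int n) = 0" by (cases n) (simp_all add: d_minus d_diff)
lemma d_numeral [simp]: "d (numeral n) = 0" using d_of_int [of "numeral n"] by simp

lemma d_inverse: "a \<noteq> 0 \<Longrightarrow> d (inverse a) = - d a / a ^ 2"
  using d_mult [of a "inverse a"] by (simp add: field_simps power2_eq_square eq_neg_iff_add_eq_0)

lemma d_divide: "b \<noteq> 0 \<Longrightarrow> d (a / b) = (d a * b - a * d b) / b ^ 2"
  by (simp add: divide_inverse d_mult d_inverse) (simp add: field_simps power2_eq_square)

lemma d_power: "a \<noteq> 0 \<Longrightarrow> d (a ^ n) = of_nat n * d a * a ^ n / a"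
  by (induction n) (simp_all add: d_mult field_simps)

lemma d_power_int: "a \<noteq> 0 \<Longrightarrow> d (a powi k) = of_int k * d a * a powi (k - 1)"
proof (cases k rule: int_cases2)
  case (nonneg n)
  assume "a \<noteq> 0" then show ?thesis by (simp add: nonneg d_power power_int_diff)
next
  case (nonpos n)
  assume a: "a \<noteq> 0"
  have "d (a powi k) = d (inverse (a ^ n))" by (simp add: nonpos power_int_minus)
  also have "\<dots> = - (of_nat n * d a * a ^ n / a) / (a ^ n) ^ 2"
    using a by (simp add: d_inverse d_power)
  also have "\<dots> = of_int k * d a * a powi (k - 1)"
    using a by (simp add: nonpos power_int_diff power_int_minus power2_eq_square field_simps)
  finally show ?thesis .
qed

lemma scaled_derivation: "derivation (\<lambda>g. c * d g)"
  by unfold_locales (simp_all add: d_add d_mult algebra_simps)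

lemma bracket_jacobi:
  fixes x y z :: 'f
  defines "B \<equiv> \<lambda>a b. a * d b - b * d a"
  shows "B x (B y z) + B y (B z x) + B z (B x y) = 0"
  unfolding B_def by (simp add: d_diff d_mult algebra_simps)

text \<open>Integration by parts: up to an exact term, the antisymmetrised third-order expression is
  \<open>- 2 d\<^sup>2E dF\<close>.\<close>

lemma antisymmetric_exact:
  "(d (d (d E)) * F - E * d (d (d F))) =
     d (d (d E) * F - E * d (d F) + d E * d F) - 2 * (d (d E) * d F)"
  by (simp add: d_diff d_add d_mult algebra_simps)

text \<open>The cyclic sum of the antisymmetrised third-order expressions is the derivative of the
  Wronskian of \<open>x, y, z\<close>.\<close>

lemma third_order_cocycle:
  fixes x y z :: 'f
  defines "B \<equiv> \<lambda>a b. a * d b - b * d a"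
    and "C \<equiv> \<lambda>a b. d (d (d a)) * b - a * d (d (d b))"
  shows "C (B x y) z + C (B y z) x + C (B z x) y =
    d (x * (d y * d (d z) - d (d y) * d z) - d x * (y * d (d z) - d (d y) * z)
       + d (d x) * (y * d z - d y * z))"
  unfolding B_def C_def by (simp add: d_diff d_add d_mult algebra_simps)

end

text \<open>The vector fields \<open>V\<^sub>n\<close> on the cubic \<open>Y\<^sup>2 = 4 x (x\<^sup>2 + p x + q)\<close>, written as the
  coefficient \<open>a\<close> of \<open>a d/dx\<close>. The elements \<open>x\<close> and \<open>Y\<close> may lie in any field, so that the same
  formula serves for the function field and for its Laurent expansions at different points.\<close>

definition cubic_vf :: "'f::field \<Rightarrow> 'f \<Rightarrow> int \<Rightarrow> 'f" where
  "cubic_vf x Y n =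
     (if odd n then x powi ((n - 1) div 2) * Y else 1 / 2 * Y ^ 2 * x powi (n div 2 - 2))"

text \<open>The coefficients of \<open>p V\<^sub>n\<^sub>+\<^sub>m\<^sub>-\<^sub>2\<close> (for \<open>i = 1\<close>) and of \<open>q V\<^sub>n\<^sub>+\<^sub>m\<^sub>-\<^sub>4\<close> (for \<open>i = 2\<close>) in
  the bracket \<open>[V\<^sub>n, V\<^sub>m]\<close>.\<close>

definition lin_coeff :: "int \<Rightarrow> int \<Rightarrow> int \<Rightarrow> int" where
  "lin_coeff i n m = (if odd n \<and> odd m then 0 else if odd n then m - n - i
     else if odd m then m - n + i else m - n)"

lemma cubic_vf_odd: "cubic_vf x Y (2 * k + 1) = x powi k * Y"
  and cubic_vf_even: "cubic_vf x Y (2 * k) = 1 / 2 * Y ^ 2 * x powi (k - 2)"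
  by (simp_all add: cubic_vf_def)

text \<open>A differential field with a point \<open>(x, Y)\<close> of the cubic; the derivation is \<open>d/dx\<close> and
  \<open>p\<close>, \<open>q\<close> are constants.\<close>

locale cubic = derivation d for d :: "'a::field_char_0 \<Rightarrow> 'a" +
  fixes x Y p q :: 'a
  assumes dx: "d x = 1" and dp: "d p = 0" and dq: "d q = 0"
    and x0: "x \<noteq> 0" and Y0: "Y \<noteq> 0"
    and Y2: "Y ^ 2 = 4 * x * (x ^ 2 + p * x + q)"
begin

lemma YY: "Y * Y = 4 * (x * x * x + p * x * x + q * x)"
  using Y2 by (simp add: power2_eq_square algebra_simps)

lemma d_Y: "Y * d Y = 6 * x * x + 4 * p * x + 2 * q"
proof -
  have "d (Y * Y) = d (4 * (x * x * x + p * x * x + q * x))" by (simp add: YY)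
  then have "2 * (Y * d Y) = 2 * (6 * x * x + 4 * p * x + 2 * q)"
    by (simp add: d_mult d_add dx dp dq algebra_simps)
  then show ?thesis by (metis mult_left_cancel zero_neq_numeral)
qed

lemma d_xpow: "d (x powi k) = of_int k * x powi (k - 1)"
  by (simp add: d_power_int x0 dx)

lemma xpow: "x powi k = x * x powi (k - 1)"
  using x0 by (simp add: power_int_diff)

lemma xpow_split: "k = a + b + int c \<Longrightarrow> x powi k = x powi a * x powi b * x ^ c"
  using x0 by (simp add: power_int_add)

lemma d_half_square: "d (1/2 * Y ^ 2 * c) = Y * d Y * c + 1/2 * Y ^ 2 * d c"
proof -
  have "d (1/2 :: 'a) = 0" by (simp add: d_divide)
  then show ?thesis by (simp only: d_mult power2_eq_square) (simp add: algebra_simps)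
qed

lemma bracket_odd_odd:
  "cubic_vf x Y (2*k+1) * d (cubic_vf x Y (2*l+1)) - cubic_vf x Y (2*l+1) * d (cubic_vf x Y (2*k+1)) =
     of_int (2*l - 2*k) * cubic_vf x Y (2*k+1 + (2*l+1))"
proof -
  define A B where "A = x powi (k - 1)" and "B = x powi (l - 1)"
  have e: "x powi k = x * A" "x powi l = x * B" unfolding A_def B_def by (rule xpow)+
  have "cubic_vf x Y (2*k+1 + (2*l+1)) = cubic_vf x Y (2 * (k + l + 1))" by (simp add: algebra_simps)
  also have "\<dots> = 1 / 2 * Y ^ 2 * (A * B * x)"
    unfolding cubic_vf_even A_def B_def by (simp add: xpow_split [of _ "k - 1" "l - 1" 1])
  finally have f: "cubic_vf x Y (2*k+1 + (2*l+1)) = 1 / 2 * Y ^ 2 * (A * B * x)" .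
  have dA: "d (x * A) = of_int k * A" and dB: "d (x * B) = of_int l * B"
    using d_xpow [of k] d_xpow [of l] by (simp_all add: e A_def B_def)
  show ?thesis
    unfolding f unfolding cubic_vf_odd e d_mult [of _ Y] dA dB
    by (simp add: algebra_simps power2_eq_square)
qed

lemma bracket_odd_even:
  "cubic_vf x Y (2*k+1) * d (cubic_vf x Y (2*l)) - cubic_vf x Y (2*l) * d (cubic_vf x Y (2*k+1)) =
     of_int (2*l - (2*k+1)) * cubic_vf x Y (2*k+1 + 2*l)
     + of_int (2*l - (2*k+1) - 1) * p * cubic_vf x Y (2*k+1 + 2*l - 2)
     + of_int (2*l - (2*k+1) - 2) * q * cubic_vf x Y (2*k+1 + 2*l - 4)"
proof -
  define A B where "A = x powi (k - 1)" and "B = x powi (l - 3)"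
  have e: "x powi k = x * A" unfolding A_def by (rule xpow)
  have e': "x powi (l - 2) = x * B" unfolding B_def using xpow [of "l - 2"] by simp
  have i: "2*k+1 + 2*l = 2 * ((k - 1) + (l - 3) + 4) + 1" "2*k+1 + 2*l - 2 = 2 * ((k - 1) + (l - 3) + 3) + 1"
      "2*k+1 + 2*l - 4 = 2 * ((k - 1) + (l - 3) + 2) + 1" by simp_all
  have f: "x powi ((k - 1) + (l - 3) + 4) = A * B * x * x * x * x"
    "x powi ((k - 1) + (l - 3) + 3) = A * B * x * x * x"
    "x powi ((k - 1) + (l - 3) + 2) = A * B * x * x"
    unfolding A_def B_def
    by (simp_all add: xpow_split [of _ "k - 1" "l - 3" 4] xpow_split [of _ "k - 1" "l - 3" 3]
        xpow_split [of _ "k - 1" "l - 3" 2] power_numeral_reduce)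
  have dB: "d (x * B) = of_int (l - 2) * B"
    using d_xpow [of "l - 2"] by (simp add: e' B_def)
  have dA: "d (x * A) = of_int k * A"
    using d_xpow [of k] by (simp add: e A_def)
  have a: "d (x * A * Y) = of_int k * A * Y + x * A * d Y"
    and b: "d (1/2 * Y ^ 2 * (x * B)) = Y * d Y * (x * B) + 1/2 * (Y * Y) * (of_int (l - 2) * B)"
    unfolding d_half_square d_mult [of "x * A" Y] dA dB by (simp_all add: power2_eq_square algebra_simps)
  have "x * A * Y * d (1/2 * Y ^ 2 * (x * B)) - 1/2 * Y ^ 2 * (x * B) * d (x * A * Y) =
      1/2 * x * x * A * B * Y * (Y * d Y) + 1/2 * of_int (l - 2 - k) * x * A * B * Y * (Y * Y)"
    unfolding a b by (simp add: algebra_simps power2_eq_square)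
  also have "\<dots> = of_int (2*l - (2*k+1)) * (A * B * x * x * x * x * Y)
     + of_int (2*l - (2*k+1) - 1) * p * (A * B * x * x * x * Y)
     + of_int (2*l - (2*k+1) - 2) * q * (A * B * x * x * Y)"
    unfolding d_Y YY by (simp add: algebra_simps)
  finally show ?thesis
    unfolding i(2,3) unfolding i(1) cubic_vf_odd f unfolding cubic_vf_even e e' .
qed

lemma bracket_even_even:
  "cubic_vf x Y (2*k) * d (cubic_vf x Y (2*l)) - cubic_vf x Y (2*l) * d (cubic_vf x Y (2*k)) =
     of_int (2*l - 2*k) * (cubic_vf x Y (2*k + 2*l)
     + p * cubic_vf x Y (2*k + 2*l - 2) + q * cubic_vf x Y (2*k + 2*l - 4))"
proof -
  define A B where "A = x powi (k - 3)" and "B = x powi (l - 3)"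
  have e: "x powi (k - 2) = x * A" unfolding A_def using xpow [of "k - 2"] by simp
  have e': "x powi (l - 2) = x * B" unfolding B_def using xpow [of "l - 2"] by simp
  have i: "2*k + 2*l = 2 * ((k - 3) + (l - 3) + 6)" "2*k + 2*l - 2 = 2 * ((k - 3) + (l - 3) + 5)"
      "2*k + 2*l - 4 = 2 * ((k - 3) + (l - 3) + 4)" by simp_all
  have f: "x powi ((k - 3) + (l - 3) + 6 - 2) = A * B * x * x * x * x"
    "x powi ((k - 3) + (l - 3) + 5 - 2) = A * B * x * x * x"
    "x powi ((k - 3) + (l - 3) + 4 - 2) = A * B * x * x"
    unfolding A_def B_def
    by (simp_all add: xpow_split [of _ "k - 3" "l - 3" 4] xpow_split [of _ "k - 3" "l - 3" 3]
        xpow_split [of _ "k - 3" "l - 3" 2] power_numeral_reduce)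
  have dB: "d (x * B) = of_int (l - 2) * B"
    using d_xpow [of "l - 2"] by (simp add: e' B_def)
  have dA: "d (x * A) = of_int (k - 2) * A"
    using d_xpow [of "k - 2"] by (simp add: e A_def)
  have a: "d (1/2 * Y ^ 2 * (x * A)) = Y * d Y * (x * A) + 1/2 * (Y * Y) * (of_int (k - 2) * A)"
    and b: "d (1/2 * Y ^ 2 * (x * B)) = Y * d Y * (x * B) + 1/2 * (Y * Y) * (of_int (l - 2) * B)"
    unfolding d_half_square dA dB by (simp_all add: power2_eq_square)
  have "1/2 * Y ^ 2 * (x * A) * d (1/2 * Y ^ 2 * (x * B)) - 1/2 * Y ^ 2 * (x * B) * d (1/2 * Y ^ 2 * (x * A)) =
      1/4 * of_int (l - k) * x * A * B * Y ^ 2 * (Y * Y)"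
    unfolding a b by (simp add: algebra_simps power2_eq_square)
  also have "\<dots> = of_int (2*l - 2*k) * (1/2 * Y ^ 2 * (A * B * x * x * x * x)
     + p * (1/2 * Y ^ 2 * (A * B * x * x * x)) + q * (1/2 * Y ^ 2 * (A * B * x * x)))"
    unfolding YY by (simp add: field_simps)
  finally show ?thesis
    unfolding i(2,3) unfolding i(1) cubic_vf_even e e' f .
qed

lemma bracket_cubic_vf:
  "cubic_vf x Y n * d (cubic_vf x Y m) - cubic_vf x Y m * d (cubic_vf x Y n) =
     of_int (m - n) * cubic_vf x Y (n + m)
     + of_int (lin_coeff 1 n m) * p * cubic_vf x Y (n + m - 2)
     + of_int (lin_coeff 2 n m) * q * cubic_vf x Y (n + m - 4)"
proof (cases "odd n"; cases "odd m")
  assume "odd n" "odd m"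
  then obtain k l where "n = 2 * k + 1" "m = 2 * l + 1" by (auto elim!: oddE)
  then show ?thesis using bracket_odd_odd [of k l] by (simp add: lin_coeff_def)
next
  assume "odd n" "\<not> odd m"
  then obtain k l where "n = 2 * k + 1" "m = 2 * l" by (auto elim!: oddE evenE)
  then show ?thesis using bracket_odd_even [of k l] by (simp add: lin_coeff_def)
next
  assume "\<not> odd n" "odd m"
  then obtain k l where nm: "n = 2 * l" "m = 2 * k + 1" by (auto elim!: oddE evenE)
  have "cubic_vf x Y n * d (cubic_vf x Y m) - cubic_vf x Y m * d (cubic_vf x Y n) =
      - (of_int (n - m) * cubic_vf x Y (n + m)
     + of_int (n - m - 1) * p * cubic_vf x Y (n + m - 2)
     + of_int (n - m - 2) * q * cubic_vf x Y (n + m - 4))"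
    using bracket_odd_even [of k l] unfolding nm by (simp add: algebra_simps)
  also have "\<dots> = of_int (m - n) * cubic_vf x Y (n + m)
     + of_int (m - n + 1) * p * cubic_vf x Y (n + m - 2)
     + of_int (m - n + 2) * q * cubic_vf x Y (n + m - 4)"
    by (simp add: algebra_simps)
  finally show ?thesis by (simp add: lin_coeff_def nm)
next
  assume "\<not> odd n" "\<not> odd m"
  then obtain k l where "n = 2 * k" "m = 2 * l" by (auto elim!: evenE)
  then show ?thesis using bracket_even_even [of k l] by (simp add: lin_coeff_def algebra_simps)
qed

text \<open>First and second derivatives with respect to \<open>D = Y d/dx\<close>. As multiples of \<open>D\<close>, the
  fields \<open>V\<^sub>n\<close> have the coefficients \<open>x\<^sup>k\<close> for \<open>n = 2 k + 1\<close> and \<open>Y x\<^sup>a / 2\<close>, \<open>a = k - 2\<close>, for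
  \<open>n = 2 k\<close>.\<close>

lemma D_odd: "Y * d (x powi k) = Y * (of_int k * x powi (k - 1))"
  by (simp add: d_xpow)

lemma D2_odd: "Y * d (Y * d (x powi k)) =
    of_int (4*k^2 + 2*k) * x powi (k + 1) + of_int (4*k^2) * p * x powi k
      + of_int (4*k^2 - 2*k) * q * x powi (k - 1)"
proof -
  define A where "A = x powi (k - 2)"
  have e: "x powi (k + 1) = A * x * x * x" "x powi k = A * x * x" "x powi (k - 1) = A * x"
    unfolding A_def by (simp_all add: xpow_split [of _ "k - 2" 0 3] xpow_split [of _ "k - 2" 0 2]
        xpow_split [of _ "k - 2" 0 1] power_numeral_reduce)
  have dA: "d (A * x) = of_int (k - 1) * A"
    using d_xpow [of "k - 1"] by (simp add: e A_def)
  have "Y * d (Y * d (x powi k)) =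
      of_int k * (A * x) * (Y * d Y) + of_int k * of_int (k - 1) * A * (Y * Y)"
    unfolding d_xpow unfolding e d_mult [of Y] d_mult [of "of_int k"] dA by (simp add: algebra_simps)
  also have "\<dots> = of_int (4*k^2 + 2*k) * (A * x * x * x) + of_int (4*k^2) * p * (A * x * x)
      + of_int (4*k^2 - 2*k) * q * (A * x)"
    unfolding d_Y YY by (simp add: algebra_simps power2_eq_square)
  finally show ?thesis unfolding e .
qed

lemma D_even: "Y * d (1/2 * Y * x powi a) =
    1/2 * (of_int (6 + 4*a) * x powi (a + 2) + of_int (4 + 4*a) * p * x powi (a + 1)
      + of_int (2 + 4*a) * q * x powi a)"
proof -
  define A where "A = x powi (a - 1)"
  have e: "x powi (a + 2) = A * x * x * x" "x powi (a + 1) = A * x * x" "x powi a = A * x"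
    unfolding A_def by (simp_all add: xpow_split [of _ "a - 1" 0 3] xpow_split [of _ "a - 1" 0 2]
        xpow_split [of _ "a - 1" 0 1] power_numeral_reduce)
  have dA: "d (A * x) = of_int a * A"
    using d_xpow [of a] by (simp add: e A_def)
  have d2: "d (1/2 :: 'a) = 0" by (simp add: d_divide)
  have "Y * d (1/2 * Y * x powi a) = 1/2 * (A * x) * (Y * d Y) + 1/2 * of_int a * A * (Y * Y)"
    unfolding e d_mult [of "1/2 * Y"] d_mult [of "1/2"] d2 dA by (simp add: algebra_simps)
  also have "\<dots> = 1/2 * (of_int (6 + 4*a) * (A * x * x * x) + of_int (4 + 4*a) * p * (A * x * x)
      + of_int (2 + 4*a) * q * (A * x))"
    unfolding d_Y YY by (simp add: field_simps)
  finally show ?thesis unfolding e .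
qed

lemma D2_even: "Y * d (Y * d (1/2 * Y * x powi a)) =
    Y * (1/2 * (of_int ((6 + 4*a) * (a + 2)) * x powi (a + 1)
      + of_int ((4 + 4*a) * (a + 1)) * p * x powi a + of_int ((2 + 4*a) * a) * q * x powi (a - 1)))"
proof -
  have d2: "d (1/2 :: 'a) = 0" by (simp add: d_divide)
  show ?thesis unfolding D_even unfolding d_mult d_add d_xpow dp dq d_of_int d2
    by (simp add: algebra_simps)
qed

end

section \<open>Laurent series and residues\<close>

lemma derivation_fls: "derivation (\<lambda>g :: complex fls. fls_deriv g / fls_deriv x)"
  by unfold_locales (simp_all add: add_divide_distrib)

text \<open>A linear combination with nonzero coefficients of series of pairwise distinct orders has the smallest of these
  orders.\<close>

lemma fls_sum_leading:
  fixes v :: "'i \<Rightarrow> complex fls"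
  assumes "finite S" "S \<noteq> {}" "inj_on (\<lambda>i. fls_subdegree (v i)) S"
    and nz: "\<And>i. i \<in> S \<Longrightarrow> v i \<noteq> 0 \<and> c i \<noteq> 0"
  obtains i where "i \<in> S" "\<And>j. j \<in> S \<Longrightarrow> fls_subdegree (v i) \<le> fls_subdegree (v j)"
    "fls_nth (\<Sum>i\<in>S. fls_const (c i) * v i) (fls_subdegree (v i)) \<noteq> 0"
    "fls_subdegree (\<Sum>i\<in>S. fls_const (c i) * v i) = fls_subdegree (v i)"
proof -
  let ?d = "\<lambda>i. fls_subdegree (v i)"
  obtain i where i: "i \<in> S" "?d i = Min (?d ` S)"
    using Min_in [of "?d ` S"] assms(1,2) by fastforce
  have le: "?d i \<le> ?d j" if "j \<in> S" for j using that assms(1) by (simp add: i(2))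
  have lt: "?d i < ?d j" if "j \<in> S - {i}" for j
    using le [of j] that i(1) assms(3) by (fastforce simp: inj_on_def le_less)
  have "fls_nth (\<Sum>i\<in>S. fls_const (c i) * v i) (?d i) = (\<Sum>j\<in>S. fls_nth (fls_const (c j) * v j) (?d i))"
    by (simp add: fls_nth_sum)
  also have "\<dots> = fls_nth (fls_const (c i) * v i) (?d i) + (\<Sum>j\<in>S-{i}. fls_nth (fls_const (c j) * v j) (?d i))"
    using i(1) assms(1) by (rule sum.remove [rotated])
  also have "(\<Sum>j\<in>S-{i}. fls_nth (fls_const (c j) * v j) (?d i)) = 0"
    by (rule sum.neutral) (use lt in auto)
  finally have e: "fls_nth (\<Sum>i\<in>S. fls_const (c i) * v i) (?d i) \<noteq> 0" using nz [OF i(1)] by simp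
  have "fls_subdegree (\<Sum>i\<in>S. fls_const (c i) * v i) = ?d i"
    by (rule fls_subdegree_eqI [OF e])
       (auto simp: fls_nth_sum intro!: sum.neutral dest: le)
  with that i(1) le e show ?thesis by blast
qed

text \<open>Even Laurent series. They are described as the series in the square of the parameter,
  which makes closure under products and inverses immediate.\<close>

definition fls_even :: "complex fls \<Rightarrow> bool" where
  "fls_even g \<longleftrightarrow> (\<exists>h. g = fls_compose_power h 2)"

lemma fls_even_const [simp]: "fls_even (fls_const c)"
  unfolding fls_even_def by (rule exI [of _ "fls_const c"]) simp

lemma fls_even_0 [simp]: "fls_even 0"
  using fls_even_const [of 0] by simp

lemma fls_even_mult: "fls_even g \<Longrightarrow> fls_even h \<Longrightarrow> fls_even (g * h)"
  unfolding fls_even_def by (metis fls_compose_power_mult)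

lemma fls_even_add: "fls_even g \<Longrightarrow> fls_even h \<Longrightarrow> fls_even (g + h)"
  unfolding fls_even_def by (metis fls_compose_power_add)

lemma fls_even_diff: "fls_even g \<Longrightarrow> fls_even h \<Longrightarrow> fls_even (g - h)"
  unfolding fls_even_def by (metis fls_compose_power_diff)

lemma fls_even_inverse:
  assumes "fls_even g"
  shows "fls_even (inverse g)"
proof (cases "g = 0")
  case False
  obtain h where h: "g = fls_compose_power h 2" using assms by (auto simp: fls_even_def)
  with False have "h \<noteq> 0" by auto
  then have "fls_compose_power (inverse h) 2 * fls_compose_power h 2 = 1"
    by (metis fls_compose_power_1_left fls_compose_power_mult left_inverse zero_less_numeral)
  then have "inverse g = fls_compose_power (inverse h) 2"
    unfolding h by (metis inverse_unique mult.commute)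
  then show ?thesis by (auto simp: fls_even_def)
qed simp

lemma fls_even_power: "fls_even g \<Longrightarrow> fls_even (g ^ n)"
  by (induction n) (use fls_even_const [of 1] in \<open>auto intro: fls_even_mult\<close>)

lemma fls_even_power_int: "fls_even g \<Longrightarrow> fls_even (g powi n)"
  by (simp add: power_int_def fls_even_power fls_even_inverse)

lemma fls_even_X2: "fls_even (fls_X ^ 2)"
  unfolding fls_even_def
  by (rule exI [of _ fls_X]) (simp add: fls_X_power_conv_shift_1)

lemma fls_even_residue: "fls_even g \<Longrightarrow> fls_residue g = 0"
  by (auto simp: fls_even_def fls_nth_compose_power)

section \<open>The cubic curves\<close>

text \<open>The constants with \<open>p = pcoef s * t\<close> and \<open>q = qcoef s * t\<^sup>2\<close> in the equation
  \<open>Y\<^sup>2 = 4 x (x\<^sup>2 + p x + q)\<close>, that is, \<open>p = 3 e\<^sub>1\<close> and \<open>q = (e\<^sub>1 - e\<^sub>2) (e\<^sub>1 - e\<^sub>3)\<close>.\<close>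

definition pcoef :: "proj_line \<Rightarrow> complex" where
  "pcoef s = (case s of Finite _ \<Rightarrow> 3 | Infinity \<Rightarrow> 0)"

definition qcoef :: "proj_line \<Rightarrow> complex" where
  "qcoef s = (case s of Finite a \<Rightarrow> (1 - a) * (2 + a) | Infinity \<Rightarrow> - 1)"

text \<open>The function \<open>x = X - e\<^sub>1\<close>.\<close>

definition cx :: "proj_line \<Rightarrow> complex \<Rightarrow> complex fls" where
  "cx s t = cX - fls_const (e1 s t)"

lemma pq_nonzero: "pcoef s \<noteq> 0 \<or> qcoef s \<noteq> 0"
  by (cases s) (simp_all add: pcoef_def qcoef_def)

lemma e_sum: "e1 s t + e2 s t + e3 s t = 0"
  by (cases s) (simp_all add: algebra_simps)

lemma e_p: "pcoef s * t = 3 * e1 s t"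
  by (cases s) (simp_all add: pcoef_def)

lemma e_q: "qcoef s * t ^ 2 = (e1 s t - e2 s t) * (e1 s t - e3 s t)"
  by (cases s) (simp_all add: qcoef_def algebra_simps power2_eq_square)

lemma cY_cubic:
  "cY s t ^ 2 = 4 * cx s t * (cx s t ^ 2 + fls_const (pcoef s * t) * cx s t + fls_const (qcoef s * t ^ 2))"
proof -
  define a b c where "a = e1 s t" and "b = e2 s t" and "c = e3 s t"
  have abc: "c = - a - b" using e_sum [of s t] by (simp add: a_def b_def c_def eq_neg_iff_add_eq_0 algebra_simps)
  have "cY s t ^ 2 = 4 * (cX - fls_const a) * (cX - fls_const b) * (cX - fls_const c)"
    by (simp add: cY_square cf_def a_def b_def c_def)
  also have "\<dots> = 4 * (cX - fls_const a) * ((cX - fls_const a) ^ 2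
      + fls_const (3 * a) * (cX - fls_const a) + fls_const ((a - b) * (a - c)))"
    unfolding abc fls_const_mult_const [symmetric] fls_minus_const [symmetric]
    by (simp add: algebra_simps power2_eq_square del: fls_const_mult_const)
  finally show ?thesis by (simp add: cx_def e_p e_q a_def b_def c_def)
qed

lemma cX_inverse: "cX = inverse (fls_X ^ 2)"
  by (simp only: cX_def power_int_minus power_int_numeral)

lemma cX_nz [simp]: "cX \<noteq> 0"
  by (simp only: cX_inverse) (simp only: inverse_nonzero_iff_nonzero power_not_zero fls_X_nonzero not_False_eq_True)

lemma cX_subdegree: "fls_subdegree cX = - 2"
  by (simp add: cX_def)

lemma deriv_cX: "fls_deriv cX = - 2 * inverse (fls_X ^ 3)"
proof -
  interpret derivation "fls_deriv :: complex fls \<Rightarrow> _" by unfold_locales simp_all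
  have "fls_deriv cX = - fls_deriv (fls_X ^ 2) / (fls_X ^ 2) ^ 2"
    unfolding cX_inverse by (rule d_inverse) simp
  also have "\<dots> = - 2 * inverse (fls_X ^ 3)"
    unfolding fls_deriv_power by (simp add: power_numeral_reduce field_simps)
  finally show ?thesis .
qed

lemma deriv_cX_nz [simp]: "fls_deriv cX \<noteq> 0"
  by (simp add: deriv_cX)

lemma cx_subdegree: "fls_subdegree (cx s t) = - 2" and cx_nz [simp]: "cx s t \<noteq> 0"
proof -
  show d: "fls_subdegree (cx s t) = - 2"
    unfolding cx_def by (subst fls_subdegree_diff_eq1) (simp_all add: cX_subdegree)
  then show "cx s t \<noteq> 0" by auto
qed

lemma cY_subdegree: "fls_subdegree (cY s t) = - 3" and cY_nz [simp]: "cY s t \<noteq> 0"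
proof -
  have d: "fls_subdegree (cX - fls_const a) = - 2" for a
    using fls_subdegree_diff_eq1 [of cX "fls_const a"] by (auto simp: cX_subdegree)
  then have nz: "cX - fls_const a \<noteq> 0" for a
    using fls_zero_subdegree by (metis neg_equal_0_iff_equal zero_neq_numeral)
  have g: "fls_subdegree (4 * A * B * C) = - 6 \<and> 4 * A * B * C \<noteq> 0"
    if "A \<noteq> 0" "B \<noteq> 0" "C \<noteq> 0" "fls_subdegree A = - 2" "fls_subdegree B = - 2" "fls_subdegree C = - 2"
    for A B C :: "complex fls" using that by simp
  have "fls_subdegree (cY s t ^ 2) = - 6" "cY s t ^ 2 \<noteq> 0"
    unfolding cY_square cf_def using g [OF nz nz nz d d d] by simp_all
  then show "fls_subdegree (cY s t) = - 3" "cY s t \<noteq> 0" by (simp_all add: fls_subdegree_pow)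
qed

lemma V_cubic: "V s t n = cubic_vf (cx s t) (cY s t) n"
  by (simp add: V_def cubic_vf_def cx_def cY_square)

lemma V_subdegree: "fls_subdegree (V s t n) = - n - 2" and V_nz [simp]: "V s t n \<noteq> 0"
proof -
  show nz: "V s t n \<noteq> 0" by (auto simp: V_cubic cubic_vf_def)
  show "fls_subdegree (V s t n) = - n - 2"
    using nz unfolding V_cubic cubic_vf_def
    by (auto simp: cx_subdegree cY_subdegree fls_subdegree_pow fls_divide_subdegree elim!: oddE evenE)
qed

lemma cubic_ddX: "cubic ddX (cx s t) (cY s t) (fls_const (pcoef s * t)) (fls_const (qcoef s * t ^ 2))"
proof -
  interpret derivation ddX unfolding ddX_def [abs_def] by (rule derivation_fls)
  show ?thesis
    by unfold_locales (simp_all add: cY_cubic, simp_all add: ddX_def cx_def)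
qed

lemma V_bracket:
  "vf_bracket (V s t n) (V s t m) = fls_const (of_int (m - n)) * V s t (n + m)
     + fls_const (of_int (lin_coeff 1 n m) * (pcoef s * t)) * V s t (n + m - 2)
     + fls_const (of_int (lin_coeff 2 n m) * (qcoef s * t ^ 2)) * V s t (n + m - 4)"
  using cubic.bracket_cubic_vf [OF cubic_ddX, of s t n m]
  unfolding vf_bracket_def V_cubic fls_const_mult_const [symmetric] by (simp add: fls_of_int)

text \<open>The functions \<open>X\<close> and \<open>Y / \<tau>\<close> are even in the local parameter \<open>\<tau>\<close>.\<close>

lemma even_cX: "fls_even cX"
proof -
  show ?thesis unfolding cX_inverse by (intro fls_even_inverse fls_even_X2)
qed

lemma even_cx: "fls_even (cx s t)"
  unfolding cx_def by (intro fls_even_diff even_cX fls_even_const)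

lemma even_deriv_cX: "fls_even (fls_deriv cX / fls_X)"
proof -
  have "- 2 * inverse (T ^ 3) / T = - 2 * inverse ((T ^ 2) ^ 2)" if "T \<noteq> 0" for T :: "complex fls"
    using that by (simp add: power_numeral_reduce field_simps)
  from this [OF fls_X_nonzero] have "fls_deriv cX / fls_X = fls_const (- 2) * inverse ((fls_X ^ 2) ^ 2)"
    unfolding deriv_cX by simp
  then show ?thesis by (simp only: fls_even_mult fls_even_const fls_even_inverse fls_even_power fls_even_X2)
qed

lemma even_cY: "fls_even (cY s t / fls_X)"
proof -
  let ?g = "\<lambda>z. (1 - fps_const (e1 s t) * z) * (1 - fps_const (e2 s t) * z) * (1 - fps_const (e3 s t) * z)"
  let ?b = "fps_X ^ 2 :: complex fps"
  have "?g fps_X oo ?b = ?g ?b"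
    by (simp add: fps_compose_mult_distrib fps_compose_sub_distrib)
  moreover have "fps_radical (\<lambda>_. csqrt) 2 (?g fps_X) oo ?b = fps_radical (\<lambda>_. csqrt) 2 (?g fps_X oo ?b)"
    using fps_compose_radical [of ?b "\<lambda>_. csqrt" 1 "?g fps_X"] by (simp add: numeral_2_eq_2)
  ultimately have "fps_radical (\<lambda>_. csqrt) 2 (?g ?b) = fps_radical (\<lambda>_. csqrt) 2 (?g fps_X) oo ?b" by simp
  then have e: "fls_even (fps_to_fls (fps_radical (\<lambda>_. csqrt) 2 (?g ?b)))"
    unfolding fls_even_def by (metis fls_compose_power_fps_to_fls zero_less_numeral)
  have sh: "fls_X powi (- 3) = inverse (fls_X ^ 3 :: complex fls)"
    by (simp only: power_int_minus power_int_numeral)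
  have "2 * inverse (T ^ 3) * r / T = 2 * inverse ((T ^ 2) ^ 2) * r" if "T \<noteq> 0" for T r :: "complex fls"
    using that by (simp add: power_numeral_reduce field_simps)
  from this [OF fls_X_nonzero] have "cY s t / fls_X = fls_const 2 * inverse ((fls_X ^ 2) ^ 2) * fps_to_fls (fps_radical (\<lambda>_. csqrt) 2 (?g ?b))"
    unfolding cY_def sh by (simp only: fls_const_numeral)
  with e show ?thesis by (simp only: fls_even_mult fls_even_const fls_even_inverse fls_even_power fls_even_X2)
qed

text \<open>By parity, functions of \<open>x\<close> times \<open>Y\<close> or \<open>1 / Y\<close> have no residue with respect to \<open>dX\<close>.\<close>

lemma residue_even_Y: "fls_even g \<Longrightarrow> fls_residue (g * cY s t * fls_deriv cX) = 0"
proof (rule fls_even_residue)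
  assume g: "fls_even g"
  have gen: "g * y * x = g * (y / T) * (x / T) * T ^ 2" if "T \<noteq> 0" for T x y :: "complex fls"
    using that by (simp add: power2_eq_square)
  have "g * cY s t * fls_deriv cX = g * (cY s t / fls_X) * (fls_deriv cX / fls_X) * fls_X ^ 2"
    using gen [OF fls_X_nonzero] .
  then show "fls_even (g * cY s t * fls_deriv cX)"
    by (simp only: fls_even_mult g even_cY even_deriv_cX fls_even_X2)
qed

lemma residue_even_over_Y: "fls_even g \<Longrightarrow> fls_residue (g / cY s t * fls_deriv cX) = 0"
proof (rule fls_even_residue)
  assume g: "fls_even g"
  have gen: "g / y * x = g * inverse (y / T) * (x / T)" if "T \<noteq> 0" for T x y :: "complex fls"
    using that by (simp add: divide_inverse)
  have "g / cY s t * fls_deriv cX = g * (inverse (cY s t / fls_X)) * (fls_deriv cX / fls_X)"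
    using gen [OF fls_X_nonzero] .
  then show "fls_even (g / cY s t * fls_deriv cX)"
    by (simp only: fls_even_mult g even_cY even_deriv_cX fls_even_inverse)
qed

text \<open>The value \<open>- 2\<close> is the order of \<open>x\<close> at infinity.\<close>

lemma residue_x_powi:
  "fls_residue (cx s t powi j * fls_deriv cX) = (if j = - 1 then - 2 else 0)"
proof -
  interpret derivation "fls_deriv :: complex fls \<Rightarrow> _" by unfold_locales simp_all
  have dx: "fls_deriv (cx s t) = fls_deriv cX" by (simp add: cx_def)
  show ?thesis
  proof (cases "j = - 1")
    case True
    then show ?thesis
      using fls_residue_deriv_times_inverse_eq_subdegree(2) [of "cx s t"]
      by (simp add: dx power_int_minus cx_subdegree)
  next
    case False
    then have nz: "(of_int (j + 1) :: complex) \<noteq> 0" by (metis add.commute add_eq_0_iff of_int_eq_0_iff)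
    have "fls_deriv (cx s t powi (j + 1)) = fls_const (of_int (j + 1)) * (cx s t powi j * fls_deriv cX)"
      unfolding fls_of_int [symmetric] by (simp add: d_power_int dx mult_ac)
    then have "of_int (j + 1) * fls_residue (cx s t powi j * fls_deriv cX) = 0"
      by (metis fls_residue_deriv fls_residue_fls_const_times(1))
    then show ?thesis using False nz by simp
  qed
qed

section \<open>The residue cocycle\<close>

lemma derivation_ddX: "derivation ddX"
  unfolding ddX_def [abs_def] by (rule derivation_fls)

lemma derivation_cD: "derivation (cD s t)"
  unfolding cD_def [abs_def] by (rule derivation.scaled_derivation [OF derivation_ddX])

lemma ddX_const [simp]: "ddX (fls_const c) = 0"
  by (simp add: ddX_def)

lemma ddX_add: "ddX (x + y) = ddX x + ddX y"
  by (rule derivation.d_add [OF derivation_ddX])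

lemma ddX_const_mult: "ddX (fls_const c * x) = fls_const c * ddX x"
  by (simp add: derivation.d_mult [OF derivation_ddX])

lemma cD_const_mult: "cD s t (fls_const c * x) = fls_const c * cD s t x"
  by (simp add: cD_def ddX_const_mult)

lemma cD_add: "cD s t (x + y) = cD s t x + cD s t y"
  by (simp add: cD_def ddX_add algebra_simps)

lemma res_inf_add: "res_inf s t (g + h) = res_inf s t g + res_inf s t h"
  by (simp add: res_inf_def add_divide_distrib distrib_right)

lemma res_inf_const_mult: "res_inf s t (fls_const c * g) = c * res_inf s t g"
proof -
  have "fls_const c * g / cY s t * fls_deriv cX = fls_const c * (g / cY s t * fls_deriv cX)" by simp
  then show ?thesis unfolding res_inf_def by (simp only: fls_residue_fls_const_times)
qed

lemma res_inf_half: "res_inf s t (1 / 2 * g) = 1 / 2 * res_inf s t g"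
proof -
  have "(1 :: complex fls) / 2 = fls_const (1 / 2)"
    by (metis fls_const_divide_const fls_const_1 fls_const_numeral)
  then show ?thesis by (simp only: res_inf_const_mult)
qed

lemma res_inf_diff: "res_inf s t (g - h) = res_inf s t g - res_inf s t h"
  using res_inf_add [of s t "g - h" h] by simp

text \<open>Exact differentials have no residue.\<close>

lemma res_inf_cD: "res_inf s t (cD s t h) = 0"
proof -
  have "cD s t h / cY s t * fls_deriv cX = fls_deriv h"
    by (simp add: cD_def ddX_def)
  then show ?thesis unfolding res_inf_def by (simp only: fls_residue_deriv)
qed

text \<open>The linear form on vector fields given by the residue pairing with the quadratic
  differential \<open>R (dX / Y)\<^sup>2\<close>.\<close>

definition psi :: "proj_line \<Rightarrow> complex \<Rightarrow> complex fls \<Rightarrow> complex fls \<Rightarrow> complex" where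
  "psi s t R z = - (1 / 12) * res_inf s t (R * (z / cY s t))"

lemma psi_add: "psi s t R (x + y) = psi s t R x + psi s t R y"
  by (simp add: psi_def add_divide_distrib distrib_left res_inf_add)

lemma psi_const_mult: "psi s t R (fls_const c * x) = c * psi s t R x"
proof -
  have "R * (fls_const c * x / cY s t) = fls_const c * (R * (x / cY s t))" by simp
  then show ?thesis unfolding psi_def by (simp only: res_inf_const_mult) simp
qed

lemma psi_0 [simp]: "psi s t R 0 = 0"
  using psi_const_mult [of s t R 0 0] by simp

lemma vf_bracket_over_Y:
  "vf_bracket x y / cY s t = x / cY s t * cD s t (y / cY s t) - y / cY s t * cD s t (x / cY s t)"
  by (simp add: vf_bracket_def cD_def derivation.d_divide [OF derivation_ddX])
     (simp add: field_simps power2_eq_square)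

text \<open>The quadratic differential contributes a coboundary.\<close>

lemma gamma_coboundary: "gamma s t R x y = gamma s t 0 x y + psi s t R (vf_bracket x y)"
  unfolding psi_def vf_bracket_over_Y
  by (simp add: gamma_def Let_def res_inf_diff right_diff_distrib mult_ac)

lemma gamma_0_antisymmetric:
  fixes s t x y
  defines "D \<equiv> cD s t" and "E \<equiv> x / cY s t" and "F \<equiv> y / cY s t"
  shows "gamma s t 0 x y = - (1 / 24) * res_inf s t (D (D (D E)) * F - E * D (D (D F)))"
  unfolding gamma_def Let_def D_def E_def F_def by (simp only: mult_zero_left diff_zero res_inf_half) simp

lemma gamma_0_product:
  "gamma s t 0 x y = 1 / 12 * res_inf s t (cD s t (cD s t (x / cY s t)) * cD s t (y / cY s t))"
proof -
  have two: "res_inf s t (2 * g) = 2 * res_inf s t g" for g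
    using res_inf_const_mult [of s t 2 g] by simp
  show ?thesis
    unfolding gamma_0_antisymmetric derivation.antisymmetric_exact [OF derivation_cD]
      res_inf_diff res_inf_cD two by simp
qed

lemma vf_bracket_add_left: "vf_bracket (x + x') y = vf_bracket x y + vf_bracket x' y"
  and vf_bracket_add_right: "vf_bracket x (y + y') = vf_bracket x y + vf_bracket x y'"
  by (simp_all add: vf_bracket_def ddX_add algebra_simps)

lemma vf_bracket_const_left: "vf_bracket (fls_const a * x) y = fls_const a * vf_bracket x y"
  and vf_bracket_const_right: "vf_bracket x (fls_const a * y) = fls_const a * vf_bracket x y"
  unfolding vf_bracket_def ddX_const_mult by (simp_all add: algebra_simps)

lemma vf_bracket_self: "vf_bracket x x = 0"
  by (simp add: vf_bracket_def)

lemma gamma_add_left: "gamma s t R (x + x') y = gamma s t R x y + gamma s t R x' y"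
  unfolding gamma_coboundary [of s t R] gamma_0_product vf_bracket_add_left psi_add
    add_divide_distrib cD_add distrib_right res_inf_add by simp

lemma gamma_add_right: "gamma s t R x (y + y') = gamma s t R x y + gamma s t R x y'"
  unfolding gamma_coboundary [of s t R] gamma_0_product vf_bracket_add_right psi_add
    add_divide_distrib cD_add distrib_left res_inf_add by simp

lemma gamma_const_left: "gamma s t R (fls_const a * x) y = a * gamma s t R x y"
proof -
  have *: "fls_const a * x / cY s t = fls_const a * (x / cY s t)" by simp
  show ?thesis
    unfolding gamma_coboundary [of s t R] gamma_0_product vf_bracket_const_left * cD_const_mult
      psi_const_mult mult.assoc res_inf_const_mult by (simp add: distrib_left)
qed

lemma gamma_const_right: "gamma s t R x (fls_const a * y) = a * gamma s t R x y"
proof -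
  have *: "fls_const a * y / cY s t = fls_const a * (y / cY s t)" by simp
  show ?thesis
    unfolding gamma_coboundary [of s t R] gamma_0_product vf_bracket_const_right * cD_const_mult
      psi_const_mult mult.left_commute [of _ "fls_const a"] res_inf_const_mult by (simp add: distrib_left)
qed

lemma gamma_self: "gamma s t R x x = 0"
proof -
  have "res_inf s t 0 = 0" using res_inf_const_mult [of s t 0 0] by simp
  then show ?thesis unfolding gamma_def Let_def by simp
qed

lemma gamma_anti: "gamma s t R x y = - gamma s t R y x"
proof -
  have "0 = gamma s t R (x + y) (x + y)" by (simp only: gamma_self)
  also have "\<dots> = gamma s t R x y + gamma s t R y x"
    unfolding gamma_add_left gamma_add_right by (simp add: gamma_self)
  finally show ?thesis by (simp add: eq_neg_iff_add_eq_0)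
qed

lemma vf_jacobi:
  "vf_bracket x (vf_bracket y z) + vf_bracket y (vf_bracket z x) + vf_bracket z (vf_bracket x y) = 0"
  unfolding vf_bracket_def by (rule derivation.bracket_jacobi [OF derivation_ddX])

lemma gamma_cocycle:
  "gamma s t R x (vf_bracket y z) + gamma s t R y (vf_bracket z x) + gamma s t R z (vf_bracket x y) = 0"
proof -
  let ?D = "cD s t" and ?Y = "cY s t"
  let ?C = "\<lambda>a b. ?D (?D (?D a)) * b - a * ?D (?D (?D b))"
  let ?B = "\<lambda>a b. a * ?D b - b * ?D a"
  have g: "gamma s t 0 a (vf_bracket b c) =
      1 / 24 * res_inf s t (?C (?B (b / ?Y) (c / ?Y)) (a / ?Y))" for a b c
  proof -
    have "gamma s t 0 a (vf_bracket b c) = - gamma s t 0 (vf_bracket b c) a" by (rule gamma_anti)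
    then show ?thesis unfolding gamma_0_antisymmetric vf_bracket_over_Y by simp
  qed
  have "gamma s t 0 x (vf_bracket y z) + gamma s t 0 y (vf_bracket z x) + gamma s t 0 z (vf_bracket x y)
    = 1 / 24 * res_inf s t (?C (?B (y / ?Y) (z / ?Y)) (x / ?Y) + ?C (?B (z / ?Y) (x / ?Y)) (y / ?Y)
        + ?C (?B (x / ?Y) (y / ?Y)) (z / ?Y))"
    unfolding g res_inf_add distrib_left by (simp only: add_ac)
  also have "\<dots> = 0"
    unfolding derivation.third_order_cocycle [OF derivation_cD] res_inf_cD by simp
  finally have 0: "gamma s t 0 x (vf_bracket y z) + gamma s t 0 y (vf_bracket z x)
      + gamma s t 0 z (vf_bracket x y) = 0" .
  have "psi s t R (vf_bracket x (vf_bracket y z)) + psi s t R (vf_bracket y (vf_bracket z x))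
      + psi s t R (vf_bracket z (vf_bracket x y)) = 0"
    unfolding psi_add [symmetric] vf_jacobi by simp
  then have "(gamma s t 0 x (vf_bracket y z) + gamma s t 0 y (vf_bracket z x)
      + gamma s t 0 z (vf_bracket x y)) + (psi s t R (vf_bracket x (vf_bracket y z))
      + psi s t R (vf_bracket y (vf_bracket z x)) + psi s t R (vf_bracket z (vf_bracket x y))) = 0"
    unfolding 0 by simp
  then show ?thesis unfolding gamma_coboundary [of s t R] by (simp only: add_ac)
qed

section \<open>The centrally extended algebras\<close>

lemma module_fls_scale: "module fls_scale"
  by unfold_locales (simp_all add: fls_scale_def algebra_simps fls_plus_const [symmetric])

lemma W_bracket_closed:
  assumes "x \<in> W s t" "y \<in> W s t"
  shows "vf_bracket x y \<in> W s t"
proof -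
  interpret module fls_scale by (rule module_fls_scale)
  have sub: "subspace (W s t)" unfolding W_def by (rule subspace_span)
  have vf_zero: "vf_bracket 0 z = 0" "vf_bracket z 0 = 0" for z
    using vf_bracket_const_left [of 0 0 z] vf_bracket_const_right [of z 0 0] by simp_all
  have V: "V s t n \<in> W s t" for n unfolding W_def by (rule span_base) simp
  have sc: "fls_const a * z \<in> W s t" if "z \<in> W s t" for a z
    using subspace_scale [OF sub that] by (simp add: fls_scale_def)
  have 1: "vf_bracket (V s t n) (V s t m) \<in> W s t" for n m
    unfolding V_bracket by (intro subspace_add [OF sub] sc V)
  have 2: "vf_bracket (V s t n) z \<in> W s t" if "z \<in> W s t" for n z
  proof -
    have "subspace {z. vf_bracket (V s t n) z \<in> W s t}"
      using subspace_add [OF sub] sc subspace_0 [OF sub]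
      unfolding subspace_def
      by (auto simp: vf_bracket_add_right vf_bracket_const_right fls_scale_def vf_zero)
    then have "W s t \<subseteq> {z. vf_bracket (V s t n) z \<in> W s t}"
      unfolding W_def using 1 by (intro span_minimal) (auto simp: W_def)
    then show ?thesis using that by blast
  qed
  have "subspace {z. vf_bracket z y \<in> W s t}"
    using subspace_add [OF sub] sc subspace_0 [OF sub]
    unfolding subspace_def
    by (auto simp: vf_bracket_add_left vf_bracket_const_left fls_scale_def vf_zero)
  then have "W s t \<subseteq> {z. vf_bracket z y \<in> W s t}"
    unfolding W_def using 2 [OF assms(2)] by (intro span_minimal) (auto simp: W_def)
  then show ?thesis using assms(1) by blast
qed

text \<open>Scalar multiplication of the centrally extended algebras.\<close>

abbreviation pair_scale :: "complex \<Rightarrow> complex \<times> complex fls \<Rightarrow> complex \<times> complex fls" where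
  "pair_scale \<equiv> \<lambda>a (z, x). (a * z, fls_scale a x)"

lemma module_pair_scale: "module pair_scale"
  by unfold_locales (auto simp: fls_scale_def algebra_simps fls_plus_const [symmetric] plus_prod_def)

lemma lie_algebra_W_hat: "lie_algebra (W_hat s ct R t)"
proof -
  interpret f: module fls_scale by (rule module_fls_scale)
  interpret p: module pair_scale by (rule module_pair_scale)
  have sub: "f.subspace (W s t)" unfolding W_def by (rule f.subspace_span)
  have sub': "p.subspace (UNIV \<times> W s t)"
    using sub unfolding f.subspace_def p.subspace_def by (auto simp: zero_prod_def plus_prod_def)
  have coc: "ct t * gamma s t (R t) x (vf_bracket y z) + ct t * gamma s t (R t) y (vf_bracket z x)
      + ct t * gamma s t (R t) z (vf_bracket x y) = 0" for x y z
    using gamma_cocycle [of s t "R t" x y z] by (simp only: distrib_left [symmetric]) simp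
  show ?thesis
    unfolding lie_algebra_def W_hat_def lie_struct.simps
    by (intro conjI module_pair_scale sub')
       (auto simp: W_bracket_closed fls_scale_def vf_bracket_add_left vf_bracket_add_right
         vf_bracket_const_left vf_bracket_const_right vf_bracket_self gamma_add_left gamma_add_right gamma_const_left
         gamma_const_right gamma_self vf_jacobi coc distrib_left mult.left_commute zero_prod_def plus_prod_def)
qed

section \<open>The cocycle in the basis\<close>

text \<open>The value of the cocycle on \<open>(V\<^sub>n, V\<^sub>m)\<close> for \<open>R = 0\<close>, as a polynomial in \<open>p\<close> and \<open>q\<close>. It is
  nonzero only for \<open>n + m \<in> {0, 2, 4}\<close> (both odd) or \<open>n + m \<in> {0, 2, 4, 6, 8}\<close> (both even).\<close>

definition cocycle_coeff :: "int \<Rightarrow> int \<Rightarrow> complex \<Rightarrow> complex \<Rightarrow> complex" where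
  "cocycle_coeff n m p q =
     (if odd n \<and> odd m then
        let k = (n - 1) div 2; l = (m - 1) div 2 in
          - (1 / 6) * of_int l *
            ((if k + l = - 1 then of_int (4 * k^2 + 2 * k) else 0)
             + (if k + l = 0 then of_int (4 * k^2) * p else 0)
             + (if k + l = 1 then of_int (4 * k^2 - 2 * k) * q else 0))
      else if even n \<and> even m then
        let a = n div 2 - 2; b = m div 2 - 2;
            A0 = of_int ((6 + 4 * a) * (a + 2)); A1 = of_int ((4 + 4 * a) * (a + 1));
            A2 = of_int ((2 + 4 * a) * a);
            B0 = of_int (6 + 4 * b); B1 = of_int (4 + 4 * b); B2 = of_int (2 + 4 * b) in
          - (1 / 24) *
            ((if a + b = - 4 then A0 * B0 else 0)
             + (if a + b = - 3 then (A0 * B1 + A1 * B0) * p else 0)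
             + (if a + b = - 2 then (A0 * B2 + A2 * B0) * q + A1 * B1 * p ^ 2 else 0)
             + (if a + b = - 1 then (A1 * B2 + A2 * B1) * p * q else 0)
             + (if a + b = 0 then A2 * B2 * q ^ 2 else 0))
      else 0)"

lemma fls_half: "(1 / 2 :: complex fls) = fls_const (1 / 2)"
  using fls_const_divide_const [of "1 :: complex" 2] by simp

lemma residue_monomials:
  "fls_residue ((fls_const a * cx s t powi i) * (fls_const b * cx s t powi j) * fls_deriv cX)
     = a * b * (if i + j = - 1 then - 2 else 0)"
proof -
  have "(fls_const a * cx s t powi i) * (fls_const b * cx s t powi j) * fls_deriv cX
      = fls_const (a * b) * (cx s t powi (i + j) * fls_deriv cX)"
    by (simp add: power_int_add fls_const_mult_const [symmetric] del: fls_const_mult_const)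
  then show ?thesis by (simp only: fls_residue_fls_const_times residue_x_powi)
qed

text \<open>The residue of \<open>D\<^sup>2E DF\<close> for even indices, with the common factors removed.\<close>

lemma residue_product:
  "fls_residue ((fls_const A0 * cx s t powi (a + 1) + fls_const (A1 * p) * cx s t powi a
       + fls_const (A2 * q) * cx s t powi (a - 1))
     * (fls_const B0 * cx s t powi (b + 2) + fls_const (B1 * p) * cx s t powi (b + 1)
       + fls_const (B2 * q) * cx s t powi b) * fls_deriv cX) =
     - 2 * ((if a + b = - 4 then A0 * B0 else 0)
             + (if a + b = - 3 then (A0 * B1 + A1 * B0) * p else 0)
             + (if a + b = - 2 then (A0 * B2 + A2 * B0) * q + A1 * B1 * p ^ 2 else 0)
             + (if a + b = - 1 then (A1 * B2 + A2 * B1) * p * q else 0)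
             + (if a + b = 0 then A2 * B2 * q ^ 2 else 0))"
proof -
  have e: "a + 1 + (b + 2) = a + b + 3" "a + 1 + (b + 1) = a + b + 2" "a + 1 + b = a + b + 1"
    "a + (b + 2) = a + b + 2" "a + (b + 1) = a + b + 1" "a - 1 + (b + 2) = a + b + 1"
    "a - 1 + (b + 1) = a + b" "a - 1 + b = a + b - 1" by simp_all
  consider "a + b = - 4" | "a + b = - 3" | "a + b = - 2" | "a + b = - 1" | "a + b = 0"
      | "a + b \<noteq> - 4" "a + b \<noteq> - 3" "a + b \<noteq> - 2" "a + b \<noteq> - 1" "a + b \<noteq> 0" by blast
  then show ?thesis
    unfolding distrib_right distrib_left fls_residue_add residue_monomials e
    by cases (simp_all add: algebra_simps power2_eq_square)
qed

lemma gamma_V: "gamma s t 0 (V s t n) (V s t m) = cocycle_coeff n m (pcoef s * t) (qcoef s * t ^ 2)"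
proof -
  define p q where "p = pcoef s * t" and "q = qcoef s * t ^ 2"
  interpret cubic ddX "cx s t" "cY s t" "fls_const p" "fls_const q"
    unfolding p_def q_def by (rule cubic_ddX)
  let ?x = "cx s t" and ?Y = "cY s t" and ?X' = "fls_deriv cX" and ?D = "cD s t"
  have Vo: "V s t (2 * k + 1) / ?Y = ?x powi k" for k
    by (simp add: V_cubic cubic_vf_odd)
  have Ve: "V s t (2 * k) / ?Y = 1 / 2 * ?Y * ?x powi (k - 2)" for k
    by (simp add: V_cubic cubic_vf_even power2_eq_square)
  define Do where "Do k = fls_const (of_int k) * ?x powi (k - 1)" for k
  define D2o where "D2o k = fls_const (of_int (4*k^2 + 2*k)) * ?x powi (k + 1)
    + fls_const (of_int (4*k^2) * p) * ?x powi k + fls_const (of_int (4*k^2 - 2*k) * q) * ?x powi (k - 1)" for k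
  define De where "De a = fls_const (of_int (6 + 4*a)) * ?x powi (a + 2)
    + fls_const (of_int (4 + 4*a) * p) * ?x powi (a + 1) + fls_const (of_int (2 + 4*a) * q) * ?x powi a" for a
  define D2e where "D2e a = fls_const (of_int ((6 + 4*a) * (a + 2))) * ?x powi (a + 1)
    + fls_const (of_int ((4 + 4*a) * (a + 1)) * p) * ?x powi a
    + fls_const (of_int ((2 + 4*a) * a) * q) * ?x powi (a - 1)" for a
  note defs = Do_def D2o_def De_def D2e_def
  have Do: "?D (?x powi k) = ?Y * Do k" for k
    using D_odd [of k] unfolding cD_def defs by (simp only: fls_of_int)
  have D2o: "?D (?D (?x powi k)) = D2o k" for k
    using D2_odd [of k] unfolding cD_def defs by (simp only: fls_of_int fls_const_mult_const)
  have De: "?D (1 / 2 * ?Y * ?x powi a) = fls_const (1 / 2) * De a" for a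
    using D_even [of a] unfolding cD_def defs by (simp only: fls_of_int fls_const_mult_const fls_half)
  have D2e: "?D (?D (1 / 2 * ?Y * ?x powi a)) = ?Y * (fls_const (1 / 2) * D2e a)" for a
    using D2_even [of a] unfolding cD_def defs by (simp only: fls_of_int fls_const_mult_const fls_half)
  have ev: "fls_even (Do k)" "fls_even (D2o k)" "fls_even (De k)" "fls_even (D2e k)" for k
    unfolding defs by (intro fls_even_add fls_even_mult fls_even_const fls_even_power_int even_cx)+
  consider "odd n" "odd m" | "odd n" "even m" | "even n" "odd m" | "even n" "even m" by blast
  then have "gamma s t 0 (V s t n) (V s t m) = cocycle_coeff n m p q"
  proof cases
    case 1
    then obtain k l where nm: "n = 2 * k + 1" "m = 2 * l + 1" by (auto elim!: oddE)
    have "gamma s t 0 (V s t n) (V s t m) = 1 / 12 * res_inf s t (D2o k * (?Y * Do l))"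
      unfolding gamma_0_product nm Vo D2o unfolding Do ..
    also have "\<dots> = 1 / 12 * fls_residue (D2o k * Do l * ?X')"
      unfolding res_inf_def by (simp add: mult_ac)
    also have "\<dots> = cocycle_coeff n m p q"
      unfolding defs distrib_right fls_residue_add residue_monomials
      by (simp add: cocycle_coeff_def nm Let_def)
    finally show ?thesis .
  next
    case 2
    then obtain k l where nm: "n = 2 * k + 1" "m = 2 * l" by (auto elim!: oddE evenE)
    have "gamma s t 0 (V s t n) (V s t m) = 1 / 12 * res_inf s t (D2o k * (fls_const (1 / 2) * De (l - 2)))"
      unfolding gamma_0_product nm Vo Ve D2o unfolding De ..
    also have "\<dots> = 0"
      unfolding res_inf_def by (subst residue_even_over_Y) (simp_all only: fls_even_mult ev fls_even_const mult_zero_right)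
    finally show ?thesis using 2 by (simp add: cocycle_coeff_def)
  next
    case 3
    then obtain k l where nm: "n = 2 * k" "m = 2 * l + 1" by (auto elim!: oddE evenE)
    have "gamma s t 0 (V s t n) (V s t m) = 1 / 12 * res_inf s t (?Y * (fls_const (1 / 2) * D2e (k - 2)) * (?Y * Do l))"
      unfolding gamma_0_product nm Vo Ve D2e unfolding Do ..
    also have "\<dots> = 1 / 12 * fls_residue ((fls_const (1 / 2) * D2e (k - 2) * Do l) * ?Y * ?X')"
      unfolding res_inf_def by (simp add: mult_ac)
    also have "\<dots> = 0"
      by (subst residue_even_Y) (simp_all only: fls_even_mult ev fls_even_const mult_zero_right)
    finally show ?thesis using 3 by (simp add: cocycle_coeff_def)
  next
    case 4
    then obtain k l where nm: "n = 2 * k" "m = 2 * l" by (auto elim!: evenE)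
    have c: "1 / 48 * (- 2 * z) = - (1 / 24) * z" for z :: complex by simp
    have "gamma s t 0 (V s t n) (V s t m) =
        1 / 12 * res_inf s t (?Y * (fls_const (1 / 2) * D2e (k - 2)) * (fls_const (1 / 2) * De (l - 2)))"
      unfolding gamma_0_product nm Ve D2e unfolding De ..
    also have "?Y * (fls_const (1 / 2) * D2e (k - 2)) * (fls_const (1 / 2) * De (l - 2)) =
        fls_const (1 / 4) * (D2e (k - 2) * De (l - 2) * ?Y)"
      using fls_const_mult_const [of "1 / 2 :: complex" "1 / 2", symmetric]
      by (simp add: mult_ac del: fls_const_mult_const)
    also have "1 / 12 * res_inf s t \<dots> = 1 / 48 * fls_residue (D2e (k - 2) * De (l - 2) * ?X')"
      unfolding res_inf_const_mult unfolding res_inf_def by simp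
    also have "\<dots> = cocycle_coeff n m p q"
      unfolding defs residue_product c by (simp add: cocycle_coeff_def nm Let_def)
    finally show ?thesis .
  qed
  then show ?thesis by (simp add: p_def q_def)
qed

text \<open>Weighted homogeneity: \<open>p\<close> has weight 2 and \<open>q\<close> weight 4.\<close>

lemma cocycle_coeff_homogeneous:
  assumes "r \<noteq> 0"
  shows "cocycle_coeff n m (p * r ^ 2) (q * r ^ 4) = r powi (n + m) * cocycle_coeff n m p q"
proof -
  consider "odd n" "odd m" | "odd n \<noteq> odd m" | "even n" "even m" by blast
  then show ?thesis
  proof cases
    case 1
    then obtain k l where nm: "n = 2 * k + 1" "m = 2 * l + 1" by (auto elim!: oddE)
    have e: "n + m = 2 * (k + l) + 2" by (simp add: nm)
    have "(if j = - 1 then A else 0) + (if j = 0 then B * (p * r ^ 2) else 0) + (if j = 1 then C * (q * r ^ 4) else 0)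
      = r powi (2 * j + 2) * ((if j = - 1 then A else 0) + (if j = 0 then B * p else 0) + (if j = 1 then C * q else 0))"
      for j A B C by simp
    then show ?thesis unfolding e unfolding nm cocycle_coeff_def by (simp add: Let_def)
  next
    case 2
    then show ?thesis by (auto simp: cocycle_coeff_def)
  next
    case 3
    then obtain k l where nm: "n = 2 * k" "m = 2 * l" by (auto elim!: evenE)
    define a b where "a = n div 2 - 2" and "b = m div 2 - 2"
    have e: "n + m = 2 * (a + b) + 8" by (simp add: nm a_def b_def)
    have h: "(if j = - 4 then A else 0) + (if j = - 3 then B * (p * r ^ 2) else 0)
        + (if j = - 2 then C * (q * r ^ 4) + D * (p * r ^ 2) ^ 2 else 0)
        + (if j = - 1 then E * (p * r ^ 2) * (q * r ^ 4) else 0) + (if j = 0 then F * (q * r ^ 4) ^ 2 else 0)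
      = r powi (2 * j + 8) * ((if j = - 4 then A else 0) + (if j = - 3 then B * p else 0)
        + (if j = - 2 then C * q + D * p ^ 2 else 0)
        + (if j = - 1 then E * p * q else 0) + (if j = 0 then F * q ^ 2 else 0))"
      for j A B C D E F by (simp add: power_mult_distrib distrib_left mult_ac)
    show ?thesis
      unfolding e using 3 unfolding cocycle_coeff_def Let_def
      unfolding a_def [symmetric] b_def [symmetric] h by (simp only: if_False simp_thms mult.left_commute) simp
  qed
qed

lemma cocycle_coeff_0:
  "cocycle_coeff n m 0 0 = (if n = - m then - of_int (m ^ 3 - m) / 12 else 0)"
proof -
  consider "odd n" "odd m" | "odd n \<noteq> odd m" | "even n" "even m" by blast
  then show ?thesis
  proof cases
    case 1
    then obtain k l where nm: "n = 2 * k + 1" "m = 2 * l + 1" by (auto elim!: oddE)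
    show ?thesis
    proof (cases "k + l = - 1")
      case True
      then have k: "k = - 1 - l" by simp
      have c: "n = - m" unfolding nm k by simp
      have "cocycle_coeff n m 0 0 = - (1 / 6) * of_int l * of_int (4 * k^2 + 2 * k)"
        using True by (simp add: cocycle_coeff_def nm Let_def)
      also have "\<dots> = - of_int (m ^ 3 - m) / 12"
        unfolding k nm by (simp add: algebra_simps power2_eq_square power3_eq_cube)
      finally show ?thesis using c by simp
    next
      case False
      then have c: "n \<noteq> - m" unfolding nm by presburger
      then show ?thesis using False by (simp add: nm cocycle_coeff_def Let_def)
    qed
  next
    case 2
    then have "n \<noteq> - m" by auto
    with 2 show ?thesis by (auto simp: cocycle_coeff_def)
  next
    case 3
    then obtain k l where nm: "n = 2 * k" "m = 2 * l" by (auto elim!: evenE)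
    show ?thesis
    proof (cases "k + l = 0")
      case True
      then have k: "k = - l" by simp
      have c: "n = - m" unfolding nm k by simp
      have "cocycle_coeff n m 0 0 = - (1 / 24) * (of_int ((6 + 4 * (k - 2)) * (k - 2 + 2)) * of_int (6 + 4 * (l - 2)))"
        using True by (simp add: cocycle_coeff_def nm Let_def)
      also have "\<dots> = - of_int (m ^ 3 - m) / 12"
        unfolding k nm by (simp add: algebra_simps power3_eq_cube)
      finally show ?thesis using c by simp
    next
      case False
      then have c: "n \<noteq> - m" unfolding nm by presburger
      then show ?thesis using False by (simp add: nm cocycle_coeff_def Let_def)
    qed
  qed
qed

section \<open>Structure constants\<close>

text \<open>Structure constants of a central extension with parameters \<open>p\<close>, \<open>q\<close> and central term \<open>g\<close>,
  over an arbitrary commutative ring.\<close>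

fun hat_str :: "'a::comm_ring_1 \<Rightarrow> 'a \<Rightarrow> (int \<Rightarrow> int \<Rightarrow> 'a) \<Rightarrow> vir_basis \<Rightarrow> vir_basis \<Rightarrow> (vir_basis \<Rightarrow>\<^sub>0 'a)" where
  "hat_str p q g (Ell n) (Ell m) =
     Poly_Mapping.single (Ell (n + m)) (of_int (m - n))
     + Poly_Mapping.single (Ell (n + m - 2)) (of_int (lin_coeff 1 n m) * p)
     + Poly_Mapping.single (Ell (n + m - 4)) (of_int (lin_coeff 2 n m) * q)
     + Poly_Mapping.single Cen (g n m)"
| "hat_str p q g Cen _ = 0"
| "hat_str p q g (Ell n) Cen = 0"

lemma unital_ring_hom_of_int:
  assumes "unital_ring_hom h"
  shows "h (of_int k) = of_int k"
proof -
  have n: "h (of_nat n) = of_nat n" for n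
    using assms unital_ring_hom_0 [OF assms] by (induction n) (simp_all add: unital_ring_hom_def)
  have "h (- x) + h x = 0" for x
    using assms unital_ring_hom_0 [OF assms] unfolding unital_ring_hom_def by (metis add.left_inverse)
  then have "h (- x) = - h x" for x by (simp add: eq_neg_iff_add_eq_0)
  then show ?thesis using n by (cases k rule: int_cases2) simp_all
qed

lemma map_hat_str:
  assumes h: "unital_ring_hom h"
  shows "Poly_Mapping.map h (hat_str p q g i j) = hat_str (h p) (h q) (\<lambda>n m. h (g n m)) i j"
proof -
  have m: "h (x * y) = h x * h y" for x y using h by (simp add: unital_ring_hom_def)
  note s = pm_map_single [of h, OF unital_ring_hom_0 [OF h]] pm_map_zero [of h, OF unital_ring_hom_0 [OF h]]
  show ?thesis
  proof (cases i)
    case (Ell n)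
    then show ?thesis
      by (cases j) (simp_all only: hat_str.simps pm_map_add [OF h] s m unital_ring_hom_of_int [OF h])
  next
    case Cen
    then show ?thesis by (simp add: s)
  qed
qed

text \<open>The standard central extension. The sign of the cocycle is chosen so that \<open>p = q = 0\<close> gives
  the Virasoro algebra.\<close>

definition std_str :: "complex \<Rightarrow> complex \<Rightarrow> vir_basis \<Rightarrow> vir_basis \<Rightarrow> (vir_basis \<Rightarrow>\<^sub>0 complex)" where
  "std_str p q = hat_str p q (\<lambda>n m. - cocycle_coeff n m p q)"

lemma std_str_0: "std_str 0 0 i j = vir_str i j"
proof (cases i; cases j)
  fix n m assume "i = Ell n" "j = Ell m"
  then show ?thesis by (simp add: std_str_def cocycle_coeff_0 diff_divide_distrib)
qed (simp_all add: std_str_def)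

section \<open>Bases of the centrally extended algebras\<close>

text \<open>The family \<open>(\<omega>\<^sub>n, c\<^sub>n V\<^sub>n)\<close>, \<open>(\<kappa>, 0)\<close>, which is a basis of the extension if \<open>\<kappa>\<close> and all
  \<open>c\<^sub>n\<close> are nonzero.\<close>

definition hat_basis :: "proj_line \<Rightarrow> complex \<Rightarrow> (int \<Rightarrow> complex) \<Rightarrow> complex \<Rightarrow> (int \<Rightarrow> complex) \<Rightarrow> vir_basis \<Rightarrow> complex \<times> complex fls" where
  "hat_basis s t \<omega> \<kappa> c i = (case i of Ell n \<Rightarrow> (\<omega> n, fls_scale (c n) (V s t n)) | Cen \<Rightarrow> (\<kappa>, 0))"

lemma snd_sum: "snd (sum f S) = (\<Sum>i\<in>S. snd (f i))"
  by (induction S rule: infinite_finite_induct) (simp_all add: plus_prod_def zero_prod_def)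

lemma snd_hat_basis_sum_nz:
  assumes c: "\<And>n. c n \<noteq> 0" and x: "Poly_Mapping.lookup x (Ell n) \<noteq> 0"
  shows "snd (lin_ext pair_scale (hat_basis s t \<omega> \<kappa> c) x) \<noteq> 0"
proof -
  let ?S = "{n. Ell n \<in> Poly_Mapping.keys x}"
  have fin: "finite ?S"
    using finite_vimageI [OF finite_keys [of x], of Ell] by (simp add: inj_def vimage_def)
  have "snd (lin_ext pair_scale (hat_basis s t \<omega> \<kappa> c) x)
      = (\<Sum>i\<in>Poly_Mapping.keys x. fls_scale (Poly_Mapping.lookup x i) (snd (hat_basis s t \<omega> \<kappa> c i)))"
    unfolding lin_ext_def snd_sum by (simp add: case_prod_beta)
  also have "\<dots> = (\<Sum>i\<in>Ell ` ?S. fls_scale (Poly_Mapping.lookup x i) (snd (hat_basis s t \<omega> \<kappa> c i)))"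
  proof (rule sum.mono_neutral_right)
    show "\<forall>i\<in>Poly_Mapping.keys x - Ell ` ?S.
        fls_scale (Poly_Mapping.lookup x i) (snd (hat_basis s t \<omega> \<kappa> c i)) = 0"
    proof
      fix i assume "i \<in> Poly_Mapping.keys x - Ell ` ?S"
      then show "fls_scale (Poly_Mapping.lookup x i) (snd (hat_basis s t \<omega> \<kappa> c i)) = 0"
        by (cases i) (auto simp: hat_basis_def fls_scale_def)
    qed
  qed auto
  also have "\<dots> = (\<Sum>n\<in>?S. fls_const (Poly_Mapping.lookup x (Ell n) * c n) * V s t n)"
    by (subst sum.reindex)
       (auto simp: inj_on_def hat_basis_def fls_scale_def mult.assoc fls_const_mult_const [symmetric]
         simp del: fls_const_mult_const)
  also have "\<dots> \<noteq> 0"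
  proof (rule fls_sum_leading [of ?S "V s t" "\<lambda>n. Poly_Mapping.lookup x (Ell n) * c n"])
    show "?S \<noteq> {}" using x by (auto simp: in_keys_iff)
    show "inj_on (\<lambda>i. fls_subdegree (V s t i)) ?S" by (auto simp: inj_on_def V_subdegree)
  qed (use fin c in \<open>auto simp: in_keys_iff\<close>)
  finally show ?thesis .
qed

lemma bij_hat_basis:
  assumes c: "\<And>n. c n \<noteq> 0" and \<kappa>: "\<kappa> \<noteq> 0"
  shows "bij_betw (lin_ext pair_scale (hat_basis s t \<omega> \<kappa> c)) UNIV (UNIV \<times> W s t)"
proof -
  let ?b = "hat_basis s t \<omega> \<kappa> c"
  let ?l = "lin_ext pair_scale ?b"
  note hom = module_hom_lin_ext [OF module_pair_scale, of ?b]
  interpret f: module fls_scale by (rule module_fls_scale)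
  interpret p: module pair_scale by (rule module_pair_scale)
  interpret h: module_hom pm_scale pair_scale ?l by (rule hom)
  have ls: "?l (Poly_Mapping.single i a) = pair_scale a (?b i)" for i a
    by (rule lin_ext_single [OF module_pair_scale])
  have "inj ?l"
  proof (rule injI)
    fix x y assume "?l x = ?l y"
    then have 0: "?l (x - y) = 0" by (simp add: h.diff)
    define z where "z = x - y"
    have E: "Poly_Mapping.lookup z (Ell n) = 0" for n
      using snd_hat_basis_sum_nz [where c = c and x = z and n = n and s = s and t = t and \<omega> = \<omega> and \<kappa> = \<kappa>]
        c 0 by (auto simp: z_def zero_prod_def)
    have "z = Poly_Mapping.single Cen (Poly_Mapping.lookup z Cen)"
    proof (rule poly_mapping_eqI)
      show "Poly_Mapping.lookup z k = Poly_Mapping.lookup (Poly_Mapping.single Cen (Poly_Mapping.lookup z Cen)) k" for k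
        by (cases k) (simp_all add: E lookup_single)
    qed
    then have "?l z = ?l (Poly_Mapping.single Cen (Poly_Mapping.lookup z Cen))" by (rule arg_cong)
    then have "?l z = pair_scale (Poly_Mapping.lookup z Cen) (?b Cen)" unfolding ls .
    with 0 \<kappa> have "Poly_Mapping.lookup z Cen = 0"
      by (simp add: z_def hat_basis_def fls_scale_def zero_prod_def)
    with E have "Poly_Mapping.lookup z k = 0" for k by (cases k) simp_all
    then have "z = 0" by (intro poly_mapping_eqI) simp
    then show "x = y" by (simp add: z_def)
  qed
  moreover have "range ?l = UNIV \<times> W s t"
  proof
    have sub: "f.subspace (W s t)" unfolding W_def by (rule f.subspace_span)
    have V: "V s t n \<in> W s t" for n unfolding W_def by (rule f.span_base) simp
    have S: "snd (?l x) \<in> W s t" for x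
      unfolding lin_ext_def snd_sum
      by (rule f.subspace_sum [OF sub])
         (auto simp: case_prod_beta hat_basis_def f.subspace_0 [OF sub] intro!: f.subspace_scale [OF sub] V split: vir_basis.split)
    show "range ?l \<subseteq> UNIV \<times> W s t"
    proof
      fix z assume "z \<in> range ?l"
      then obtain x where "z = ?l x" by blast
      then show "z \<in> UNIV \<times> W s t" using S [of x] by (simp only: mem_Times_iff UNIV_I simp_thms)
    qed
  next
    have sub: "p.subspace (range ?l)"
      using h.subspace_image [of UNIV] by (simp add: module.subspace_UNIV module_pm_scale)
    have C: "(a, 0) \<in> range ?l" for a
    proof -
      have "?l (Poly_Mapping.single Cen (a / \<kappa>)) = (a, 0)"
        unfolding ls using \<kappa> by (simp add: hat_basis_def fls_scale_def)
      then show ?thesis by (rule range_eqI [OF sym])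
    qed
    have E: "(0, V s t n) \<in> range ?l" for n
    proof -
      have "?l (Poly_Mapping.single (Ell n) (1 / c n)) = (\<omega> n / c n, V s t n)"
        unfolding ls using c [of n] by (simp add: hat_basis_def fls_scale_def mult.assoc [symmetric])
      then have "(\<omega> n / c n, V s t n) \<in> range ?l" by (rule range_eqI [OF sym])
      then have "(\<omega> n / c n, V s t n) - (\<omega> n / c n, 0) \<in> range ?l"
        using p.subspace_diff [OF sub _ C] by blast
      then show ?thesis by (simp add: minus_prod_def)
    qed
    have "f.subspace {w. (0, w) \<in> range ?l}"
      unfolding f.subspace_def
    proof (intro conjI ballI allI)
      show "0 \<in> {w. (0, w) \<in> range ?l}" using C by simp
      show "x + y \<in> {w. (0, w) \<in> range ?l}"
        if "x \<in> {w. (0, w) \<in> range ?l}" "y \<in> {w. (0, w) \<in> range ?l}" for x y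
      proof -
        have "(0, x) + (0, y) \<in> range ?l" using that by (intro p.subspace_add [OF sub]) simp_all
        then show ?thesis by (simp add: plus_prod_def)
      qed
      show "fls_scale a x \<in> {w. (0, w) \<in> range ?l}" if "x \<in> {w. (0, w) \<in> range ?l}" for a x
      proof -
        have "pair_scale a (0, x) \<in> range ?l" using that by (intro p.subspace_scale [OF sub]) simp_all
        then show ?thesis by simp
      qed
    qed
    then have W: "W s t \<subseteq> {w. (0, w) \<in> range ?l}"
      unfolding W_def using E by (intro f.span_minimal) auto
    show "UNIV \<times> W s t \<subseteq> range ?l"
    proof
      fix z :: "complex \<times> complex fls" assume "z \<in> UNIV \<times> W s t"
      then obtain a :: complex and w where z: "z = (a, w)" "w \<in> W s t" by auto
      then have "(a, 0) + (0, w) \<in> range ?l" using W C by (intro p.subspace_add [OF sub]) auto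
      then show "z \<in> range ?l" by (simp add: z plus_prod_def)
    qed
  qed
  ultimately show ?thesis by (simp add: bij_betw_def)
qed

lemma lscale_W_hat [simp]: "lscale (W_hat s ct R t) = pair_scale"
  and lcarrier_W_hat [simp]: "lcarrier (W_hat s ct R t) = UNIV \<times> W s t"
  by (simp_all add: W_hat_def)

lemma hat_iso:
  assumes c: "\<And>n. c n \<noteq> 0" and \<kappa>: "\<kappa> \<noteq> 0"
    and br: "\<And>n m. (ct t * gamma s t (R t) (fls_scale (c n) (V s t n)) (fls_scale (c m) (V s t m)),
        vf_bracket (fls_scale (c n) (V s t n)) (fls_scale (c m) (V s t m))) =
      lin_ext pair_scale (hat_basis s t \<omega> \<kappa> c) (str (Ell n) (Ell m))"
    and cen: "\<And>i. str Cen i = 0" "\<And>i. str i Cen = 0"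
  shows "lie_iso (free_lie (bilin_ext str)) (W_hat s ct R t)
    (lin_ext (lscale (W_hat s ct R t)) (hat_basis s t \<omega> \<kappa> c))"
proof (rule lie_iso_lin_ext [OF lie_algebra_W_hat])
  show "bij_betw (lin_ext (lscale (W_hat s ct R t)) (hat_basis s t \<omega> \<kappa> c)) UNIV (lcarrier (W_hat s ct R t))"
    using bij_hat_basis [OF c \<kappa>] by simp
next
  have z: "vf_bracket x 0 = 0" "vf_bracket 0 x = 0" "gamma s t (R t) x 0 = 0" "gamma s t (R t) 0 x = 0" for x
    using vf_bracket_const_left [of 0 0 x] vf_bracket_const_right [of x 0 0]
      gamma_const_left [of s t "R t" 0 0 x] gamma_const_right [of s t "R t" x 0 0] by simp_all
  show "lbracket (W_hat s ct R t) (hat_basis s t \<omega> \<kappa> c i) (hat_basis s t \<omega> \<kappa> c j) =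
      lin_ext (lscale (W_hat s ct R t)) (hat_basis s t \<omega> \<kappa> c) (str i j)" for i j
  proof (cases i; cases j)
    fix n m assume "i = Ell n" "j = Ell m"
    then show ?thesis using br [of n m] by (simp add: W_hat_def hat_basis_def)
  qed (simp_all add: cen lin_ext_zero [OF module_pair_scale] W_hat_def hat_basis_def z zero_prod_def)
qed

lemma hat_str_Cen_right [simp]: "hat_str p q g i Cen = 0"
  by (cases i) simp_all

lemma lin_ext_hat_str:
  "lin_ext pair_scale b (hat_str p q g (Ell n) (Ell m)) =
     pair_scale (of_int (m - n)) (b (Ell (n + m)))
     + pair_scale (of_int (lin_coeff 1 n m) * p) (b (Ell (n + m - 2)))
     + pair_scale (of_int (lin_coeff 2 n m) * q) (b (Ell (n + m - 4)))
     + pair_scale (g n m) (b Cen)"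
  unfolding hat_str.simps lin_ext_add [OF module_pair_scale] lin_ext_single [OF module_pair_scale] ..

lemma hat_iso_basis:
  "lie_iso (free_lie (bilin_ext (hat_str (pcoef s * t) (qcoef s * t ^ 2)
       (\<lambda>n m. ct t * gamma s t (R t) (V s t n) (V s t m))))) (W_hat s ct R t)
    (lin_ext (lscale (W_hat s ct R t)) (W_hat_basis s t))"
proof -
  have b: "W_hat_basis s t = hat_basis s t (\<lambda>_. 0) 1 (\<lambda>_. 1)"
  proof
    show "W_hat_basis s t i = hat_basis s t (\<lambda>_. 0) 1 (\<lambda>_. 1) i" for i
      by (cases i) (simp_all add: hat_basis_def fls_scale_def)
  qed
  show ?thesis unfolding b
  proof (rule hat_iso)
    show "(ct t * gamma s t (R t) (fls_scale 1 (V s t n)) (fls_scale 1 (V s t m)),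
        vf_bracket (fls_scale 1 (V s t n)) (fls_scale 1 (V s t m))) =
      lin_ext pair_scale (hat_basis s t (\<lambda>_. 0) 1 (\<lambda>_. 1)) (hat_str (pcoef s * t) (qcoef s * t ^ 2)
       (\<lambda>n m. ct t * gamma s t (R t) (V s t n) (V s t m)) (Ell n) (Ell m))" for n m
      unfolding lin_ext_hat_str by (simp add: hat_basis_def fls_scale_def V_bracket plus_prod_def)
  qed simp_all
qed

text \<open>The basis \<open>(ct t * \<psi>(r\<^sup>n V\<^sub>n), r\<^sup>n V\<^sub>n)\<close>, \<open>(- ct t, 0)\<close> absorbs the coboundary and the scaling
  of the cocycle and multiplies \<open>p\<close> by \<open>r\<^sup>2\<close> and \<open>q\<close> by \<open>r\<^sup>4\<close>.\<close>

lemma hat_iso_std: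
  assumes r: "r \<noteq> 0" and ct: "ct t \<noteq> 0"
  shows "lie_isomorphic (free_lie (bilin_ext (std_str (pcoef s * t * r ^ 2) (qcoef s * t ^ 2 * r ^ 4))))
    (W_hat s ct R t)"
proof -
  define c where "c n = r powi n" for n
  define \<omega> where "\<omega> n = ct t * (c n * psi s t (R t) (V s t n))" for n
  define p q where "p = pcoef s * t" and "q = qcoef s * t ^ 2"
  have cc: "c n * c m = c (n + m)" "r ^ 2 * c (n - 2) = c n" "r ^ 4 * c (n - 4) = c n" for n m
    using r by (simp_all add: c_def power_int_add power_int_diff)
  have "lie_iso (free_lie (bilin_ext (std_str (p * r ^ 2) (q * r ^ 4)))) (W_hat s ct R t)
    (lin_ext (lscale (W_hat s ct R t)) (hat_basis s t \<omega> (- ct t) c))"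
  proof (rule hat_iso)
    fix n m
    let ?v = "\<lambda>k. fls_scale (c k) (V s t k)"
    have br: "vf_bracket (?v n) (?v m) = fls_const (of_int (m - n)) * ?v (n + m)
      + fls_const (of_int (lin_coeff 1 n m) * (p * r ^ 2)) * ?v (n + m - 2)
      + fls_const (of_int (lin_coeff 2 n m) * (q * r ^ 4)) * ?v (n + m - 4)"
    proof -
      have e1: "c m * (c n * (x * p)) = x * (p * r ^ 2) * c (n + m - 2)"
       and e2: "c m * (c n * (x * q)) = x * (q * r ^ 4) * c (n + m - 4)"
       and e3: "c m * (c n * x) = x * c (n + m)" for x
        unfolding mult.assoc cc(2) [of "n + m"] cc(3) [of "n + m"] by (simp_all add: cc(1) [symmetric] mult_ac)
      show ?thesis
        unfolding fls_scale_def vf_bracket_const_left vf_bracket_const_right V_bracket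
          p_def [symmetric] q_def [symmetric] distrib_left mult.assoc [symmetric] fls_const_mult_const
        by (simp only: mult.assoc e1 e2 e3 cc(2) [of "n + m"] cc(3) [of "n + m"] mult.commute [of "c (n + m)"])
    qed
    have psi: "ct t * psi s t (R t) (?v k) = \<omega> k" for k
      by (simp add: fls_scale_def psi_const_mult \<omega>_def)
    have "ct t * gamma s t (R t) (?v n) (?v m) = ct t * gamma s t 0 (?v n) (?v m)
        + ct t * psi s t (R t) (vf_bracket (?v n) (?v m))"
      by (simp only: gamma_coboundary [of s t "R t"] distrib_left)
    also have "gamma s t 0 (?v n) (?v m) = cocycle_coeff n m (p * r ^ 2) (q * r ^ 4)"
      unfolding fls_scale_def gamma_const_left gamma_const_right gamma_V
        cocycle_coeff_homogeneous [OF r] p_def q_def by (simp add: cc(1) [symmetric] c_def power_int_add r)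
    also have "ct t * psi s t (R t) (vf_bracket (?v n) (?v m)) = of_int (m - n) * \<omega> (n + m)
        + of_int (lin_coeff 1 n m) * (p * r ^ 2) * \<omega> (n + m - 2)
        + of_int (lin_coeff 2 n m) * (q * r ^ 4) * \<omega> (n + m - 4)"
      unfolding br psi_add psi_const_mult psi [symmetric] by (simp add: algebra_simps)
    finally have g: "ct t * gamma s t (R t) (?v n) (?v m) =
        ct t * cocycle_coeff n m (p * r ^ 2) (q * r ^ 4) + (of_int (m - n) * \<omega> (n + m)
        + of_int (lin_coeff 1 n m) * (p * r ^ 2) * \<omega> (n + m - 2)
        + of_int (lin_coeff 2 n m) * (q * r ^ 4) * \<omega> (n + m - 4))" .
    show "(ct t * gamma s t (R t) (?v n) (?v m), vf_bracket (?v n) (?v m)) =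
      lin_ext pair_scale (hat_basis s t \<omega> (- ct t) c) (std_str (p * r ^ 2) (q * r ^ 4) (Ell n) (Ell m))"
      unfolding br g std_str_def lin_ext_hat_str
      by (simp add: hat_basis_def plus_prod_def) (simp add: fls_scale_def)
  qed (use r ct in \<open>simp_all add: c_def std_str_def\<close>)
  then show ?thesis unfolding lie_isomorphic_def p_def q_def by blast
qed

section \<open>Polynomial dependence on the parameter\<close>

lemma regular_const [simp]: "regular_function (\<lambda>_. c)"
  unfolding regular_function_def by (rule exI [of _ "[:c:]"]) simp

lemma regular_id: "regular_function (\<lambda>t. t)"
  unfolding regular_function_def by (rule exI [of _ "[:0, 1:]"]) simp

lemma regular_poly: "regular_function (\<lambda>t. poly p t)"
  unfolding regular_function_def by blast

lemma regular_functionE: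
  assumes "regular_function f" obtains p where "f = (\<lambda>t. poly p t)"
  using assms unfolding regular_function_def by blast

lemma regular_add: "regular_function f \<Longrightarrow> regular_function g \<Longrightarrow> regular_function (\<lambda>t. f t + g t)"
  by (elim regular_functionE) (simp only: poly_add [symmetric] regular_poly)

lemma regular_mult: "regular_function f \<Longrightarrow> regular_function g \<Longrightarrow> regular_function (\<lambda>t. f t * g t)"
  by (elim regular_functionE) (simp only: poly_mult [symmetric] regular_poly)

lemma regular_minus: "regular_function f \<Longrightarrow> regular_function (\<lambda>t. - f t)"
  by (elim regular_functionE) (simp only: poly_minus [symmetric] regular_poly)

lemma regular_power: "regular_function f \<Longrightarrow> regular_function (\<lambda>t. f t ^ n)"
  by (induction n) (simp_all add: regular_mult)

lemma regular_if: "(b \<Longrightarrow> regular_function f) \<Longrightarrow> (\<not> b \<Longrightarrow> regular_function g) \<Longrightarrow>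
    regular_function (\<lambda>t. if b then f t else g t)"
  by (cases b) simp_all

lemma regular_e1: "regular_function (e1 s)"
proof -
  have "e1 s = (\<lambda>t. case s of Finite _ \<Rightarrow> t | Infinity \<Rightarrow> 0)" by (cases s) auto
  then show ?thesis by (cases s) (simp_all add: regular_id)
qed

text \<open>The polynomial that represents a regular function.\<close>

definition the_poly :: "(complex \<Rightarrow> complex) \<Rightarrow> complex poly" where
  "the_poly f = (SOME p. \<forall>t. f t = poly p t)"

lemma poly_the_poly:
  assumes "regular_function f" shows "poly (the_poly f) t = f t"
proof -
  from assms have "\<forall>t. f t = poly (the_poly f) t"
    unfolding regular_function_def the_poly_def by (rule someI_ex)
  from this [rule_format, of t] show ?thesis by (rule sym)
qed

lemma regular_nonvanishing_const:
  assumes "regular_function f" "\<And>t. f t \<noteq> 0"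
  obtains c where "c \<noteq> 0" "\<And>t. f t = c"
proof -
  obtain p where p: "\<And>t. f t = poly p t" using assms(1) by (auto simp: regular_function_def)
  have "constant (poly p)"
    using fundamental_theorem_of_algebra [of p] assms(2) by (auto simp: p)
  then have "f t = f 0" for t unfolding p constant_def by blast
  then show ?thesis by (rule that [OF assms(2)])
qed

lemma regular_cocycle_coeff:
  "regular_function (\<lambda>t. cocycle_coeff n m (a * t) (b * t ^ 2))"
  unfolding cocycle_coeff_def Let_def
  by (intro regular_if regular_add regular_mult regular_minus regular_const regular_power regular_id)

lemma poly_at_pCons: "poly_at (pCons c P) t = fls_const (poly c t) + cX * poly_at P t"
  by (simp add: poly_at_def map_poly_pCons)

lemma poly_at_0 [simp]: "poly_at 0 t = 0"
  by (simp add: poly_at_def)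

lemma even_poly_at: "fls_even (poly_at P t)"
  by (induction P) (simp_all add: poly_at_pCons fls_even_add fls_even_mult even_cX)

text \<open>Residues of Laurent polynomials in \<open>X - e\<^sub>1\<close> whose coefficients depend polynomially on
  the parameter.\<close>

lemma regular_residue_poly_at:
  "regular_function (\<lambda>t. fls_residue (poly_at P t * cx s t powi j * fls_deriv cX))"
proof (induction P arbitrary: j)
  case 0
  then show ?case by simp
next
  case (pCons c P)
  have "fls_residue (poly_at (pCons c P) t * cx s t powi j * fls_deriv cX) =
      poly c t * (if j = - 1 then - 2 else 0)
      + (fls_residue (poly_at P t * cx s t powi (j + 1) * fls_deriv cX)
      + e1 s t * fls_residue (poly_at P t * cx s t powi j * fls_deriv cX))" for t
  proof -
    have X: "cX = cx s t + fls_const (e1 s t)" by (simp add: cx_def)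
    have "poly_at (pCons c P) t * cx s t powi j * fls_deriv cX =
      fls_const (poly c t) * (cx s t powi j * fls_deriv cX)
      + (poly_at P t * cx s t powi (j + 1) * fls_deriv cX
      + fls_const (e1 s t) * (poly_at P t * cx s t powi j * fls_deriv cX))"
      unfolding poly_at_pCons
      by (subst (1) X) (simp add: power_int_add algebra_simps)
    then show ?thesis
      by (simp only: fls_residue_add fls_residue_fls_const_times residue_x_powi)
  qed
  then show ?case
    by (simp only:) (intro regular_add regular_mult regular_poly regular_const regular_e1 pCons.IH)
qed

text \<open>By parity only one of the two parts of \<open>R = (P(X) + Q(X) Y) / x\<^sup>N\<close> contributes to the residue.\<close>

lemma regular_psi:
  assumes "algebraic_family s R"
  shows "regular_function (\<lambda>t. psi s t (R t) (V s t n))"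
proof -
  obtain P Q N where R: "\<And>t. R t = (poly_at P t + poly_at Q t * cY s t) / (cX - fls_const (e1 s t)) ^ N"
    using assms by (auto simp: algebraic_family_def)
  have R: "R t = (poly_at P t + poly_at Q t * cY s t) * cx s t powi (- int N)" for t
    by (simp add: R cx_def [symmetric] power_int_minus divide_inverse)
  show ?thesis
  proof (cases "odd n")
    case True
    then obtain k where n: "n = 2 * k + 1" by (auto elim!: oddE)
    have "psi s t (R t) (V s t n) = - (1 / 12) * fls_residue (poly_at Q t * cx s t powi (k - int N) * fls_deriv cX)" for t
    proof -
      have "R t * (V s t n / cY s t) = poly_at P t * cx s t powi (k - int N)
          + poly_at Q t * cx s t powi (k - int N) * cY s t"
        unfolding n V_cubic cubic_vf_odd by (simp add: R power_int_diff power_int_minus field_simps)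
      then have "R t * (V s t n / cY s t) / cY s t * fls_deriv cX =
          poly_at P t * cx s t powi (k - int N) / cY s t * fls_deriv cX
          + poly_at Q t * cx s t powi (k - int N) * fls_deriv cX"
        by (simp add: field_simps)
      moreover have "fls_residue (poly_at P t * cx s t powi (k - int N) / cY s t * fls_deriv cX) = 0"
        by (intro residue_even_over_Y fls_even_mult even_poly_at fls_even_power_int even_cx)
      ultimately show ?thesis unfolding psi_def res_inf_def by (simp only: fls_residue_add) simp
    qed
    then show ?thesis
      by (simp only:) (intro regular_mult regular_const regular_residue_poly_at)
  next
    case False
    then obtain k where n: "n = 2 * k" by (auto elim!: evenE)
    have "psi s t (R t) (V s t n) = - (1 / 24) * fls_residue (poly_at P t * cx s t powi (k - 2 - int N) * fls_deriv cX)" for t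
    proof -
      have pw: "cx s t powi (k - 2 - int N) = cx s t powi (k - 2) * cx s t powi (- int N)"
        using power_int_add [of "cx s t" "k - 2" "- int N"] by simp
      have "R t * (V s t n / cY s t) = fls_const (1 / 2) * (poly_at P t * cx s t powi (k - 2 - int N) * cY s t
          + poly_at Q t * cx s t powi (k - 2 - int N) * cY s t * cY s t)"
        unfolding fls_half [symmetric] n V_cubic cubic_vf_even R pw
        by (simp add: field_simps power2_eq_square)
      then have "R t * (V s t n / cY s t) / cY s t * fls_deriv cX =
          fls_const (1 / 2) * (poly_at P t * cx s t powi (k - 2 - int N) * fls_deriv cX
          + poly_at Q t * cx s t powi (k - 2 - int N) * cY s t * fls_deriv cX)"
        by (simp add: field_simps)
      moreover have "fls_residue (poly_at Q t * cx s t powi (k - 2 - int N) * cY s t * fls_deriv cX) = 0"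
        by (intro residue_even_Y fls_even_mult even_poly_at fls_even_power_int even_cx)
      ultimately show ?thesis unfolding psi_def res_inf_def
        by (simp only: fls_residue_add fls_residue_fls_const_times) simp
    qed
    then show ?thesis
      by (simp only:) (intro regular_mult regular_const regular_residue_poly_at)
  qed
qed

lemma gamma_V_formula:
  "gamma s t R (V s t n) (V s t m) = cocycle_coeff n m (pcoef s * t) (qcoef s * t ^ 2)
     + (of_int (m - n) * psi s t R (V s t (n + m))
     + of_int (lin_coeff 1 n m) * (pcoef s * t) * psi s t R (V s t (n + m - 2))
     + of_int (lin_coeff 2 n m) * (qcoef s * t ^ 2) * psi s t R (V s t (n + m - 4)))"
  unfolding gamma_coboundary [of s t R] gamma_V V_bracket psi_add psi_const_mult ..

lemma regular_gamma:
  assumes "algebraic_family s R"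
  shows "regular_function (\<lambda>t. gamma s t (R t) (V s t n) (V s t m))"
  unfolding gamma_V_formula
  by (intro regular_add regular_mult regular_const regular_power regular_id regular_cocycle_coeff
      regular_psi assms)

section \<open>The families over the affine line\<close>

text \<open>Structure constants over the coordinate ring of the affine line.\<close>

definition family_str :: "proj_line \<Rightarrow> (int \<Rightarrow> int \<Rightarrow> complex poly) \<Rightarrow> vir_basis \<Rightarrow> vir_basis \<Rightarrow> (vir_basis \<Rightarrow>\<^sub>0 complex poly)" where
  "family_str s = hat_str [:0, pcoef s:] [:0, 0, qcoef s:]"

lemma map_family_str:
  "Poly_Mapping.map (\<lambda>p. poly p t) (family_str s g i j) =
     hat_str (pcoef s * t) (qcoef s * t ^ 2) (\<lambda>n m. poly (g n m) t) i j"
proof -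
  have "poly [:0, pcoef s:] t = pcoef s * t" "poly [:0, 0, qcoef s:] t = qcoef s * t ^ 2"
    by (simp_all add: power2_eq_square)
  then show ?thesis
    unfolding family_str_def by (simp only: map_hat_str [OF unital_ring_hom_poly])
qed

text \<open>The family whose fibre over \<open>t\<close> is the standard extension with parameters
  \<open>pcoef s * t\<close> and \<open>qcoef s * t\<^sup>2\<close>.\<close>

definition std_family :: "proj_line \<Rightarrow> vir_basis \<Rightarrow> vir_basis \<Rightarrow> (vir_basis \<Rightarrow>\<^sub>0 complex poly)" where
  "std_family s = family_str s (\<lambda>n m. the_poly (\<lambda>t. - cocycle_coeff n m (pcoef s * t) (qcoef s * t ^ 2)))"

lemma map_std_family:
  "Poly_Mapping.map (\<lambda>p. poly p t) (std_family s i j) = std_str (pcoef s * t) (qcoef s * t ^ 2) i j"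
  unfolding std_family_def map_family_str std_str_def
  by (simp add: poly_the_poly regular_minus regular_cocycle_coeff)

lemma map_bilin_std_family:
  "Poly_Mapping.map (\<lambda>p. poly p t) (bilin_ext (std_family s) x y) =
     bilin_ext (std_str (pcoef s * t) (qcoef s * t ^ 2))
       (Poly_Mapping.map (\<lambda>p. poly p t) x) (Poly_Mapping.map (\<lambda>p. poly p t) y)"
  by (simp add: map_bilin_ext [OF unital_ring_hom_poly] map_std_family)

lemma lie_algebra_std: "lie_algebra (free_lie (bilin_ext (std_str (pcoef s * t) (qcoef s * t ^ 2))))"
  using hat_iso_std [of 1 "\<lambda>_. 1" t s "\<lambda>_. 0"] lie_algebra_free_transfer [OF lie_algebra_W_hat]
  unfolding lie_isomorphic_def by auto

lemma lie_algebra_std_family: "lie_algebra (free_lie (bilin_ext (std_family s)))"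
  unfolding lie_algebra_free_iff
proof (intro conjI allI)
  fix x y z :: "vir_basis \<Rightarrow>\<^sub>0 complex poly"
  note st = lie_algebra_std [of s, unfolded lie_algebra_free_iff]
  show "bilin_ext (std_family s) x x = 0"
    by (rule poly_pm_eq_0) (use st in \<open>simp add: map_bilin_std_family\<close>)
  show "bilin_ext (std_family s) x (bilin_ext (std_family s) y z) +
       bilin_ext (std_family s) y (bilin_ext (std_family s) z x) +
       bilin_ext (std_family s) z (bilin_ext (std_family s) x y) = 0"
    by (rule poly_pm_eq_0)
       (use st in \<open>simp add: map_bilin_std_family pm_map_add [OF unital_ring_hom_poly]\<close>)
qed

lemma virasoro_std: "virasoro = bilin_ext (std_str 0 0)"
proof -
  have "std_str 0 0 = vir_str" by (intro ext) (rule std_str_0)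
  then show ?thesis by (simp add: virasoro_def)
qed

lemma lie_algebra_virasoro: "lie_algebra (free_lie virasoro)"
  using lie_algebra_std [of undefined 0] by (simp add: virasoro_std)

lemma global_deformation_std_family:
  "global_deformation (\<lambda>c. [:c:]) (\<lambda>p. poly p 0) virasoro (bilin_ext (std_family s))"
  unfolding global_deformation_def augmented_algebra_def
  using lie_algebra_std_family lie_algebra_virasoro
  by (simp add: unital_ring_hom_const unital_ring_hom_poly map_bilin_std_family virasoro_std)

text \<open>The family of extensions belonging to \<open>R\<close> is carried to the standard one by the base
  change \<open>V\<^sub>n \<mapsto> l\<^sub>n + \<psi>(V\<^sub>n) c\<close>, \<open>c \<mapsto> - c / k\<close>, where \<open>k\<close> is the constant scaling
  the cocycle.\<close>

lemma family_iso_std: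
  assumes R: "algebraic_family s R" and ct: "regular_function ct" and nz: "\<And>t. ct t \<noteq> 0"
  shows "lie_isomorphic
     (free_lie (bilin_ext (family_str s (\<lambda>n m. the_poly (\<lambda>t. ct t * gamma s t (R t) (V s t n) (V s t m))))))
     (free_lie (bilin_ext (std_family s)))"
proof -
  obtain k where k: "k \<noteq> 0" "\<And>t. ct t = k" using regular_nonvanishing_const [OF ct nz] by blast
  define a where "a n = the_poly (\<lambda>t. psi s t (R t) (V s t n))" for n
  define F where "F = family_str s (\<lambda>n m. the_poly (\<lambda>t. ct t * gamma s t (R t) (V s t n) (V s t m)))"
  define b where "b i = (case i of Ell n \<Rightarrow> Poly_Mapping.single (Ell n) 1 + Poly_Mapping.single Cen (a n)
      | Cen \<Rightarrow> Poly_Mapping.single Cen [:- 1 / k:])" for i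
  define b' where "b' i = (case i of Ell n \<Rightarrow> Poly_Mapping.single (Ell n) 1 + Poly_Mapping.single Cen ([:k:] * a n)
      | Cen \<Rightarrow> Poly_Mapping.single Cen [:- k:])" for i
  note pm = module_pm_scale
  interpret pm: module "pm_scale :: complex poly \<Rightarrow> (vir_basis \<Rightarrow>\<^sub>0 complex poly) \<Rightarrow> _" by (rule pm)
  note L = lin_ext_add [OF pm] lin_ext_single [OF pm] pm.scale_one pm.scale_right_distrib
  have sc: "pm_scale x (Poly_Mapping.single i y) = Poly_Mapping.single i (x * y)" for x y :: "complex poly" and i :: vir_basis
    by (rule poly_mapping_eqI) (simp add: lookup_single when_def)
  have kk: "[:- k:] * [:- 1 / k:] = 1" "[:- 1 / k:] * [:- k:] = 1" "[:k:] * [:- 1 / k:] = - 1" "[:k:] * w * [:- 1 / k:] = - w" "w * [:- k:] = - ([:k:] * w)" for w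
    using k(1) by (simp_all add: one_pCons)
  have bb: "lin_ext pm_scale b (b' i) = Poly_Mapping.single i 1" for i
    by (cases i; simp only: b'_def b_def vir_basis.case L sc kk add.assoc single_add [symmetric]
        mult_1 minus_minus add.right_inverse single_zero add_0_right add.left_inverse)
  have bb': "lin_ext pm_scale b' (b i) = Poly_Mapping.single i 1" for i
    by (cases i; simp only: b'_def b_def vir_basis.case L sc kk add.assoc single_add [symmetric]
        mult_1 minus_minus add.right_inverse single_zero add_0_right add.left_inverse)
  have "bij_betw (lin_ext pm_scale b) UNIV UNIV"
    by (rule bij_betw_byWitness [where f' = "lin_ext pm_scale b'"])
       (simp_all add: lin_ext_lin_ext pm bb bb' lin_ext_basis)
  moreover have "bilin_ext (std_family s) (b i) (b j) = lin_ext pm_scale b (F i j)" for i j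
  proof -
    have cz: "std_family s i Cen = 0" "std_family s Cen i = 0" "F i Cen = 0" "F Cen i = 0" for i
      by (simp_all add: std_family_def family_str_def F_def)
    note hl = module_hom.add [OF bilin_ext_hom_left] and hr = module_hom.add [OF bilin_ext_hom_right]
    have Bs: "bilin_ext (std_family s) (Poly_Mapping.single i u) (Poly_Mapping.single j v) = pm_scale (u * v) (std_family s i j)" for i j u v
      by (rule bilin_ext_single)
    have B: "bilin_ext (std_family s) (b i) (b j) = (if i = Cen \<or> j = Cen then 0 else std_family s i j)" for i j
      by (cases i; cases j) (simp_all add: b_def hl hr Bs cz pm.scale_zero_right)
    show ?thesis
    proof (cases i; cases j)
      fix n m assume ij: "i = Ell n" "j = Ell m"
      let ?c0 = "of_int (m - n) :: complex poly" and ?c1 = "of_int (lin_coeff 1 n m) * [:0, pcoef s:]"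
        and ?c2 = "of_int (lin_coeff 2 n m) * [:0, 0, qcoef s:]"
      let ?G = "the_poly (\<lambda>t. ct t * gamma s t (R t) (V s t n) (V s t m))"
      let ?g = "the_poly (\<lambda>t. - cocycle_coeff n m (pcoef s * t) (qcoef s * t ^ 2))"
      have "poly ?g t = poly (?c0 * a (n + m) + ?c1 * a (n + m - 2) + ?c2 * a (n + m - 4) + ?G * [:- 1 / k:]) t" for t
      proof -
        have e: "poly ?g t = - cocycle_coeff n m (pcoef s * t) (qcoef s * t ^ 2)"
          by (simp add: poly_the_poly regular_minus regular_cocycle_coeff)
        have e': "poly ?G t = k * gamma s t (R t) (V s t n) (V s t m)"
          unfolding k by (rule poly_the_poly) (intro regular_mult regular_const regular_gamma R)
        have e'': "poly (a i) t = psi s t (R t) (V s t i)" for i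
          unfolding a_def by (rule poly_the_poly [OF regular_psi [OF R]])
        have oi: "poly (of_int i) t = of_int i" for i
          by (rule unital_ring_hom_of_int [OF unital_ring_hom_poly])
        show ?thesis
          unfolding poly_add poly_mult e e' e'' oi unfolding gamma_V_formula
          using k(1) by (simp add: field_simps power2_eq_square)
      qed
      then have g: "?g = ?c0 * a (n + m) + ?c1 * a (n + m - 2) + ?c2 * a (n + m - 4) + ?G * [:- 1 / k:]"
        by (simp add: poly_eq_poly_eq_iff [symmetric] fun_eq_iff)
      have "bilin_ext (std_family s) (b i) (b j) = std_family s (Ell n) (Ell m)" by (simp add: B ij)
      also have "\<dots> = lin_ext pm_scale b (F i j)"
        unfolding F_def std_family_def family_str_def ij hat_str.simps g L b_def vir_basis.case sc
        by (simp only: single_add mult_1_right add_ac)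
      finally show ?thesis .
    qed (simp_all add: B cz lin_ext_zero [OF pm])
  qed
  ultimately have "lie_iso (free_lie (bilin_ext F)) (free_lie (bilin_ext (std_family s)))
      (lin_ext (lscale (free_lie (bilin_ext (std_family s)))) b)"
    by (intro lie_iso_lin_ext lie_algebra_std_family) (simp_all add: free_lie_def)
  then show ?thesis unfolding lie_isomorphic_def F_def by blast
qed

section \<open>Locally finite elements\<close>

lemma lin_ext_bilin_ext:
  assumes sc: "module sc"
    and l: "\<And>y. module_hom sc sc (\<lambda>x. br x y)" and r: "\<And>x. module_hom sc sc (\<lambda>y. br x y)"
    and b: "\<And>i j. lin_ext sc b (str i j) = br (b i) (b j)"
  shows "lin_ext sc b (bilin_ext str x y) = br (lin_ext sc b x) (lin_ext sc b y)"
proof -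
  have "lin_ext sc b (bilin_ext str x y) = lin_ext sc (\<lambda>i. lin_ext sc (\<lambda>j. br (b i) (b j)) y) x"
    unfolding bilin_ext_def by (simp add: lin_ext_lin_ext sc b)
  also have "\<dots> = br (lin_ext sc b x) (lin_ext sc b y)"
    unfolding lin_ext_def module_hom.sum [OF l] module_hom.scale [OF l]
    unfolding module_hom.sum [OF r] module_hom.scale [OF r] ..
  finally show ?thesis .
qed

text \<open>The iterates of \<open>A\<close> on every vector have their supports in one finite set of basis
  indices. For linear \<open>A\<close> this is local finiteness: every vector lies in a finite-dimensional
  \<open>A\<close>-invariant subspace.\<close>

definition loc_finite :: "(('b \<Rightarrow>\<^sub>0 complex) \<Rightarrow> ('b \<Rightarrow>\<^sub>0 complex)) \<Rightarrow> bool" where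
  "loc_finite A \<longleftrightarrow> (\<forall>y. \<exists>T. finite T \<and> (\<forall>k. Poly_Mapping.keys ((A ^^ k) y) \<subseteq> T))"

text \<open>The bracket of the vector fields \<open>a d/du\<close> and \<open>b d/du\<close> in a local parameter \<open>u\<close>.\<close>

definition local_bracket :: "complex fls \<Rightarrow> complex fls \<Rightarrow> complex fls" where
  "local_bracket a b = a * fls_deriv b - b * fls_deriv a"

text \<open>The bracket equals \<open>a\<^sup>2 (b / a)'\<close>.\<close>

lemma local_bracket_order:
  assumes "a \<noteq> 0" "b \<noteq> 0" "fls_subdegree b \<noteq> fls_subdegree a"
  shows "local_bracket a b \<noteq> 0"
    "fls_subdegree (local_bracket a b) = fls_subdegree a + fls_subdegree b - 1"
proof -
  interpret derivation "fls_deriv :: complex fls \<Rightarrow> _" by unfold_locales simp_all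
  have e: "local_bracket a b = a ^ 2 * fls_deriv (b / a)"
    using assms by (simp add: local_bracket_def d_divide mult.commute)
  have d: "fls_subdegree (b / a) = fls_subdegree b - fls_subdegree a"
    using assms by (simp add: fls_divide_subdegree)
  then have "fls_subdegree (fls_deriv (b / a)) = fls_subdegree b - fls_subdegree a - 1"
    using assms by (simp add: fls_subdegree_deriv)
  moreover have "fls_deriv (b / a) \<noteq> 0"
  proof
    assume "fls_deriv (b / a) = 0"
    then have "b / a = fls_const (fls_nth (b / a) 0)" by (simp only: fls_deriv_eq_0_iff)
    then have "fls_subdegree (b / a) = 0" by (metis fls_const_subdegree)
    with d assms(3) show False by simp
  qed
  ultimately show "local_bracket a b \<noteq> 0"
    "fls_subdegree (local_bracket a b) = fls_subdegree a + fls_subdegree b - 1"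
    unfolding e using assms by (simp_all add: fls_subdegree_pow)
qed

lemma local_bracket_iterate:
  assumes "a \<noteq> 0" "b \<noteq> 0" "fls_subdegree a \<le> 0" "fls_subdegree b < fls_subdegree a"
  shows "(local_bracket a ^^ k) b \<noteq> 0 \<and> fls_subdegree ((local_bracket a ^^ k) b) \<le> fls_subdegree b - int k"
proof (induction k)
  case 0
  then show ?case using assms by simp
next
  case (Suc k)
  then show ?case
    using local_bracket_order [of a "(local_bracket a ^^ k) b"] assms by auto
qed

lemma local_bracket_hom: "module_hom fls_scale fls_scale (\<lambda>x. local_bracket x y)"
  "module_hom fls_scale fls_scale (\<lambda>y. local_bracket x y)"
proof -
  interpret module fls_scale by (rule module_fls_scale)
  show "module_hom fls_scale fls_scale (\<lambda>x. local_bracket x y)"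
    "module_hom fls_scale fls_scale (\<lambda>y. local_bracket x y)"
    by unfold_locales (simp_all add: local_bracket_def fls_scale_def algebra_simps)
qed

text \<open>For series \<open>x\<close> and \<open>Y\<close> in a local parameter \<open>u\<close> that satisfy the equation of the curve,
  the expansion of \<open>V\<^sub>n\<close> as a multiple of \<open>d/du\<close>. The central element is sent to zero.\<close>

definition expansion :: "complex fls \<Rightarrow> complex fls \<Rightarrow> vir_basis \<Rightarrow> complex fls" where
  "expansion x Y i = (case i of Ell n \<Rightarrow> cubic_vf x Y n / fls_deriv x | Cen \<Rightarrow> 0)"

lemma expansion_bracket:
  assumes x: "x \<noteq> 0" "fls_deriv x \<noteq> 0" and Y: "Y \<noteq> 0"
    and Y2: "Y ^ 2 = 4 * x * (x ^ 2 + fls_const p * x + fls_const q)"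
  shows "lin_ext fls_scale (expansion x Y) (bilin_ext (std_str p q) z w) =
    local_bracket (lin_ext fls_scale (expansion x Y) z) (lin_ext fls_scale (expansion x Y) w)"
proof (rule lin_ext_bilin_ext [OF module_fls_scale local_bracket_hom])
  let ?d = "\<lambda>g. fls_deriv g / fls_deriv x"
  interpret derivation ?d by (rule derivation_fls)
  interpret cubic ?d x Y "fls_const p" "fls_const q"
    by unfold_locales (simp_all add: x Y Y2)
  have br: "local_bracket (a / fls_deriv x) (b / fls_deriv x) = (a * ?d b - b * ?d a) / fls_deriv x" for a b
  proof -
    interpret D: derivation "fls_deriv :: complex fls \<Rightarrow> _" by unfold_locales simp_all
    show ?thesis
      using x(2) unfolding local_bracket_def by (simp add: D.d_divide field_simps power2_eq_square)
  qed
  note l = lin_ext_add [OF module_fls_scale] lin_ext_single [OF module_fls_scale] lin_ext_zero [OF module_fls_scale]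
  fix i j
  show "lin_ext fls_scale (expansion x Y) (std_str p q i j) = local_bracket (expansion x Y i) (expansion x Y j)"
  proof (cases i; cases j)
    fix n m assume ij: "i = Ell n" "j = Ell m"
    show ?thesis
      unfolding ij std_str_def hat_str.simps l expansion_def vir_basis.case br bracket_cubic_vf
      unfolding fls_scale_def fls_of_int fls_const_mult_const
      by (simp add: add_divide_distrib)
  qed (simp_all add: std_str_def l expansion_def local_bracket_def)
qed

lemma expansion_sum:
  "lin_ext fls_scale (expansion x Y) z = (\<Sum>n\<in>{n. Ell n \<in> Poly_Mapping.keys z}.
     fls_const (Poly_Mapping.lookup z (Ell n)) * (cubic_vf x Y n / fls_deriv x))"
proof -
  let ?S = "{n. Ell n \<in> Poly_Mapping.keys z}"
  have "lin_ext fls_scale (expansion x Y) z =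
      (\<Sum>i\<in>Ell ` ?S. fls_scale (Poly_Mapping.lookup z i) (expansion x Y i))"
    unfolding lin_ext_def
  proof (rule sum.mono_neutral_right)
    show "\<forall>i\<in>Poly_Mapping.keys z - Ell ` ?S. fls_scale (Poly_Mapping.lookup z i) (expansion x Y i) = 0"
    proof
      fix i assume "i \<in> Poly_Mapping.keys z - Ell ` ?S"
      then show "fls_scale (Poly_Mapping.lookup z i) (expansion x Y i) = 0"
        by (cases i) (auto simp: expansion_def fls_scale_def)
    qed
  qed auto
  then show ?thesis
    by (simp add: sum.reindex inj_on_def expansion_def fls_scale_def)
qed

lemma finite_Ell_keys: "finite {n. Ell n \<in> Poly_Mapping.keys z}"
  using finite_vimageI [OF finite_keys [of z], of Ell] by (simp add: inj_def vimage_def)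

text \<open>A vector field that does not vanish at a point of the curve is not locally finite: its
  brackets with a vector field with a high-order pole there have poles of unbounded order.\<close>

lemma loc_finite_vanishes:
  assumes x: "x \<noteq> 0" "fls_deriv x \<noteq> 0" and Y: "Y \<noteq> 0"
    and Y2: "Y ^ 2 = 4 * x * (x ^ 2 + fls_const p * x + fls_const q)"
    and unb: "\<And>N. \<exists>n. fls_subdegree (cubic_vf x Y n / fls_deriv x) < N"
    and lf: "loc_finite (bilin_ext (std_str p q) h)" and d: "d \<le> 0"
  shows "fls_nth (lin_ext fls_scale (expansion x Y) h) d = 0"
proof (rule ccontr)
  let ?\<rho> = "lin_ext fls_scale (expansion x Y)"
  let ?B = "bilin_ext (std_str p q) h"
  assume nz: "fls_nth (?\<rho> h) d \<noteq> 0"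
  then have h: "?\<rho> h \<noteq> 0" "fls_subdegree (?\<rho> h) \<le> 0"
    using d fls_subdegree_leI [of "?\<rho> h" d] by auto
  obtain n where n: "fls_subdegree (cubic_vf x Y n / fls_deriv x) < fls_subdegree (?\<rho> h)"
    using unb by blast
  define y where "y = Poly_Mapping.single (Ell n) (1 :: complex)"
  have y: "?\<rho> y = cubic_vf x Y n / fls_deriv x"
    unfolding y_def lin_ext_single [OF module_fls_scale] by (simp add: fls_scale_def expansion_def)
  have y0: "?\<rho> y \<noteq> 0"
    unfolding y using x Y by (simp add: cubic_vf_def)
  obtain T where T: "finite T" "\<And>k. Poly_Mapping.keys ((?B ^^ k) y) \<subseteq> T"
    using lf unfolding loc_finite_def by metis
  have it: "?\<rho> ((?B ^^ k) y) = (local_bracket (?\<rho> h) ^^ k) (?\<rho> y)" for k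
    by (induction k) (simp_all add: expansion_bracket [OF x Y Y2])
  define M where "M = Min (insert 0 (fls_subdegree ` expansion x Y ` T))"
  have M: "M \<le> fls_subdegree (expansion x Y i)" if "i \<in> T" for i
    unfolding M_def using T(1) that by (intro Min_le) auto
  have below: "fls_nth (?\<rho> ((?B ^^ k) y)) e = 0" if "e < M" for k e
  proof -
    have "fls_nth (fls_const c * expansion x Y i) e = 0" if "i \<in> T" for i c
      using M [OF that] \<open>e < M\<close> by simp
    then show ?thesis
      unfolding lin_ext_superset [OF module_fls_scale T(1) T(2)] fls_nth_sum fls_scale_def
      by (intro sum.neutral) blast
  qed
  define k where "k = nat (fls_subdegree (?\<rho> y) - M + 1)"
  have "(local_bracket (?\<rho> h) ^^ k) (?\<rho> y) \<noteq> 0"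
    "fls_subdegree ((local_bracket (?\<rho> h) ^^ k) (?\<rho> y)) \<le> fls_subdegree (?\<rho> y) - int k"
    using local_bracket_iterate [OF h(1) y0 h(2), of k] n by (simp_all add: y)
  moreover have "fls_subdegree (?\<rho> y) - int k < M" unfolding k_def by simp
  ultimately show False
    using below [of "fls_subdegree ((local_bracket (?\<rho> h) ^^ k) (?\<rho> y))" k] by (simp add: it)
qed

text \<open>If a combination of series of distinct orders has no coefficients in degrees \<open>\<le> 0\<close>, neither
  has any of its terms.\<close>

lemma orders_positive:
  fixes v :: "int \<Rightarrow> complex fls"
  assumes "finite K" "inj_on (\<lambda>n. fls_subdegree (v n)) K" "\<And>n. n \<in> K \<Longrightarrow> v n \<noteq> 0 \<and> c n \<noteq> 0"
    and z: "\<And>d. d \<le> 0 \<Longrightarrow> fls_nth (\<Sum>n\<in>K. fls_const (c n) * v n) d = 0" and j: "j \<in> K"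
  shows "fls_subdegree (v j) \<ge> 1"
proof -
  have "K \<noteq> {}" using j by blast
  then obtain i where i: "i \<in> K" "\<And>j. j \<in> K \<Longrightarrow> fls_subdegree (v i) \<le> fls_subdegree (v j)"
    "fls_nth (\<Sum>n\<in>K. fls_const (c n) * v n) (fls_subdegree (v i)) \<noteq> 0"
    using fls_sum_leading [OF assms(1) _ assms(2), of c] assms(3) by metis
  then have "fls_subdegree (v i) > 0" using z by (meson not_le)
  with i(2) [OF j] show ?thesis by simp
qed

lemma fls_sqrt_exists:
  assumes "fps_nth a 0 \<noteq> (0 :: complex)"
  obtains S :: "complex fls" where "S ^ 2 = fps_to_fls a" "S \<noteq> 0" "fls_subdegree S = 0"
proof -
  have "fps_radical (\<lambda>_. csqrt) 2 a ^ 2 = a"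
    using power_radical [OF assms, of "\<lambda>_. csqrt" 1] by (simp add: numeral_2_eq_2 [symmetric])
  then have r: "fps_to_fls (fps_radical (\<lambda>_. csqrt) 2 a) ^ 2 = fps_to_fls a"
    by (simp only: fps_to_fls_power [symmetric])
  have "subdegree a = 0" "a \<noteq> 0" using assms by auto
  then have "fls_subdegree (fps_to_fls (fps_radical (\<lambda>_. csqrt) 2 a) ^ 2) = 0" "fps_to_fls a \<noteq> 0"
    unfolding r by (simp_all add: fls_subdegree_fls_to_fps)
  moreover have "fls_subdegree (fps_to_fls (fps_radical (\<lambda>_. csqrt) 2 a) ^ 2)
      = 2 * fls_subdegree (fps_to_fls (fps_radical (\<lambda>_. csqrt) 2 a))"
    by (simp only: fls_subdegree_pow of_nat_numeral)
  ultimately show ?thesis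
    using r by (intro that [OF r]) auto
qed

lemma loc_finite_at_infinity:
  assumes lf: "loc_finite (bilin_ext (std_str (pcoef s) (qcoef s)) h)" and n: "Ell n \<in> Poly_Mapping.keys h"
  shows "n \<le> 0"
proof -
  let ?x = "cx s 1" and ?Y = "cY s 1"
  have dx: "fls_deriv ?x = fls_deriv cX" by (simp add: cx_def)
  have dd: "fls_subdegree (fls_deriv cX) = - 3"
    using fls_subdegree_deriv [of cX] by (simp add: cX_subdegree)
  have sub: "fls_subdegree (cubic_vf ?x ?Y n / fls_deriv ?x) = 1 - n" for n
    using V_nz [of s 1 n] V_subdegree [of s 1 n]
    by (simp add: V_cubic [symmetric] dx fls_divide_subdegree dd)
  have nz: "cubic_vf ?x ?Y n / fls_deriv ?x \<noteq> 0" for n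
    using V_nz [of s 1 n] by (simp add: V_cubic [symmetric] dx)
  have Y2: "?Y ^ 2 = 4 * ?x * (?x ^ 2 + fls_const (pcoef s) * ?x + fls_const (qcoef s))"
    using cY_cubic [of s 1] by simp
  have "\<exists>n. 1 - n < N" for N :: int by presburger
  then have unb: "\<exists>n. fls_subdegree (cubic_vf ?x ?Y n / fls_deriv ?x) < N" for N
    unfolding sub .
  have "1 \<le> fls_subdegree (cubic_vf ?x ?Y n / fls_deriv ?x)"
  proof (rule orders_positive [OF finite_Ell_keys])
    show "fls_nth (\<Sum>n\<in>{n. Ell n \<in> Poly_Mapping.keys h}. fls_const (Poly_Mapping.lookup h (Ell n))
        * (cubic_vf ?x ?Y n / fls_deriv ?x)) d = 0" if "d \<le> 0" for d
      unfolding expansion_sum [symmetric]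
      by (rule loc_finite_vanishes [OF _ _ _ Y2 unb lf that]) (simp_all add: dx)
  qed (use n nz in \<open>auto simp: inj_on_def sub in_keys_iff\<close>)
  then show ?thesis by (simp add: sub)
qed

text \<open>At \<open>(e\<^sub>1, 0)\<close> there are two cases: a nonsingular point, with local parameter \<open>u\<close>,
  \<open>X - e\<^sub>1 = u\<^sup>2\<close>, if \<open>q \<noteq> 0\<close>; and a node with the two
  branches \<open>Y = \<plusminus> 2 x sqrt (x + p)\<close> if \<open>q = 0\<close> and \<open>p \<noteq> 0\<close>. On a single branch of the node an
  even and an odd \<open>V\<^sub>n\<close> may have the same order; half the sum and half the difference of the two
  expansions separate the even from the odd indices.\<close>

lemma loc_finite_at_e1_smooth:
  assumes q: "q \<noteq> 0" and lf: "loc_finite (bilin_ext (std_str p q) h)" and n: "Ell n \<in> Poly_Mapping.keys h"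
  shows "n > 0"
proof -
  obtain S where S: "S ^ 2 = fps_to_fls (fps_const q + fps_const p * fps_X ^ 2 + fps_X ^ 4)"
    "S \<noteq> 0" "fls_subdegree S = 0"
    using fls_sqrt_exists [of "fps_const q + fps_const p * fps_X ^ 2 + fps_X ^ 4"] q by auto
  define x Y :: "complex fls" where "x = fls_X ^ 2" and "Y = 2 * fls_X * S"
  have S2: "S ^ 2 = fls_const q + fls_const p * fls_X ^ 2 + fls_X ^ 4"
    unfolding S by (simp add: fls_times_fps_to_fls fps_to_fls_power)
  have Y2: "Y ^ 2 = 4 * x * (x ^ 2 + fls_const p * x + fls_const q)"
    unfolding x_def Y_def power_mult_distrib S2 by (simp add: algebra_simps flip: power_mult power_add)
  have x: "x \<noteq> 0" "fls_subdegree x = 2" and Y: "Y \<noteq> 0" "fls_subdegree Y = 1"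
    using S by (simp_all add: x_def Y_def)
  have dx: "fls_subdegree (fls_deriv x) = 1"
    using fls_subdegree_deriv [of x] by (simp add: x)
  then have dx0: "fls_deriv x \<noteq> 0" by auto
  have nz: "cubic_vf x Y n / fls_deriv x \<noteq> 0" for n
    using x Y dx0 by (simp add: cubic_vf_def)
  have sub: "fls_subdegree (cubic_vf x Y n / fls_deriv x) = (if odd n then n - 1 else n - 3)" for n
    using x Y dx dx0 by (auto simp: cubic_vf_def fls_divide_subdegree fls_subdegree_pow elim!: oddE evenE)
  have unb: "\<exists>n. fls_subdegree (cubic_vf x Y n / fls_deriv x) < N" for N
    by (rule exI [of _ "2 * min 0 N"]) (simp add: sub)
  have "1 \<le> fls_subdegree (cubic_vf x Y n / fls_deriv x)"
  proof (rule orders_positive [OF finite_Ell_keys])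
    show "fls_nth (\<Sum>n\<in>{n. Ell n \<in> Poly_Mapping.keys h}. fls_const (Poly_Mapping.lookup h (Ell n))
        * (cubic_vf x Y n / fls_deriv x)) d = 0" if "d \<le> 0" for d
      unfolding expansion_sum [symmetric]
      by (rule loc_finite_vanishes [OF x(1) dx0 Y(1) Y2 unb lf that])
    show "inj_on (\<lambda>n. fls_subdegree (cubic_vf x Y n / fls_deriv x)) {n. Ell n \<in> Poly_Mapping.keys h}"
      unfolding sub inj_on_def by (auto split: if_splits; presburger)
  qed (use n nz in \<open>auto simp: in_keys_iff\<close>)
  then show ?thesis by (simp add: sub split: if_splits)
qed

lemma loc_finite_at_e1_node:
  assumes p: "p \<noteq> 0" and lf: "loc_finite (bilin_ext (std_str p 0) h)" and n: "Ell n \<in> Poly_Mapping.keys h"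
  shows "n > 0"
proof -
  obtain S where S: "S ^ 2 = fps_to_fls (fps_const p + fps_X)"
    "S \<noteq> 0" "fls_subdegree S = 0"
    using fls_sqrt_exists [of "fps_const p + fps_X"] p by auto
  define x Y :: "complex fls" where "x = fls_X" and "Y = 2 * fls_X * S"
  have S2: "S ^ 2 = fls_const p + fls_X"
    unfolding S by simp
  have Y2: "Y ^ 2 = 4 * x * (x ^ 2 + fls_const p * x + fls_const 0)"
    unfolding x_def Y_def power_mult_distrib S2 by (simp add: algebra_simps power2_eq_square)
  then have Y2': "(- Y) ^ 2 = 4 * x * (x ^ 2 + fls_const p * x + fls_const 0)" by simp
  have x: "x \<noteq> 0" "fls_subdegree x = 1" "fls_deriv x = 1" and Y: "Y \<noteq> 0" "fls_subdegree Y = 1"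
    using S by (simp_all add: x_def Y_def)
  have neg: "cubic_vf x (- Y) n = (if odd n then - cubic_vf x Y n else cubic_vf x Y n)" for n
    by (simp add: cubic_vf_def)
  have nz: "cubic_vf x Y n \<noteq> 0" for n
    using x Y by (simp add: cubic_vf_def)
  have sub: "fls_subdegree (cubic_vf x Y n) = (if odd n then (n + 1) div 2 else n div 2)" for n
    using x Y by (auto simp: cubic_vf_def fls_divide_subdegree fls_subdegree_pow elim!: oddE evenE)
  have unb: "\<exists>n. fls_subdegree (cubic_vf x Y n / fls_deriv x) < N" for N
    by (rule exI [of _ "2 * (N - 1)"]) (simp add: sub x)
  have unb': "\<exists>n. fls_subdegree (cubic_vf x (- Y) n / fls_deriv x) < N" for N
    by (rule exI [of _ "2 * (N - 1)"]) (simp add: neg sub x)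
  let ?K = "{n. Ell n \<in> Poly_Mapping.keys h}" and ?c = "\<lambda>n. Poly_Mapping.lookup h (Ell n)"
  define A where "A = (\<Sum>n\<in>{n\<in>?K. even n}. fls_const (?c n) * cubic_vf x Y n)"
  define B where "B = (\<Sum>n\<in>{n\<in>?K. odd n}. fls_const (?c n) * cubic_vf x Y n)"
  have split: "(\<Sum>n\<in>?K. f n) = (\<Sum>n\<in>{n\<in>?K. even n}. f n) + (\<Sum>n\<in>{n\<in>?K. odd n}. f n)" for f :: "int \<Rightarrow> complex fls"
  proof -
    have "sum f ({n\<in>?K. even n} \<union> {n\<in>?K. odd n}) = sum f {n\<in>?K. even n} + sum f {n\<in>?K. odd n}"
      by (rule sum.union_disjoint) (use finite_Ell_keys [of h] in auto)
    moreover have "{n\<in>?K. even n} \<union> {n\<in>?K. odd n} = ?K" by blast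
    ultimately show ?thesis by (simp only:)
  qed
  have fin: "finite {n\<in>?K. P n}" for P
    by (rule finite_subset [OF _ finite_Ell_keys [of h]]) blast
  have AB: "lin_ext fls_scale (expansion x Y) h = A + B"
    unfolding expansion_sum split A_def B_def x by simp
  have AB': "lin_ext fls_scale (expansion x (- Y)) h = A - B"
    unfolding expansion_sum split A_def B_def x by (simp add: neg sum_negf)
  have "fls_nth (A + B) d = 0" "fls_nth (A - B) d = 0" if "d \<le> 0" for d
    using loc_finite_vanishes [OF x(1) _ Y(1) Y2 unb lf that]
      loc_finite_vanishes [OF x(1) _ _ Y2' unb' lf that] Y(1) unfolding AB AB' by (simp_all add: x)
  then have 0: "fls_nth A d = 0" "fls_nth B d = 0" if "d \<le> 0" for d
    using that by (fastforce simp: add_eq_0_iff)+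
  show ?thesis
  proof (cases "even n")
    case True
    have "1 \<le> fls_subdegree (cubic_vf x Y n)"
    proof (rule orders_positive [of "{n\<in>?K. even n}"])
      show "fls_nth (\<Sum>n\<in>{n\<in>?K. even n}. fls_const (?c n) * cubic_vf x Y n) d = 0" if "d \<le> 0" for d
        using 0(1) [OF that] by (simp add: A_def)
      show "inj_on (\<lambda>n. fls_subdegree (cubic_vf x Y n)) {n\<in>?K. even n}"
        unfolding sub inj_on_def by auto
    qed (use n nz True fin [of even] in \<open>auto simp: in_keys_iff\<close>)
    then show ?thesis using True by (simp add: sub)
  next
    case False
    have "1 \<le> fls_subdegree (cubic_vf x Y n)"
    proof (rule orders_positive [of "{n\<in>?K. odd n}"])
      show "fls_nth (\<Sum>n\<in>{n\<in>?K. odd n}. fls_const (?c n) * cubic_vf x Y n) d = 0" if "d \<le> 0" for d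
        using 0(2) [OF that] by (simp add: B_def)
      show "inj_on (\<lambda>n. fls_subdegree (cubic_vf x Y n)) {n\<in>?K. odd n}"
        unfolding sub inj_on_def by (auto elim!: oddE)
    qed (use n nz False fin [of odd] in \<open>auto simp: in_keys_iff\<close>)
    then have "0 \<le> n" using False by (simp add: sub)
    then show ?thesis using False by presburger
  qed
qed

text \<open>In the fibre over \<open>t = 1\<close>, the elements with locally finite adjoint action are central.\<close>

lemma loc_finite_central:
  assumes "loc_finite (bilin_ext (std_str (pcoef s) (qcoef s)) h)"
  shows "bilin_ext (std_str (pcoef s) (qcoef s)) h z = 0"
proof -
  have "Ell n \<notin> Poly_Mapping.keys h" for n
  proof
    assume n: "Ell n \<in> Poly_Mapping.keys h"
    have "n > 0"
    proof (cases "qcoef s = 0")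
      case True
      then show ?thesis using loc_finite_at_e1_node [of "pcoef s" h n] pq_nonzero [of s] assms n by simp
    next
      case False
      then show ?thesis using loc_finite_at_e1_smooth assms n by blast
    qed
    with loc_finite_at_infinity [OF assms n] show False by simp
  qed
  then have "i = Cen" if "i \<in> Poly_Mapping.keys h" for i
    using that by (cases i) auto
  moreover have "std_str (pcoef s) (qcoef s) Cen j = 0" for j by (simp add: std_str_def)
  ultimately have "Poly_Mapping.lookup (bilin_ext (std_str (pcoef s) (qcoef s)) h z) k = 0" for k
    unfolding lookup_bilin_ext by (intro sum.neutral ballI) (metis lookup_zero mult_zero_right)
  then show ?thesis by (intro poly_mapping_eqI) simp
qed

section \<open>Nontriviality\<close>

lemma not_equivalent_trivial:
  "\<not> equivalent_deformations (\<lambda>p. poly p 0) (bilin_ext (std_family s))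
      (trivial_deformation (\<lambda>c. [:c:]) virasoro)"
proof
  let ?F = "bilin_ext (std_family s)" and ?T = "trivial_deformation (\<lambda>c. [:c:]) virasoro"
  let ?ev = "Poly_Mapping.map (\<lambda>p. poly p (1 :: complex)) :: (vir_basis \<Rightarrow>\<^sub>0 complex poly) \<Rightarrow> _"
  let ?B = "bilin_ext (std_str (pcoef s) (qcoef s))"
  assume "equivalent_deformations (\<lambda>p. poly p 0) ?F ?T"
  then obtain \<phi> where \<phi>: "lie_iso (free_lie ?F) (free_lie ?T) \<phi>"
    unfolding equivalent_deformations_def by blast
  define \<psi> where "\<psi> = the_inv_into UNIV \<phi>"
  have \<psi>: "lie_iso (free_lie ?T) (free_lie ?F) \<psi>"
    using lie_iso_sym [OF lie_algebra_std_family \<phi>] by (simp add: \<psi>_def free_lie_def)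
  have bij: "bij \<phi>" using \<phi> by (simp add: lie_iso_def free_lie_def)
  have \<psi>\<phi>: "\<psi> (\<phi> x) = x" for x
    unfolding \<psi>_def using bij by (intro the_inv_into_f_f) (auto simp: bij_def)
  have \<phi>\<psi>: "\<phi> (\<psi> x) = x" for x
    unfolding \<psi>_def using bij by (intro f_the_inv_into_f) (auto simp: bij_def)
  have hom: "module_hom pm_scale pm_scale \<psi>"
    using \<psi> unfolding module_hom_def module_hom_axioms_def lie_iso_def free_lie_def by (simp add: module_pm_scale)
  have \<psi>_br: "\<psi> (?T x y) = ?F (\<psi> x) (\<psi> y)" for x y
    using \<psi> by (simp add: lie_iso_def free_lie_def)
  have \<phi>_sc: "\<phi> (pm_scale a x) = pm_scale a (\<phi> x)" for a x
    using \<phi> by (simp add: lie_iso_def free_lie_def)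
  define g where "g i = \<psi> (Poly_Mapping.single i 1)" for i
  define cc :: "vir_basis \<Rightarrow> complex poly" where "cc i = (case i of Ell m \<Rightarrow> of_int m | Cen \<Rightarrow> 0)" for i
  have eig: "?F (g (Ell 0)) (g i) = pm_scale (cc i) (g i)" for i
  proof -
    interpret module "pm_scale :: complex poly \<Rightarrow> (vir_basis \<Rightarrow>\<^sub>0 complex poly) \<Rightarrow> _" by (rule module_pm_scale)
    interpret c: module "pm_scale :: complex \<Rightarrow> (vir_basis \<Rightarrow>\<^sub>0 complex) \<Rightarrow> _" by (rule module_pm_scale)
    have "virasoro (Poly_Mapping.single (Ell 0) 1) (Poly_Mapping.single i 1) = vir_str (Ell 0) i"
      by (simp add: virasoro_def bilin_ext_single)
    also have "\<dots> = Poly_Mapping.single i (case i of Ell m \<Rightarrow> of_int m | Cen \<Rightarrow> 0)"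
      by (cases i) simp_all
    finally have v: "virasoro (Poly_Mapping.single (Ell 0) 1) (Poly_Mapping.single i 1)
        = Poly_Mapping.single i (case i of Ell m \<Rightarrow> of_int m | Cen \<Rightarrow> 0)" .
    have "?T (Poly_Mapping.single (Ell 0) 1) (Poly_Mapping.single i 1)
        = Poly_Mapping.single i [:case i of Ell m \<Rightarrow> of_int m | Cen \<Rightarrow> 0:]"
      unfolding trivial_deformation_def bilin_ext_single v by (simp add: pm_map_single)
    also have "\<dots> = pm_scale (cc i) (Poly_Mapping.single i 1)"
      by (rule poly_mapping_eqI)
         (simp add: cc_def lookup_single when_def of_int_poly split: vir_basis.split)
    finally show ?thesis
      unfolding g_def \<psi>_br [symmetric] by (simp add: module_hom.scale [OF hom])
  qed
  have ev_F: "?ev (?F x y) = ?B (?ev x) (?ev y)" for x y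
    using map_bilin_std_family [of 1 s x y] by simp
  have "loc_finite (?B (?ev (g (Ell 0))))"
    unfolding loc_finite_def
  proof
    fix y :: "vir_basis \<Rightarrow>\<^sub>0 complex"
    define y' where "y' = Poly_Mapping.map (\<lambda>c. [:c:]) y"
    have y': "?ev y' = y" by (simp add: y'_def)
    define K where "K = Poly_Mapping.keys (\<phi> y')"
    define a where "a i = Poly_Mapping.lookup (\<phi> y') i" for i
    have "y' = \<psi> (lin_ext pm_scale (\<lambda>i. Poly_Mapping.single i 1) (\<phi> y'))"
      by (simp add: lin_ext_basis \<psi>\<phi>)
    also have "\<dots> = (\<Sum>i\<in>K. pm_scale (a i) (g i))"
      unfolding lin_ext_def module_hom.sum [OF hom] module_hom.scale [OF hom] g_def K_def a_def ..
    finally have exp: "y' = (\<Sum>i\<in>K. pm_scale (a i) (g i))" .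
    have it: "(?F (g (Ell 0)) ^^ k) y' = (\<Sum>i\<in>K. pm_scale (a i * cc i ^ k) (g i))" for k
    proof (induction k)
      case 0
      then show ?case using exp by simp
    next
      case (Suc k)
      interpret module "pm_scale :: complex poly \<Rightarrow> (vir_basis \<Rightarrow>\<^sub>0 complex poly) \<Rightarrow> _" by (rule module_pm_scale)
      show ?case
        by (simp add: Suc module_hom.sum [OF bilin_ext_hom_right] module_hom.scale [OF bilin_ext_hom_right] eig mult_ac)
    qed
    have ev_it: "?ev ((?F (g (Ell 0)) ^^ k) y') = (?B (?ev (g (Ell 0))) ^^ k) y" for k
      by (induction k) (simp_all add: y' ev_F)
    let ?U = "\<Union>i\<in>K. Poly_Mapping.keys (?ev (g i))"
    have "Poly_Mapping.keys ((?B (?ev (g (Ell 0))) ^^ k) y) \<subseteq> ?U" for k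
    proof
      fix b assume b: "b \<in> Poly_Mapping.keys ((?B (?ev (g (Ell 0))) ^^ k) y)"
      show "b \<in> ?U"
      proof (rule ccontr)
        assume nb: "b \<notin> ?U"
        have "Poly_Mapping.lookup ((?B (?ev (g (Ell 0))) ^^ k) y) b =
            (\<Sum>i\<in>K. poly (a i * cc i ^ k) 1 * Poly_Mapping.lookup (?ev (g i)) b)"
          unfolding ev_it [symmetric] it by (simp add: lookup_map0 lookup_sum poly_sum)
        also have "\<dots> = 0" using nb by (intro sum.neutral) (auto simp: in_keys_iff)
        finally show False using b by (simp add: in_keys_iff)
      qed
    qed
    moreover have "finite ?U" by (simp add: K_def)
    ultimately show "\<exists>T. finite T \<and> (\<forall>k. Poly_Mapping.keys ((?B (?ev (g (Ell 0))) ^^ k) y) \<subseteq> T)" by blast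
  qed
  \<comment> \<open>So the preimage of \<open>l\<^sub>0\<close> is central over \<open>t = 1\<close>, and the preimage of
    \<open>l\<^sub>1 = [l\<^sub>0, l\<^sub>1]\<close> vanishes there, that is, is divisible by \<open>t - 1\<close>.\<close>
  then have "?B (?ev (g (Ell 0))) (?ev (g (Ell 1))) = 0" by (rule loc_finite_central)
  moreover have "?F (g (Ell 0)) (g (Ell 1)) = g (Ell 1)"
    by (simp add: eig cc_def) (rule poly_mapping_eqI, simp)
  ultimately have "?ev (g (Ell 1)) = 0" using ev_F [of "g (Ell 0)" "g (Ell 1)"] by simp
  then have root: "poly (Poly_Mapping.lookup (g (Ell 1)) i) 1 = 0" for i
    using lookup_map0 [of "\<lambda>p. poly p (1 :: complex)" "g (Ell 1)" i] by simp
  define z where "z = Poly_Mapping.map (\<lambda>p. p div [:- 1, 1:]) (g (Ell 1))"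
  have "g (Ell 1) = pm_scale [:- 1, 1:] z"
  proof (rule poly_mapping_eqI)
    fix i
    have "[:- 1, 1:] dvd Poly_Mapping.lookup (g (Ell 1)) i"
      using root [of i] by (simp add: poly_eq_0_iff_dvd)
    then show "Poly_Mapping.lookup (g (Ell 1)) i = Poly_Mapping.lookup (pm_scale [:- 1, 1:] z) i"
      by (simp add: z_def lookup_map0 del: mult_pCons_left)
  qed
  then have "Poly_Mapping.single (Ell 1) 1 = pm_scale [:- 1, 1:] (\<phi> z)"
    using \<phi>\<psi> [of "Poly_Mapping.single (Ell 1) 1"] by (simp add: g_def \<phi>_sc)
  then have "(1 :: complex poly) = [:- 1, 1:] * Poly_Mapping.lookup (\<phi> z) (Ell 1)"
    by (metis lookup_pm_scale lookup_single_eq)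
  then have "poly 1 (1 :: complex) = poly ([:- 1, 1:] * Poly_Mapping.lookup (\<phi> z) (Ell 1)) 1" by simp
  then show False by simp
qed

lemma scale_inverse_parameter:
  assumes "t \<noteq> 0"
  obtains r :: complex where "r \<noteq> 0" "t * r ^ 2 = 1" "t ^ 2 * r ^ 4 = 1"
proof
  let ?r = "csqrt (inverse t)"
  have r: "?r ^ 2 = inverse t" by (rule power2_csqrt)
  have "?r ^ 4 = (?r ^ 2) ^ 2" by (simp add: power_mult [symmetric] del: power2_csqrt)
  then show "t ^ 2 * ?r ^ 4 = 1" unfolding r using assms by (simp add: field_simps power2_eq_square)
  show "t * ?r ^ 2 = 1" unfolding r using assms by simp
  show "?r \<noteq> 0" using assms by simp
qed

theorem mainTheorem3:
  fixes s :: proj_line and ct :: "complex \<Rightarrow> complex" and R :: "complex \<Rightarrow> complex fls"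
  assumes "regular_function ct"
    and "\<And>t. ct t \<noteq> 0"
    and "algebraic_family s R"
  shows "(\<forall>t. lie_algebra (W_hat s ct R t)) \<and>
    (\<exists>fam.
       (\<forall>t. lie_iso (free_lie (fibre fam t)) (W_hat s ct R t)
              (lin_ext (lscale (W_hat s ct R t)) (W_hat_basis s t))) \<and>
       (\<exists>dfm. lie_isomorphic (free_lie fam) (free_lie dfm) \<and>
          global_deformation (\<lambda>c. [:c:]) (\<lambda>p. poly p 0) virasoro dfm \<and>
          \<not> equivalent_deformations (\<lambda>p. poly p 0) dfm
                (trivial_deformation (\<lambda>c. [:c:]) virasoro))) \<and>
    lie_isomorphic (W_hat s ct R 0) (free_lie virasoro) \<and>
    (\<forall>t t'. t \<noteq> 0 \<longrightarrow> t' \<noteq> 0 \<longrightarrow> lie_isomorphic (W_hat s ct R t) (W_hat s ct R t')) \<and>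
    \<not> globally_rigid TYPE(complex poly) virasoro"
proof (intro conjI allI impI)
  show "lie_algebra (W_hat s ct R t)" for t by (rule lie_algebra_W_hat)
next
  let ?fam = "bilin_ext (family_str s (\<lambda>n m. the_poly (\<lambda>t. ct t * gamma s t (R t) (V s t n) (V s t m))))"
  have fib: "lie_iso (free_lie (fibre ?fam t)) (W_hat s ct R t)
      (lin_ext (lscale (W_hat s ct R t)) (W_hat_basis s t))" for t
    unfolding fibre_bilin_ext map_family_str
    using hat_iso_basis [of s t ct R]
    by (simp add: poly_the_poly regular_mult regular_gamma assms)
  show "\<exists>fam.
       (\<forall>t. lie_iso (free_lie (fibre fam t)) (W_hat s ct R t)
              (lin_ext (lscale (W_hat s ct R t)) (W_hat_basis s t))) \<and>
       (\<exists>dfm. lie_isomorphic (free_lie fam) (free_lie dfm) \<and>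
          global_deformation (\<lambda>c. [:c:]) (\<lambda>p. poly p 0) virasoro dfm \<and>
          \<not> equivalent_deformations (\<lambda>p. poly p 0) dfm
                (trivial_deformation (\<lambda>c. [:c:]) virasoro))"
    using fib family_iso_std [OF assms(3,1,2)] global_deformation_std_family not_equivalent_trivial
    by (intro exI [of _ ?fam] conjI allI exI [of _ "bilin_ext (std_family s)"])
next
  have "lie_isomorphic (free_lie virasoro) (W_hat s ct R 0)"
    using hat_iso_std [where r = 1 and t = 0 and s = s and ct = ct and R = R] assms(2) by (simp add: virasoro_std)
  then show "lie_isomorphic (W_hat s ct R 0) (free_lie virasoro)"
    by (rule lie_isomorphic_sym [OF lie_algebra_virasoro])
next
  have std: "lie_isomorphic (free_lie (bilin_ext (std_str (pcoef s) (qcoef s)))) (W_hat s ct R t)"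
    if t: "t \<noteq> 0" for t
  proof -
    obtain r where r: "r \<noteq> 0" "t * r ^ 2 = 1" "t ^ 2 * r ^ 4 = 1"
      by (rule scale_inverse_parameter [OF t])
    have e: "pcoef s * t * r ^ 2 = pcoef s" "qcoef s * t ^ 2 * r ^ 4 = qcoef s"
      using r by (simp_all add: mult.assoc)
    show ?thesis
      using hat_iso_std [where r = r and t = t and s = s and ct = ct and R = R, OF r(1) assms(2)] unfolding e .
  qed
  fix t t' :: complex assume "t \<noteq> 0" "t' \<noteq> 0"
  have L: "lie_algebra (free_lie (bilin_ext (std_str (pcoef s) (qcoef s))))"
    using lie_algebra_std [of s 1] by simp
  show "lie_isomorphic (W_hat s ct R t) (W_hat s ct R t')"
    by (rule lie_isomorphic_trans [OF lie_isomorphic_sym [OF L std [OF \<open>t \<noteq> 0\<close>]] std [OF \<open>t' \<noteq> 0\<close>]])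
next
  show "\<not> globally_rigid TYPE(complex poly) virasoro"
    unfolding globally_rigid_def
    using global_deformation_std_family [of s] not_equivalent_trivial [of s] by blast
qed

end
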